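(* Let $(A,\mathcal H)$ be a commutative Hopf algebroid over $\Bbbk$. The isomorphism $$\theta:{}^*\mathcal H\longrightarrow\mathrm{End}^{\mathcal H}(\mathcal H),\qquad\alpha\longmapsto[u\mapsto u_1t(\alpha(u_2))]$$ restricts to an isomorphism of $A$-modules $\theta':\mathrm{Der}_\Bbbk^{\,s}(\mathcal H,A_\varepsilon)\to\mathrm{Der}_{\mathcal H}^{\,s}(\mathcal H,\mathcal H)$, i.e. $\theta\circ j=j'\circ\theta'$ for the inclusions $j:\mathrm{Der}_\Bbbk^{\,s}(\mathcal H,A_\varepsilon)\hookrightarrow{}^*\mathcal H$ and $j':\mathrm{Der}_{\mathcal H}^{\,s}(\mathcal H,\mathcal H)\hookrightarrow\mathrm{End}^{\mathcal H}(\mathcal H)$; and the map ${}^*(\pi^s):{}^*(\mathcal I/\mathcal I^2)\to{}^*\mathcal H$, $f\mapsto f\circ\pi^s$, factors as an isomorphism ${}^*(\mathcal I/\mathcal I^2)\cong\mathrm{Der}_\Bbbk^{\,s}(\mathcal H,A_\varepsilon)$ followed by $j$. Moreover, $\mathrm{Der}_\Bbbk^{\,s}(\mathcal H,A_\varepsilon)$ admits a structure of Lie $\Bbbk$-algebra with bracket $$[\delta,\delta']:=\delta*\delta'-\delta'*\delta:\ u\longmapsto\delta\big(u_1t(\delta'(u_2))\big)-\delta'\big(u_1t(\delta(u_2))\big),$$ which turns $\theta'$ into an isomorphism of Lie $\Bbbk$-algebras, and this structure can be transferred to ${}^*(\mathcal I/\mathcal I^2)$ in a unique way making ${}^*(\pi^s)$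 an inclusion of Lie $\Bbbk$-algebras.
   Context: $\Bbbk$ is a field. A commutative Hopf algebroid $(A,\mathcal H)$ over $\Bbbk$ consists of commutative $\Bbbk$-algebras with algebra maps $s,t:A\to\mathcal H$, $\Delta:\mathcal H\to\mathcal H\otimes_A\mathcal H$ ($u\mapsto u_1\otimes_Au_2$), $\varepsilon:\mathcal H\to A$, $\mathcal S:\mathcal H\to\mathcal H$, where $\mathcal H$ is the $A$-bimodule ${}_s\mathcal H_t$ (left via $s$, right via $t$), $\Delta,\varepsilon$ are $A$-bilinear, coassociative and counital, $\mathcal Ss=t$, $\mathcal St=s$, $\mathcal S^2=\mathrm{id}$, $\mathcal S(h_1)h_2=t(\varepsilon(h))$, $h_1\mathcal S(h_2)=s(\varepsilon(h))$. ${}^*\mathcal H$ is the set of left $A$-linear maps $({}_s\mathcal H)\to A$, with product $(\alpha*\beta)(u)=\alpha(u_1t(\beta(u_2)))$ and $A\to{}^*\mathcal H$, $a\mapsto[u\mapsto\varepsilon(u)a]$; ${}^*\mathcal H$ and its subspaces carry the commutator bracket of $*$. $\mathrm{End}^{\mathcal H}(\mathcal H)$ is the ring of endomorphisms of the left $\mathcal H$-comodule $({}_s\mathcal H,\Delta)$, i.e. left $A$-linear $\delta:{}_s\mathcal H\to{}_s\mathcal H$ with $\Delta(\delta(u))=u_1\otimes_A\delta(u_2)$; it is an $A$-ring via $a\mapsto[u\mapsto ut(a)]$, and $\theta$ is an isomorphism of $A$-rings with inverse $\delta\mapsto\varepsilon\circ\delta$. $\mathrm{Der}_\Bbbk^{\,s}(\mathcal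 H,A_\varepsilon)$ is the set of $\Bbbk$-linear $\delta:\mathcal H\to A$ with $\delta\circ s=0$, $\delta(uv)=\varepsilon(u)\delta(v)+\delta(u)\varepsilon(v)$, an $A$-module by $(a\delta)(u)=a\delta(u)$. $\mathrm{Der}_{\mathcal H}^{\,s}(\mathcal H,\mathcal H)$ is the set of $\Bbbk$-linear $\delta:\mathcal H\to\mathcal H$ with $\delta\circ s=0$, $\delta(uv)=\delta(u)v+u\delta(v)$ and $\Delta(\delta(u))=u_1\otimes_A\delta(u_2)$, an $A$-submodule of $\mathrm{End}^{\mathcal H}(\mathcal H)$ (with $(a\delta)(u)=\delta(u)t(a)$) and a Lie algebra with the commutator bracket of composition. $\mathcal I=\ker\varepsilon$; $\mathcal I/\mathcal I^2$ is an $A$-module via $s$, ${}^*(\mathcal I/\mathcal I^2)$ is its $A$-linear dual, and $\pi^s:\mathcal H\to\mathcal I/\mathcal I^2$, $u\mapsto(u-s(\varepsilon(u)))+\mathcal I^2$. *)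

theory Defs
  imports "HOL-Algebra.QuotRing" "HOL-Algebra.Ideal_Product" "HOL-Algebra.Module"
    "HOL-Algebra.Free_Abelian_Groups"
begin

text \<open>
  Conventions. Everything lives in the carrier-based setting of HOL-Algebra. A map with domain
  \<open>C\<close> that is an element of a module or ring of maps is extensional (\<^const>\<open>undefined\<close> off \<open>C\<close>),
  so that equality of HOL functions is equality of maps. \<^typ>\<open>('a, 'b) module\<close> also
  carries the ring operations; they play no role in records used only as modules.
\<close>

section \<open>Modules, algebras, Lie algebras\<close>

definition alg_hom :: "'k ring \<Rightarrow> ('k, 'a) module \<Rightarrow> ('k, 'b) module \<Rightarrow> ('a \<Rightarrow> 'b) set" where
  "alg_hom K R S = {f \<in> ring_hom R S.
     \<forall>k\<in>carrier K. \<forall>x\<in>carrier R. f (k \<odot>\<^bsub>R\<^esub> x) = k \<odot>\<^bsub>S\<^esub> f x}"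

definition lin_maps ::
  "('a, 'c) ring_scheme \<Rightarrow> ('a, 'm, 'd) module_scheme \<Rightarrow> ('a, 'n, 'e) module_scheme \<Rightarrow> ('m \<Rightarrow> 'n) set" where
  "lin_maps R M N = {f \<in> carrier M \<rightarrow> carrier N.
     (\<forall>x\<in>carrier M. \<forall>y\<in>carrier M. f (x \<oplus>\<^bsub>M\<^esub> y) = f x \<oplus>\<^bsub>N\<^esub> f y) \<and>
     (\<forall>a\<in>carrier R. \<forall>x\<in>carrier M. f (a \<odot>\<^bsub>M\<^esub> x) = a \<odot>\<^bsub>N\<^esub> f x)}"

definition module_iso ::
  "('a, 'c) ring_scheme \<Rightarrow> ('a, 'm, 'd) module_scheme \<Rightarrow> ('a, 'n, 'e) module_scheme \<Rightarrow> ('m \<Rightarrow> 'n) \<Rightarrow> bool" where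
  "module_iso R M N f \<longleftrightarrow> module R M \<and> module R N \<and>
     f \<in> lin_maps R M N \<and> bij_betw f (carrier M) (carrier N)"

text \<open>The target ring of an \<open>A\<close>-ring is in general noncommutative, and the image of \<open>A\<close> need
  not be central.\<close>

definition A_ring :: "('a, 'c) ring_scheme \<Rightarrow> ('r, 'd) ring_scheme \<Rightarrow> ('a \<Rightarrow> 'r) \<Rightarrow> bool" where
  "A_ring A R i \<longleftrightarrow> ring R \<and> i \<in> ring_hom A R"

definition A_ring_iso ::
  "('a, 'c) ring_scheme \<Rightarrow> ('r, 'd) ring_scheme \<Rightarrow> ('a \<Rightarrow> 'r) \<Rightarrow>
     ('s, 'e) ring_scheme \<Rightarrow> ('a \<Rightarrow> 's) \<Rightarrow> ('r \<Rightarrow> 's) \<Rightarrow> bool" where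
  "A_ring_iso A R i S j f \<longleftrightarrow> A_ring A R i \<and> A_ring A S j \<and>
     f \<in> ring_iso R S \<and> (\<forall>a\<in>carrier A. f (i a) = j a)"

definition commutator :: "('r, 'd) ring_scheme \<Rightarrow> 'r \<Rightarrow> 'r \<Rightarrow> 'r" where
  "commutator R x y = x \<otimes>\<^bsub>R\<^esub> y \<ominus>\<^bsub>R\<^esub> y \<otimes>\<^bsub>R\<^esub> x"

definition lie_algebra :: "'k ring \<Rightarrow> ('k, 'v) module \<Rightarrow> ('v \<Rightarrow> 'v \<Rightarrow> 'v) \<Rightarrow> bool" where
  "lie_algebra K V br \<longleftrightarrow> field K \<and> module K V \<and>
     br \<in> carrier V \<rightarrow> carrier V \<rightarrow> carrier V \<and>
     (\<forall>x\<in>carrier V. \<forall>y\<in>carrier V. \<forall>z\<in>carrier V.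
        br (x \<oplus>\<^bsub>V\<^esub> y) z = br x z \<oplus>\<^bsub>V\<^esub> br y z \<and>
        br z (x \<oplus>\<^bsub>V\<^esub> y) = br z x \<oplus>\<^bsub>V\<^esub> br z y) \<and>
     (\<forall>k\<in>carrier K. \<forall>x\<in>carrier V. \<forall>y\<in>carrier V.
        br (k \<odot>\<^bsub>V\<^esub> x) y = k \<odot>\<^bsub>V\<^esub> br x y \<and>
        br x (k \<odot>\<^bsub>V\<^esub> y) = k \<odot>\<^bsub>V\<^esub> br x y) \<and>
     (\<forall>x\<in>carrier V. br x x = \<zero>\<^bsub>V\<^esub>) \<and>
     (\<forall>x\<in>carrier V. \<forall>y\<in>carrier V. \<forall>z\<in>carrier V.
        br x (br y z) \<oplus>\<^bsub>V\<^esub> br y (br z x) \<oplus>\<^bsub>V\<^esub> br z (br x y) = \<zero>\<^bsub>V\<^esub>)"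

definition lie_hom ::
  "'k ring \<Rightarrow> ('k, 'v) module \<Rightarrow> ('v \<Rightarrow> 'v \<Rightarrow> 'v) \<Rightarrow>
     ('k, 'w) module \<Rightarrow> ('w \<Rightarrow> 'w \<Rightarrow> 'w) \<Rightarrow> ('v \<Rightarrow> 'w) \<Rightarrow> bool" where
  "lie_hom K V br W br' f \<longleftrightarrow> lie_algebra K V br \<and> lie_algebra K W br' \<and>
     f \<in> lin_maps K V W \<and>
     (\<forall>x\<in>carrier V. \<forall>y\<in>carrier V. f (br x y) = br' (f x) (f y))"

section \<open>Tensor products of commutative rings\<close>

text \<open>
  For commutative rings \<open>R\<close>, \<open>S\<close> that are modules over \<open>A\<close> through \<open>f: A \<rightarrow> R\<close> and \<open>g: A \<rightarrow> S\<close>, the ring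
  \<open>R \<otimes>\<^sub>A S\<close> is the free abelian group on the pairs \<open>(x, y)\<close> modulo biadditivity and
  \<open>(x f(a), y) = (x, g(a) y)\<close>, with the product \<open>(x \<otimes> y)(x' \<otimes> y') = xx' \<otimes> yy'\<close>.
\<close>

definition tensor_relators ::
  "('a, 'c) ring_scheme \<Rightarrow> ('r, 'd) ring_scheme \<Rightarrow> ('a \<Rightarrow> 'r) \<Rightarrow> ('s, 'e) ring_scheme \<Rightarrow> ('a \<Rightarrow> 's) \<Rightarrow>
     ('r \<times> 's \<Rightarrow>\<^sub>0 int) set" where
  "tensor_relators A R f S g =
     {frag_of (x \<oplus>\<^bsub>R\<^esub> x', y) - frag_of (x, y) - frag_of (x', y) | x x' y.
        x \<in> carrier R \<and> x' \<in> carrier R \<and> y \<in> carrier S} \<union>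
     {frag_of (x, y \<oplus>\<^bsub>S\<^esub> y') - frag_of (x, y) - frag_of (x, y') | x y y'.
        x \<in> carrier R \<and> y \<in> carrier S \<and> y' \<in> carrier S} \<union>
     {frag_of (x \<otimes>\<^bsub>R\<^esub> f a, y) - frag_of (x, g a \<otimes>\<^bsub>S\<^esub> y) | x a y.
        x \<in> carrier R \<and> a \<in> carrier A \<and> y \<in> carrier S}"

definition tensor_null ::
  "('a, 'c) ring_scheme \<Rightarrow> ('r, 'd) ring_scheme \<Rightarrow> ('a \<Rightarrow> 'r) \<Rightarrow> ('s, 'e) ring_scheme \<Rightarrow> ('a \<Rightarrow> 's) \<Rightarrow>
     ('r \<times> 's \<Rightarrow>\<^sub>0 int) set" where
  "tensor_null A R f S g =
     generate (free_Abelian_group (carrier R \<times> carrier S)) (tensor_relators A R f S g)"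

definition tensor_class ::
  "('a, 'c) ring_scheme \<Rightarrow> ('r, 'd) ring_scheme \<Rightarrow> ('a \<Rightarrow> 'r) \<Rightarrow> ('s, 'e) ring_scheme \<Rightarrow> ('a \<Rightarrow> 's) \<Rightarrow>
     ('r \<times> 's \<Rightarrow>\<^sub>0 int) \<Rightarrow> ('r \<times> 's \<Rightarrow>\<^sub>0 int) set" where
  "tensor_class A R f S g c =
     tensor_null A R f S g #>\<^bsub>free_Abelian_group (carrier R \<times> carrier S)\<^esub> c"

definition pure_tensor ::
  "('a, 'c) ring_scheme \<Rightarrow> ('r, 'd) ring_scheme \<Rightarrow> ('a \<Rightarrow> 'r) \<Rightarrow> ('s, 'e) ring_scheme \<Rightarrow> ('a \<Rightarrow> 's) \<Rightarrow>
     'r \<Rightarrow> 's \<Rightarrow> ('r \<times> 's \<Rightarrow>\<^sub>0 int) set" where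
  "pure_tensor A R f S g x y = tensor_class A R f S g (frag_of (x, y))"

definition tensor_ring ::
  "('a, 'c) ring_scheme \<Rightarrow> ('r, 'd) ring_scheme \<Rightarrow> ('a \<Rightarrow> 'r) \<Rightarrow> ('s, 'e) ring_scheme \<Rightarrow> ('a \<Rightarrow> 's) \<Rightarrow>
     ('r \<times> 's \<Rightarrow>\<^sub>0 int) set ring" where
  "tensor_ring A R f S g =
     (let Q = free_Abelian_group (carrier R \<times> carrier S) Mod tensor_null A R f S g
      in \<lparr>carrier = carrier Q,
          monoid.mult = (\<lambda>z w. \<Union>c\<in>z. \<Union>d\<in>w. tensor_class A R f S g
             (frag_extend (\<lambda>(x, y). frag_extend (\<lambda>(x', y').
                frag_of (x \<otimes>\<^bsub>R\<^esub> x', y \<otimes>\<^bsub>S\<^esub> y')) d) c)),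
          one = pure_tensor A R f S g \<one>\<^bsub>R\<^esub> \<one>\<^bsub>S\<^esub>,
          ring.zero = one Q,
          add = monoid.mult Q\<rparr>)"

text \<open>
  Sweedler notation: for a tensor \<open>z = \<Sum>\<^sub>i x\<^sub>i \<otimes> y\<^sub>i\<close> and a biadditive \<open>A\<close>-balanced map \<open>\<phi>\<close> into the
  additive group of \<open>G\<close>, \<open>sweedler G z \<phi>\<close> is \<open>\<Sum>\<^sub>i \<phi>(x\<^sub>i, y\<^sub>i)\<close>, that is, the value at \<open>z\<close> of the
  homomorphism induced by \<open>\<phi>\<close>. In all uses below \<open>\<phi>\<close> is biadditive and balanced, so that the
  sum does not depend on the representative.
\<close>

definition frag_sum :: "('g, 'd) ring_scheme \<Rightarrow> ('r \<Rightarrow> 's \<Rightarrow> 'g) \<Rightarrow> ('r \<times> 's \<Rightarrow>\<^sub>0 int) \<Rightarrow> 'g" where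
  "frag_sum G \<phi> c =
     (\<Oplus>\<^bsub>G\<^esub>p\<in>Poly_Mapping.keys c. [Poly_Mapping.lookup c p] \<cdot>\<^bsub>G\<^esub> \<phi> (fst p) (snd p))"

definition sweedler :: "('g, 'd) ring_scheme \<Rightarrow> ('r \<times> 's \<Rightarrow>\<^sub>0 int) set \<Rightarrow> ('r \<Rightarrow> 's \<Rightarrow> 'g) \<Rightarrow> 'g" where
  "sweedler G z \<phi> = (THE v. \<forall>c\<in>z. frag_sum G \<phi> c = v)"

section \<open>Commutative Hopf algebroids\<close>

record ('k, 'a, 'h) hopf_algebroid =
  base :: "('k, 'a) module"
  tot :: "('k, 'h) module"
  src :: "'a \<Rightarrow> 'h"
  tgt :: "'a \<Rightarrow> 'h"
  comult :: "'h \<Rightarrow> ('h \<times> 'h \<Rightarrow>\<^sub>0 int) set"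
  counit :: "'h \<Rightarrow> 'a"
  antip :: "'h \<Rightarrow> 'h"

text \<open>\<open>\<H> \<otimes>\<^sub>A \<H>\<close>: the left factor is an \<open>A\<close>-module via the target, the right one via the source.\<close>

definition tens2 :: "('k, 'a, 'h) hopf_algebroid \<Rightarrow> ('h \<times> 'h \<Rightarrow>\<^sub>0 int) set ring" where
  "tens2 \<H> = tensor_ring (base \<H>) (tot \<H>) (tgt \<H>) (tot \<H>) (src \<H>)"

definition pure2 :: "('k, 'a, 'h) hopf_algebroid \<Rightarrow> 'h \<Rightarrow> 'h \<Rightarrow> ('h \<times> 'h \<Rightarrow>\<^sub>0 int) set" where
  "pure2 \<H> = pure_tensor (base \<H>) (tot \<H>) (tgt \<H>) (tot \<H>) (src \<H>)"

text \<open>\<open>(\<H> \<otimes>\<^sub>A \<H>) \<otimes>\<^sub>A \<H>\<close>, where \<open>A\<close> acts on the right of \<open>\<H> \<otimes>\<^sub>A \<H>\<close> through \<open>a \<mapsto> 1 \<otimes> t(a)\<close>.\<close>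

definition tens3 :: "('k, 'a, 'h) hopf_algebroid \<Rightarrow> (('h \<times> 'h \<Rightarrow>\<^sub>0 int) set \<times> 'h \<Rightarrow>\<^sub>0 int) set ring" where
  "tens3 \<H> = tensor_ring (base \<H>)
     (tens2 \<H>) (\<lambda>a. pure2 \<H> \<one>\<^bsub>tot \<H>\<^esub> (tgt \<H> a)) (tot \<H>) (src \<H>)"

definition pure3 :: "('k, 'a, 'h) hopf_algebroid \<Rightarrow>
    ('h \<times> 'h \<Rightarrow>\<^sub>0 int) set \<Rightarrow> 'h \<Rightarrow> (('h \<times> 'h \<Rightarrow>\<^sub>0 int) set \<times> 'h \<Rightarrow>\<^sub>0 int) set" where
  "pure3 \<H> = pure_tensor (base \<H>)
     (tens2 \<H>) (\<lambda>a. pure2 \<H> \<one>\<^bsub>tot \<H>\<^esub> (tgt \<H> a)) (tot \<H>) (src \<H>)"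

text \<open>
  The bimodule structure \<open>a (u \<otimes> v) b = s(a)u \<otimes> v t(b)\<close> of \<open>\<H> \<otimes>\<^sub>A \<H>\<close> is multiplication by
  \<open>s(a) \<otimes> t(b)\<close>, and its \<open>\<k>\<close>-algebra structure is the one induced from \<open>A\<close>; hence
  \<open>comult_ring_hom\<close> and \<open>comult_bilinear\<close> together say that \<open>\<Delta>\<close> is an \<open>A\<close>-bilinear
  \<open>\<k>\<close>-algebra map.
\<close>

locale comm_hopf_algebroid =
  fixes K :: "'k ring" and \<H> :: "('k, 'a, 'h) hopf_algebroid"
  assumes field_K: "field K"
    and algebra_base: "algebra K (base \<H>)"
    and algebra_tot: "algebra K (tot \<H>)"
    and src_hom: "src \<H> \<in> alg_hom K (base \<H>) (tot \<H>)"
    and tgt_hom: "tgt \<H> \<in> alg_hom K (base \<H>) (tot \<H>)"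
    and counit_hom: "counit \<H> \<in> alg_hom K (tot \<H>) (base \<H>)"
    and antip_hom: "antip \<H> \<in> alg_hom K (tot \<H>) (tot \<H>)"
    and comult_ring_hom: "comult \<H> \<in> ring_hom (tot \<H>) (tens2 \<H>)"
    and comult_bilinear:
      "\<lbrakk>a \<in> carrier (base \<H>); b \<in> carrier (base \<H>); u \<in> carrier (tot \<H>)\<rbrakk> \<Longrightarrow>
        comult \<H> (src \<H> a \<otimes>\<^bsub>tot \<H>\<^esub> u \<otimes>\<^bsub>tot \<H>\<^esub> tgt \<H> b) =
        pure2 \<H> (src \<H> a) (tgt \<H> b) \<otimes>\<^bsub>tens2 \<H>\<^esub> comult \<H> u"
    and counit_bilinear:
      "\<lbrakk>a \<in> carrier (base \<H>); b \<in> carrier (base \<H>); u \<in> carrier (tot \<H>)\<rbrakk> \<Longrightarrow>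
        counit \<H> (src \<H> a \<otimes>\<^bsub>tot \<H>\<^esub> u \<otimes>\<^bsub>tot \<H>\<^esub> tgt \<H> b) =
        a \<otimes>\<^bsub>base \<H>\<^esub> counit \<H> u \<otimes>\<^bsub>base \<H>\<^esub> b"
    and coassoc:
      "u \<in> carrier (tot \<H>) \<Longrightarrow>
        sweedler (tens3 \<H>) (comult \<H> u) (\<lambda>x y. pure3 \<H> (comult \<H> x) y) =
        sweedler (tens3 \<H>) (comult \<H> u)
          (\<lambda>x y. sweedler (tens3 \<H>) (comult \<H> y) (\<lambda>y' y''. pure3 \<H> (pure2 \<H> x y') y''))"
    and counit_left:
      "u \<in> carrier (tot \<H>) \<Longrightarrow>
        sweedler (tot \<H>) (comult \<H> u) (\<lambda>x y. src \<H> (counit \<H> x) \<otimes>\<^bsub>tot \<H>\<^esub> y) = u"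
    and counit_right:
      "u \<in> carrier (tot \<H>) \<Longrightarrow>
        sweedler (tot \<H>) (comult \<H> u) (\<lambda>x y. x \<otimes>\<^bsub>tot \<H>\<^esub> tgt \<H> (counit \<H> y)) = u"
    and antip_src: "a \<in> carrier (base \<H>) \<Longrightarrow> antip \<H> (src \<H> a) = tgt \<H> a"
    and antip_tgt: "a \<in> carrier (base \<H>) \<Longrightarrow> antip \<H> (tgt \<H> a) = src \<H> a"
    and antip_antip: "u \<in> carrier (tot \<H>) \<Longrightarrow> antip \<H> (antip \<H> u) = u"
    and antip_left:
      "u \<in> carrier (tot \<H>) \<Longrightarrow>
        sweedler (tot \<H>) (comult \<H> u) (\<lambda>x y. antip \<H> x \<otimes>\<^bsub>tot \<H>\<^esub> y) = tgt \<H> (counit \<H> u)"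
    and antip_right:
      "u \<in> carrier (tot \<H>) \<Longrightarrow>
        sweedler (tot \<H>) (comult \<H> u) (\<lambda>x y. x \<otimes>\<^bsub>tot \<H>\<^esub> antip \<H> y) = src \<H> (counit \<H> u)"

section \<open>Duals, comodule endomorphisms, derivations\<close>

text \<open>\<open>A\<close> as a module over itself, and \<open>\<^sub>s\<H>\<close>.\<close>

definition base_mod :: "('k, 'a, 'h) hopf_algebroid \<Rightarrow> ('a, 'a) module" where
  "base_mod \<H> = \<lparr>carrier = carrier (base \<H>), monoid.mult = monoid.mult (base \<H>), one = one (base \<H>),
     ring.zero = ring.zero (base \<H>), add = add (base \<H>), smult = monoid.mult (base \<H>)\<rparr>"

definition src_mod :: "('k, 'a, 'h) hopf_algebroid \<Rightarrow> ('a, 'h) module" where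
  "src_mod \<H> = \<lparr>carrier = carrier (tot \<H>), monoid.mult = monoid.mult (tot \<H>), one = one (tot \<H>),
     ring.zero = ring.zero (tot \<H>), add = add (tot \<H>), smult = (\<lambda>a u. src \<H> a \<otimes>\<^bsub>tot \<H>\<^esub> u)\<rparr>"

definition ldual :: "('k, 'a, 'h) hopf_algebroid \<Rightarrow> ('a, 'h \<Rightarrow> 'a) module" where
  "ldual \<H> = \<lparr>
     carrier = lin_maps (base \<H>) (src_mod \<H>) (base_mod \<H>) \<inter> extensional (carrier (tot \<H>)),
     monoid.mult = (\<lambda>\<alpha> \<beta>. \<lambda>u\<in>carrier (tot \<H>).
       \<alpha> (sweedler (tot \<H>) (comult \<H> u) (\<lambda>x y. x \<otimes>\<^bsub>tot \<H>\<^esub> tgt \<H> (\<beta> y)))),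
     one = (\<lambda>u\<in>carrier (tot \<H>). counit \<H> u),
     ring.zero = (\<lambda>u\<in>carrier (tot \<H>). \<zero>\<^bsub>base \<H>\<^esub>),
     add = (\<lambda>\<alpha> \<beta>. \<lambda>u\<in>carrier (tot \<H>). \<alpha> u \<oplus>\<^bsub>base \<H>\<^esub> \<beta> u),
     smult = (\<lambda>a \<alpha>. \<lambda>u\<in>carrier (tot \<H>). a \<otimes>\<^bsub>base \<H>\<^esub> \<alpha> u)\<rparr>"

definition ldual_unit :: "('k, 'a, 'h) hopf_algebroid \<Rightarrow> 'a \<Rightarrow> 'h \<Rightarrow> 'a" where
  "ldual_unit \<H> a = (\<lambda>u\<in>carrier (tot \<H>). counit \<H> u \<otimes>\<^bsub>base \<H>\<^esub> a)"

definition comodule_map :: "('k, 'a, 'h) hopf_algebroid \<Rightarrow> ('h \<Rightarrow> 'h) \<Rightarrow> bool" where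
  "comodule_map \<H> \<delta> \<longleftrightarrow> (\<forall>u\<in>carrier (tot \<H>).
     comult \<H> (\<delta> u) = sweedler (tens2 \<H>) (comult \<H> u) (\<lambda>x y. pure2 \<H> x (\<delta> y)))"

definition comod_end :: "('k, 'a, 'h) hopf_algebroid \<Rightarrow> ('a, 'h \<Rightarrow> 'h) module" where
  "comod_end \<H> = \<lparr>
     carrier = {\<delta> \<in> lin_maps (base \<H>) (src_mod \<H>) (src_mod \<H>) \<inter> extensional (carrier (tot \<H>)).
       comodule_map \<H> \<delta>},
     monoid.mult = compose (carrier (tot \<H>)),
     one = (\<lambda>u\<in>carrier (tot \<H>). u),
     ring.zero = (\<lambda>u\<in>carrier (tot \<H>). \<zero>\<^bsub>tot \<H>\<^esub>),
     add = (\<lambda>\<delta> \<delta>'. \<lambda>u\<in>carrier (tot \<H>). \<delta> u \<oplus>\<^bsub>tot \<H>\<^esub> \<delta>' u),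
     smult = (\<lambda>a \<delta>. \<lambda>u\<in>carrier (tot \<H>). \<delta> u \<otimes>\<^bsub>tot \<H>\<^esub> tgt \<H> a)\<rparr>"

definition comod_end_unit :: "('k, 'a, 'h) hopf_algebroid \<Rightarrow> 'a \<Rightarrow> 'h \<Rightarrow> 'h" where
  "comod_end_unit \<H> a = (\<lambda>u\<in>carrier (tot \<H>). u \<otimes>\<^bsub>tot \<H>\<^esub> tgt \<H> a)"

definition theta :: "('k, 'a, 'h) hopf_algebroid \<Rightarrow> ('h \<Rightarrow> 'a) \<Rightarrow> 'h \<Rightarrow> 'h" where
  "theta \<H> \<alpha> = (\<lambda>u\<in>carrier (tot \<H>).
     sweedler (tot \<H>) (comult \<H> u) (\<lambda>x y. x \<otimes>\<^bsub>tot \<H>\<^esub> tgt \<H> (\<alpha> y)))"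

definition der_counit_carrier :: "'k ring \<Rightarrow> ('k, 'a, 'h) hopf_algebroid \<Rightarrow> ('h \<Rightarrow> 'a) set" where
  "der_counit_carrier K \<H> = {\<delta> \<in> lin_maps K (tot \<H>) (base \<H>) \<inter> extensional (carrier (tot \<H>)).
     (\<forall>a\<in>carrier (base \<H>). \<delta> (src \<H> a) = \<zero>\<^bsub>base \<H>\<^esub>) \<and>
     (\<forall>u\<in>carrier (tot \<H>). \<forall>v\<in>carrier (tot \<H>). \<delta> (u \<otimes>\<^bsub>tot \<H>\<^esub> v) =
        counit \<H> u \<otimes>\<^bsub>base \<H>\<^esub> \<delta> v \<oplus>\<^bsub>base \<H>\<^esub> \<delta> u \<otimes>\<^bsub>base \<H>\<^esub> counit \<H> v)}"

definition der_comod_carrier :: "'k ring \<Rightarrow> ('k, 'a, 'h) hopf_algebroid \<Rightarrow> ('h \<Rightarrow> 'h) set" where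
  "der_comod_carrier K \<H> = {\<delta> \<in> lin_maps K (tot \<H>) (tot \<H>) \<inter> extensional (carrier (tot \<H>)).
     (\<forall>a\<in>carrier (base \<H>). \<delta> (src \<H> a) = \<zero>\<^bsub>tot \<H>\<^esub>) \<and>
     (\<forall>u\<in>carrier (tot \<H>). \<forall>v\<in>carrier (tot \<H>). \<delta> (u \<otimes>\<^bsub>tot \<H>\<^esub> v) =
        \<delta> u \<otimes>\<^bsub>tot \<H>\<^esub> v \<oplus>\<^bsub>tot \<H>\<^esub> u \<otimes>\<^bsub>tot \<H>\<^esub> \<delta> v) \<and>
     comodule_map \<H> \<delta>}"

text \<open>
  Both modules of derivations carry the pointwise operations, which are those of \<^const>\<open>ldual\<close> and
  \<^const>\<open>comod_end\<close>; the inclusions \<open>j\<close> and \<open>j'\<close> are identities on underlying maps.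
\<close>

definition der_counit :: "'k ring \<Rightarrow> ('k, 'a, 'h) hopf_algebroid \<Rightarrow> ('a, 'h \<Rightarrow> 'a) module" where
  "der_counit K \<H> = (ldual \<H>)\<lparr>carrier := der_counit_carrier K \<H>\<rparr>"

definition der_comod :: "'k ring \<Rightarrow> ('k, 'a, 'h) hopf_algebroid \<Rightarrow> ('a, 'h \<Rightarrow> 'h) module" where
  "der_comod K \<H> = (comod_end \<H>)\<lparr>carrier := der_comod_carrier K \<H>\<rparr>"

text \<open>The \<open>\<k>\<close>-vector space underlying an \<open>A\<close>-module: restriction of scalars along \<open>k \<mapsto> k\<cdot>1\<^sub>A\<close>.\<close>

definition k_space :: "('k, 'a, 'h) hopf_algebroid \<Rightarrow> ('a, 'm) module \<Rightarrow> ('k, 'm) module" where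
  "k_space \<H> M = \<lparr>carrier = carrier M, monoid.mult = monoid.mult M, one = one M, ring.zero = ring.zero M, add = add M,
     smult = (\<lambda>k m. (k \<odot>\<^bsub>base \<H>\<^esub> \<one>\<^bsub>base \<H>\<^esub>) \<odot>\<^bsub>M\<^esub> m)\<rparr>"

section \<open>The conormal module\<close>

definition aug_ideal :: "('k, 'a, 'h) hopf_algebroid \<Rightarrow> 'h set" where
  "aug_ideal \<H> = a_kernel (tot \<H>) (base \<H>) (counit \<H>)"

definition aug_ideal_sq :: "('k, 'a, 'h) hopf_algebroid \<Rightarrow> 'h set" where
  "aug_ideal_sq \<H> = aug_ideal \<H> \<cdot>\<^bsub>tot \<H>\<^esub> aug_ideal \<H>"

definition conormal :: "('k, 'a, 'h) hopf_algebroid \<Rightarrow> ('a, 'h set) module" where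
  "conormal \<H> = (let Q = tot \<H> Quot aug_ideal_sq \<H>
     in \<lparr>carrier = (\<lambda>u. aug_ideal_sq \<H> +>\<^bsub>tot \<H>\<^esub> u) ` aug_ideal \<H>,
         monoid.mult = monoid.mult Q, one = one Q, ring.zero = ring.zero Q, add = add Q,
         smult = (\<lambda>a z. (aug_ideal_sq \<H> +>\<^bsub>tot \<H>\<^esub> src \<H> a) \<otimes>\<^bsub>Q\<^esub> z)\<rparr>)"

definition conormal_dual :: "('k, 'a, 'h) hopf_algebroid \<Rightarrow> ('a, 'h set \<Rightarrow> 'a) module" where
  "conormal_dual \<H> = \<lparr>
     carrier = lin_maps (base \<H>) (conormal \<H>) (base_mod \<H>) \<inter> extensional (carrier (conormal \<H>)),
     monoid.mult = undefined, one = undefined,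
     ring.zero = (\<lambda>z\<in>carrier (conormal \<H>). \<zero>\<^bsub>base \<H>\<^esub>),
     add = (\<lambda>f g. \<lambda>z\<in>carrier (conormal \<H>). f z \<oplus>\<^bsub>base \<H>\<^esub> g z),
     smult = (\<lambda>a f. \<lambda>z\<in>carrier (conormal \<H>). a \<otimes>\<^bsub>base \<H>\<^esub> f z)\<rparr>"

definition pi_s :: "('k, 'a, 'h) hopf_algebroid \<Rightarrow> 'h \<Rightarrow> 'h set" where
  "pi_s \<H> u = aug_ideal_sq \<H> +>\<^bsub>tot \<H>\<^esub> (u \<ominus>\<^bsub>tot \<H>\<^esub> src \<H> (counit \<H> u))"

definition pi_s_dual :: "('k, 'a, 'h) hopf_algebroid \<Rightarrow> ('h set \<Rightarrow> 'a) \<Rightarrow> 'h \<Rightarrow> 'a" where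
  "pi_s_dual \<H> f = compose (carrier (tot \<H>)) f (pi_s \<H>)"

end

theory Submission
  imports Defs
begin

text \<open>
  Write \<open>\<theta>(\<alpha>)(u) = u\<^sub>1 t(\<alpha>(u\<^sub>2))\<close>. Bijectivity of \<open>\<theta>\<close> rests on three identities. Coassociativity
  turns \<open>\<Delta>(u\<^sub>1 t(\<alpha>(u\<^sub>2)))\<close> into \<open>u\<^sub>1 \<otimes> u\<^sub>2 t(\<alpha>(u\<^sub>3))\<close>, so that \<open>\<theta>(\<alpha>)\<close> is a comodule map
  (\<open>theta_comodule_map\<close>). The left counit law gives
  \<open>\<epsilon>(\<theta>(\<alpha>)(u)) = \<epsilon>(u\<^sub>1) \<alpha>(u\<^sub>2) = \<alpha>(s(\<epsilon>(u\<^sub>1)) u\<^sub>2) = \<alpha>(u)\<close> (\<open>counit_theta\<close>). The right counit law,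
  applied to \<open>\<Delta>(\<delta>(u)) = u\<^sub>1 \<otimes> \<delta>(u\<^sub>2)\<close>, gives \<open>\<theta>(\<epsilon> \<circ> \<delta>) = \<delta>\<close> (\<open>theta_counit_comp\<close>). Hence \<open>\<theta>\<close> is
  bijective with inverse \<open>\<delta> \<mapsto> \<epsilon> \<circ> \<delta>\<close>.

  The convolution product is by definition \<open>\<alpha> * \<beta> = \<alpha> \<circ> \<theta>(\<beta>) = \<epsilon> \<circ> \<theta>(\<alpha>) \<circ> \<theta>(\<beta>)\<close>. Comodule maps are
  closed under composition, so applying \<open>\<theta>\<close> gives \<open>\<theta>(\<alpha> * \<beta>) = \<theta>(\<alpha>) \<circ> \<theta>(\<beta>)\<close> (\<open>theta_mult\<close>) without a
  further appeal to coassociativity; the ring axioms of the dual and the statement on \<open>A\<close>-rings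
  follow. Commutators make both rings Lie algebras over \<open>\<k>\<close>, because \<open>s\<close> and \<open>t\<close> agree on
  scalars and both products are therefore \<open>\<k>\<close>-bilinear.

  If \<open>\<delta>\<close> is a derivation into \<open>A\<^sub>\<epsilon>\<close>, then multiplicativity of \<open>\<Delta>\<close> and the Leibniz rule yield
  \<open>\<theta>(\<delta>)(uv) = u\<^sub>1 v\<^sub>1 t(\<epsilon>(u\<^sub>2) \<delta>(v\<^sub>2) + \<delta>(u\<^sub>2) \<epsilon>(v\<^sub>2)) = u \<theta>(\<delta>)(v) + \<theta>(\<delta>)(u) v\<close> (\<open>theta_der\<close>), and
  \<open>\<epsilon> \<circ> \<delta>\<close> of a derivation \<open>\<delta>\<close> of \<open>\<H>\<close> is clearly a derivation into \<open>A\<^sub>\<epsilon>\<close>. So \<open>\<theta>\<close> restricts to a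
  bijection between the two modules of derivations. Commutators of derivations of \<open>\<H>\<close> are
  derivations; transporting this through \<open>\<theta>\<close> shows that the other module of derivations is closed
  under the bracket of the dual.

  Finally \<open>(u - s(\<epsilon>(u))) (v - s(\<epsilon>(v)))\<close> lies in \<open>\<I>\<^sup>2\<close>, which makes \<open>\<pi>\<^sup>s\<close> a derivation and composition
  with \<open>\<pi>\<^sup>s\<close> a map into derivations (\<open>pi_s_mult\<close>). It is injective because \<open>\<pi>\<^sup>s\<close> is surjective, and
  surjective because a derivation into \<open>A\<^sub>\<epsilon>\<close> kills \<open>\<I>\<^sup>2\<close>. The bracket on the dual of \<open>\<I>/\<I>\<^sup>2\<close> is
  pulled back along this bijection, and injectivity makes it unique.

  All computations with Sweedler indices rest on one principle: an additive map out of a tensor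
  product is determined by its values on pure tensors (\<open>additive_determined_by_pure\<close>).
\<close>

section \<open>Homomorphisms out of a tensor product\<close>

context abelian_group
begin

text \<open>
  Summing over a common finite set of pairs lets two formal sums be added termwise.
\<close>

lemma frag_sum_superset:
  assumes "finite P" "Poly_Mapping.keys c \<subseteq> P" "\<And>p. p \<in> P \<Longrightarrow> \<phi> (fst p) (snd p) \<in> carrier G"
  shows "frag_sum G \<phi> c = (\<Oplus>p\<in>P. [Poly_Mapping.lookup c p] \<cdot> \<phi> (fst p) (snd p))"
  unfolding frag_sum_def
proof (rule add.finprod_mono_neutral_cong_left)
  show "\<And>i. i \<in> P - Poly_Mapping.keys c \<Longrightarrow> [Poly_Mapping.lookup c i] \<cdot> \<phi> (fst i) (snd i) = \<zero>"
    by (auto simp: in_keys_iff add_pow_def)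
qed (use assms in auto)

lemma frag_sum_closed:
  assumes "\<And>p. p \<in> Poly_Mapping.keys c \<Longrightarrow> \<phi> (fst p) (snd p) \<in> carrier G"
  shows "frag_sum G \<phi> c \<in> carrier G"
  unfolding frag_sum_def using assms by (auto intro!: finsum_closed)

lemma frag_sum_add:
  assumes "\<And>p. p \<in> Poly_Mapping.keys c \<union> Poly_Mapping.keys d \<Longrightarrow> \<phi> (fst p) (snd p) \<in> carrier G"
  shows "frag_sum G \<phi> (c + d) = frag_sum G \<phi> c \<oplus> frag_sum G \<phi> d"
proof -
  let ?P = "Poly_Mapping.keys c \<union> Poly_Mapping.keys d"
  let ?t = "\<lambda>c p. [Poly_Mapping.lookup c p] \<cdot> \<phi> (fst p) (snd p)"
  have "frag_sum G \<phi> (c + d) = (\<Oplus>p\<in>?P. ?t (c + d) p)"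
    using assms keys_add[of c d] by (intro frag_sum_superset) (simp, blast, blast)
  also have "\<dots> = (\<Oplus>p\<in>?P. ?t c p \<oplus> ?t d p)"
    using assms by (intro finsum_cong') (auto simp: lookup_add add.int_pow_mult)
  also have "\<dots> = (\<Oplus>p\<in>?P. ?t c p) \<oplus> (\<Oplus>p\<in>?P. ?t d p)"
    using assms by (intro finsum_addf) auto
  also have "(\<Oplus>p\<in>?P. ?t c p) = frag_sum G \<phi> c"
    using assms by (intro frag_sum_superset[symmetric]) auto
  also have "(\<Oplus>p\<in>?P. ?t d p) = frag_sum G \<phi> d"
    using assms by (intro frag_sum_superset[symmetric]) auto
  finally show ?thesis .
qed

lemma frag_sum_frag_of:
  assumes "\<phi> x y \<in> carrier G"
  shows "frag_sum G \<phi> (frag_of (x, y)) = \<phi> x y"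
  unfolding frag_sum_def using assms add.int_pow_1[of "\<phi> x y"]
  by (simp add: finsum_singleton[of "(x,y)" "{(x,y)}", simplified])

lemma frag_sum_hom:
  assumes "\<And>x y. \<lbrakk>x \<in> X; y \<in> Y\<rbrakk> \<Longrightarrow> \<phi> x y \<in> carrier G"
  shows "group_hom (free_Abelian_group (X \<times> Y)) (add_monoid G) (frag_sum G \<phi>)"
proof (intro group_hom.intro group_hom_axioms.intro homI)
  show "group (add_monoid G)" by (rule a_group)
qed (use assms in \<open>auto intro!: frag_sum_closed frag_sum_add simp: subset_iff\<close>)

end

definition additive :: "('g, 'c) ring_scheme \<Rightarrow> ('h, 'd) ring_scheme \<Rightarrow> ('g \<Rightarrow> 'h) \<Rightarrow> bool" where
  "additive G H F \<longleftrightarrow> F \<in> carrier G \<rightarrow> carrier H \<and>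
     (\<forall>x\<in>carrier G. \<forall>y\<in>carrier G. F (x \<oplus>\<^bsub>G\<^esub> y) = F x \<oplus>\<^bsub>H\<^esub> F y)"

definition balanced ::
  "('a, 'c) ring_scheme \<Rightarrow> ('r, 'd) ring_scheme \<Rightarrow> ('a \<Rightarrow> 'r) \<Rightarrow> ('s, 'e) ring_scheme \<Rightarrow> ('a \<Rightarrow> 's) \<Rightarrow>
     ('g, 'z) ring_scheme \<Rightarrow> ('r \<Rightarrow> 's \<Rightarrow> 'g) \<Rightarrow> bool" where
  "balanced A R f S g G \<phi> \<longleftrightarrow>
     (\<forall>x\<in>carrier R. \<forall>y\<in>carrier S. \<phi> x y \<in> carrier G) \<and>
     (\<forall>x\<in>carrier R. \<forall>x'\<in>carrier R. \<forall>y\<in>carrier S. \<phi> (x \<oplus>\<^bsub>R\<^esub> x') y = \<phi> x y \<oplus>\<^bsub>G\<^esub> \<phi> x' y) \<and>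
     (\<forall>x\<in>carrier R. \<forall>y\<in>carrier S. \<forall>y'\<in>carrier S. \<phi> x (y \<oplus>\<^bsub>S\<^esub> y') = \<phi> x y \<oplus>\<^bsub>G\<^esub> \<phi> x y') \<and>
     (\<forall>x\<in>carrier R. \<forall>a\<in>carrier A. \<forall>y\<in>carrier S. \<phi> (x \<otimes>\<^bsub>R\<^esub> f a) y = \<phi> x (g a \<otimes>\<^bsub>S\<^esub> y))"

lemma balancedI:
  assumes "\<And>x y. \<lbrakk>x \<in> carrier R; y \<in> carrier S\<rbrakk> \<Longrightarrow> \<phi> x y \<in> carrier G"
    and "\<And>x x' y. \<lbrakk>x \<in> carrier R; x' \<in> carrier R; y \<in> carrier S\<rbrakk> \<Longrightarrow>
      \<phi> (x \<oplus>\<^bsub>R\<^esub> x') y = \<phi> x y \<oplus>\<^bsub>G\<^esub> \<phi> x' y"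
    and "\<And>x y y'. \<lbrakk>x \<in> carrier R; y \<in> carrier S; y' \<in> carrier S\<rbrakk> \<Longrightarrow>
      \<phi> x (y \<oplus>\<^bsub>S\<^esub> y') = \<phi> x y \<oplus>\<^bsub>G\<^esub> \<phi> x y'"
    and "\<And>x a y. \<lbrakk>x \<in> carrier R; a \<in> carrier A; y \<in> carrier S\<rbrakk> \<Longrightarrow>
      \<phi> (x \<otimes>\<^bsub>R\<^esub> f a) y = \<phi> x (g a \<otimes>\<^bsub>S\<^esub> y)"
  shows "balanced A R f S g G \<phi>"
  using assms unfolding balanced_def by blast

lemma additive_group_hom:
  assumes "abelian_group G" "abelian_group H" "additive G H F"
  shows "group_hom (add_monoid G) (add_monoid H) F"
  using assms(3) abelian_group.a_group[OF assms(1)] abelian_group.a_group[OF assms(2)]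
  by (intro group_hom.intro group_hom_axioms.intro homI) (auto simp: additive_def)

lemma additive_zero:
  assumes "abelian_group G" "abelian_group H" "additive G H F"
  shows "F \<zero>\<^bsub>G\<^esub> = \<zero>\<^bsub>H\<^esub>"
  using group_hom.hom_one[OF additive_group_hom[OF assms]] by simp

lemma additive_minus:
  assumes "abelian_group G" "abelian_group H" "additive G H F" "x \<in> carrier G" "y \<in> carrier G"
  shows "F (x \<ominus>\<^bsub>G\<^esub> y) = F x \<ominus>\<^bsub>H\<^esub> F y"
  using group_hom.hom_inv[OF additive_group_hom[OF assms(1-3)], of y] assms(3-5)
    abelian_group.a_inv_closed[OF assms(1), of y]
  by (simp add: a_minus_def a_inv_def additive_def)

lemma additive_balanced_comp:
  assumes "additive G H F" "balanced A R f S g G \<phi>"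
  shows "balanced A R f S g H (\<lambda>x y. F (\<phi> x y))"
  using assms unfolding additive_def balanced_def by (auto simp: Pi_iff)

text \<open>
  The factors are only required to be abelian groups on which \<open>A\<close> acts through multiplication by
  the images of \<open>f\<close> and \<open>g\<close>. This covers the threefold tensor product, whose left factor \<open>\<H> \<otimes>\<^sub>A \<H>\<close> then
  enters without its ring axioms.
\<close>

locale tensor_factors =
  fixes A :: "('a, 'c) ring_scheme" and R :: "('r, 'd) ring_scheme" and f :: "'a \<Rightarrow> 'r"
    and S :: "('s, 'e) ring_scheme" and g :: "'a \<Rightarrow> 's"
  assumes ab_R: "abelian_group R" and ab_S: "abelian_group S"
    and act_R: "\<lbrakk>x \<in> carrier R; a \<in> carrier A\<rbrakk> \<Longrightarrow> x \<otimes>\<^bsub>R\<^esub> f a \<in> carrier R"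
    and act_S: "\<lbrakk>y \<in> carrier S; a \<in> carrier A\<rbrakk> \<Longrightarrow> g a \<otimes>\<^bsub>S\<^esub> y \<in> carrier S"
begin

abbreviation "Fr \<equiv> free_Abelian_group (carrier R \<times> carrier S)"
abbreviation "Nu \<equiv> tensor_null A R f S g"
abbreviation "T \<equiv> tensor_ring A R f S g"
abbreviation "cls \<equiv> tensor_class A R f S g"
abbreviation "pure \<equiv> pure_tensor A R f S g"
abbreviation "bal \<equiv> balanced A R f S g"

lemma tensor_relators_closed: "tensor_relators A R f S g \<subseteq> carrier Fr"
proof -
  interpret R: abelian_group R by (rule ab_R)
  interpret S: abelian_group S by (rule ab_S)
  have keys: "Poly_Mapping.keys c \<subseteq> X \<Longrightarrow> Poly_Mapping.keys d \<subseteq> X \<Longrightarrow> Poly_Mapping.keys (c - d) \<subseteq> X"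
    for c d :: "'r \<times> 's \<Rightarrow>\<^sub>0 int" and X
    using keys_diff[of c d] by blast
  show ?thesis
    unfolding tensor_relators_def
    by (auto simp del: keys_diff intro!: keys simp: act_R act_S dest!: subsetD[OF keys_diff])
qed

lemma tensor_null_subgroup: "subgroup Nu Fr"
  unfolding tensor_null_def
  by (rule group.generate_is_subgroup[OF group_free_Abelian_group tensor_relators_closed])

lemma tensor_null_normal: "Nu \<lhd> Fr"
  using comm_group.subgroup_imp_normal[OF abelian_free_Abelian_group tensor_null_subgroup] .

lemma carrier_tensor: "carrier T = cls ` carrier Fr"
  unfolding tensor_ring_def Let_def tensor_class_def by (simp add: carrier_FactGroup)

lemma zero_tensor: "\<zero>\<^bsub>T\<^esub> = cls 0"
proof -
  have "Nu #>\<^bsub>Fr\<^esub> 0 = Nu"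
    using group.coset_mult_one[OF group_free_Abelian_group, of Nu "carrier R \<times> carrier S"]
      subgroup.subset[OF tensor_null_subgroup] by simp
  then show ?thesis
    unfolding tensor_ring_def Let_def tensor_class_def by simp
qed

lemma add_tensor_class:
  assumes "c \<in> carrier Fr" "d \<in> carrier Fr"
  shows "cls c \<oplus>\<^bsub>T\<^esub> cls d = cls (c + d)"
  using normal.rcos_sum[OF tensor_null_normal assms]
  unfolding tensor_ring_def Let_def tensor_class_def by simp

lemma abelian_group_tensor: "abelian_group T"
proof -
  interpret Q: comm_group "Fr Mod Nu"
    by (rule comm_group.abelian_FactGroup[OF abelian_free_Abelian_group tensor_null_subgroup])
  have T: "carrier T = carrier (Fr Mod Nu)" "\<zero>\<^bsub>T\<^esub> = \<one>\<^bsub>Fr Mod Nu\<^esub>"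
    "x \<oplus>\<^bsub>T\<^esub> y = x \<otimes>\<^bsub>Fr Mod Nu\<^esub> y" for x y
    unfolding tensor_ring_def Let_def by simp_all
  show ?thesis
    by (rule abelian_groupI; unfold T)
      (simp_all del: mult_FactGroup one_FactGroup add: Q.m_ac Q.l_inv_ex)
qed

lemma pure_closed: "\<lbrakk>x \<in> carrier R; y \<in> carrier S\<rbrakk> \<Longrightarrow> pure x y \<in> carrier T"
  unfolding carrier_tensor pure_tensor_def by auto

lemma mem_tensor_class: "c \<in> carrier Fr \<Longrightarrow> c \<in> cls c"
  unfolding tensor_class_def
  using group.rcos_self[OF group_free_Abelian_group _ tensor_null_subgroup] by simp

text \<open>
  A balanced map kills each relator of the tensor product, so the induced homomorphism kills the
  subgroup that they generate.
\<close>

lemma frag_sum_balanced_null: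
  assumes "abelian_group G" "bal G \<phi>" "n \<in> Nu"
  shows "frag_sum G \<phi> n = \<zero>\<^bsub>G\<^esub>"
proof -
  interpret R: abelian_group R by (rule ab_R)
  interpret S: abelian_group S by (rule ab_S)
  interpret G: abelian_group G by fact
  interpret h: group_hom Fr "add_monoid G" "frag_sum G \<phi>"
    using assms(2) by (intro G.frag_sum_hom) (auto simp: balanced_def)
  have diff: "frag_sum G \<phi> (c - d) = frag_sum G \<phi> c \<ominus>\<^bsub>G\<^esub> frag_sum G \<phi> d"
    if "c \<in> carrier Fr" "d \<in> carrier Fr" for c d
    using h.hom_mult[of c "- d"] h.hom_inv[of d] that by (simp add: a_minus_def a_inv_def)
  have fd: "c - d \<in> carrier Fr" if "c \<in> carrier Fr" "d \<in> carrier Fr" for c d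
    using that keys_diff[of c d] by auto
  have [simp]: "frag_sum G \<phi> (frag_of (x, y)) = \<phi> x y" if "x \<in> carrier R" "y \<in> carrier S" for x y
    using that assms(2) by (intro G.frag_sum_frag_of) (auto simp: balanced_def)
  \<comment> \<open>the value of a balanced map at an additivity relator, and below at a balance relator\<close>
  have kill: "(p \<oplus>\<^bsub>G\<^esub> q) \<ominus>\<^bsub>G\<^esub> p \<ominus>\<^bsub>G\<^esub> q = \<zero>\<^bsub>G\<^esub>" if "p \<in> carrier G" "q \<in> carrier G" for p q
  proof -
    have "(p \<oplus>\<^bsub>G\<^esub> q) \<ominus>\<^bsub>G\<^esub> p \<ominus>\<^bsub>G\<^esub> q = (p \<oplus>\<^bsub>G\<^esub> \<ominus>\<^bsub>G\<^esub> p) \<oplus>\<^bsub>G\<^esub> (q \<oplus>\<^bsub>G\<^esub> \<ominus>\<^bsub>G\<^esub> q)"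
      using that by (simp add: a_minus_def G.a_ac)
    then show ?thesis using that by (simp add: G.r_neg)
  qed
  have refl_minus: "p \<ominus>\<^bsub>G\<^esub> p = \<zero>\<^bsub>G\<^esub>" if "p \<in> carrier G" for p
    using that by (simp add: a_minus_def G.r_neg)
  have "tensor_relators A R f S g \<subseteq> kernel Fr (add_monoid G) (frag_sum G \<phi>)"
  proof
    fix r assume r: "r \<in> tensor_relators A R f S g"
    then have "frag_sum G \<phi> r = \<zero>\<^bsub>G\<^esub>"
      using assms(2) unfolding tensor_relators_def balanced_def
      by (auto simp del: carrier_free_Abelian_group_iff
          simp: diff fd act_R act_S kill refl_minus)
    then show "r \<in> kernel Fr (add_monoid G) (frag_sum G \<phi>)"
      using subsetD[OF tensor_relators_closed r] by (simp add: kernel_def)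
  qed
  then have "Nu \<subseteq> kernel Fr (add_monoid G) (frag_sum G \<phi>)"
    unfolding tensor_null_def
    by (rule group.generate_subgroup_incl[OF group_free_Abelian_group _ h.subgroup_kernel])
  then show ?thesis using assms(3) by (auto simp: kernel_def)
qed

lemma frag_sum_tensor_class:
  assumes "abelian_group G" "bal G \<phi>" "c \<in> carrier Fr" "d \<in> cls c"
  shows "frag_sum G \<phi> d = frag_sum G \<phi> c"
proof -
  interpret G: abelian_group G by fact
  obtain n where n: "n \<in> Nu" "d = n + c"
    using assms(4) unfolding tensor_class_def r_coset_def by auto
  have nF: "n \<in> carrier Fr" using n(1) subgroup.subset[OF tensor_null_subgroup] by blast
  have phi: "\<phi> (fst p) (snd p) \<in> carrier G" if "p \<in> carrier R \<times> carrier S" for p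
    using assms(2) that by (auto simp: balanced_def)
  have cl: "frag_sum G \<phi> c \<in> carrier G"
    using assms(3) phi by (intro G.frag_sum_closed) auto
  have "frag_sum G \<phi> d = frag_sum G \<phi> n \<oplus>\<^bsub>G\<^esub> frag_sum G \<phi> c"
    unfolding n(2) using nF assms(3)
    by (intro G.frag_sum_add phi) (simp, blast)
  then show ?thesis
    using frag_sum_balanced_null[OF assms(1,2) n(1)] cl by simp
qed

text \<open>
  The definite description is resolved here: it may be evaluated at any representative.
\<close>

lemma sweedler_tensor_class:
  assumes "abelian_group G" "bal G \<phi>" "c \<in> carrier Fr"
  shows "sweedler G (cls c) \<phi> = frag_sum G \<phi> c"
  unfolding sweedler_def
proof (rule the_equality)
  show "\<forall>d\<in>cls c. frag_sum G \<phi> d = frag_sum G \<phi> c"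
    using frag_sum_tensor_class[OF assms] by blast
  show "v = frag_sum G \<phi> c" if "\<forall>d\<in>cls c. frag_sum G \<phi> d = v" for v
    using that mem_tensor_class[OF assms(3)] by simp
qed

lemma sweedler_pure:
  assumes "abelian_group G" "bal G \<phi>" "x \<in> carrier R" "y \<in> carrier S"
  shows "sweedler G (pure x y) \<phi> = \<phi> x y"
proof -
  have "\<phi> x y \<in> carrier G" using assms unfolding balanced_def by blast
  then show ?thesis
    unfolding pure_tensor_def
    using assms(3,4) abelian_group.frag_sum_frag_of[OF assms(1), of \<phi> x y]
    by (simp add: sweedler_tensor_class[OF assms(1,2)])
qed

lemma sweedler_additive:
  assumes "abelian_group G" "bal G \<phi>"
  shows "additive T G (\<lambda>z. sweedler G z \<phi>)"
proof -
  have "group_hom Fr (add_monoid G) (frag_sum G \<phi>)"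
    using assms(2) unfolding balanced_def by (intro abelian_group.frag_sum_hom assms(1)) blast
  then interpret h: group_hom Fr "add_monoid G" "frag_sum G \<phi>" .
  have cd: "c + d \<in> carrier Fr" if "c \<in> carrier Fr" "d \<in> carrier Fr" for c d
    using that group.is_monoid[OF group_free_Abelian_group, THEN monoid.m_closed, of c _ d] by simp
  show ?thesis
    unfolding additive_def carrier_tensor
    using h.hom_mult h.hom_closed
    by (auto simp del: carrier_free_Abelian_group_iff
        simp: sweedler_tensor_class[OF assms] add_tensor_class cd)
qed

lemma sweedler_closed:
  "\<lbrakk>abelian_group G; bal G \<phi>; z \<in> carrier T\<rbrakk> \<Longrightarrow> sweedler G z \<phi> \<in> carrier G"
  using sweedler_additive[of G \<phi>] unfolding additive_def by (simp add: Pi_iff)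

lemma sweedler_add:
  "\<lbrakk>abelian_group G; bal G \<phi>; z \<in> carrier T; w \<in> carrier T\<rbrakk> \<Longrightarrow>
    sweedler G (z \<oplus>\<^bsub>T\<^esub> w) \<phi> = sweedler G z \<phi> \<oplus>\<^bsub>G\<^esub> sweedler G w \<phi>"
  using sweedler_additive[of G \<phi>] unfolding additive_def by simp

lemma pure_balanced: "bal T pure"
proof -
  interpret R: abelian_group R by (rule ab_R)
  interpret S: abelian_group S by (rule ab_S)
  have eq: "cls c = cls d" if "c \<in> carrier Fr" "d \<in> carrier Fr" "c - d \<in> Nu" for c d
  proof -
    have "c \<in> cls d"
      using that(3) unfolding tensor_class_def r_coset_def
      by (auto intro!: bexI[of _ "c - d"])
    then show ?thesis
      using group.repr_independence[OF group_free_Abelian_group, of c "carrier R \<times> carrier S" Nu d]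
        that(2) tensor_null_subgroup
      unfolding tensor_class_def by simp
  qed
  have rel: "r \<in> Nu" if "r \<in> tensor_relators A R f S g" for r
    using that unfolding tensor_null_def by (rule generate.incl)
  have cd: "c + d \<in> carrier Fr" if "c \<in> carrier Fr" "d \<in> carrier Fr" for c d
    using that group.is_monoid[OF group_free_Abelian_group, THEN monoid.m_closed, of c _ d] by simp
  show ?thesis
  proof (rule balancedI)
    fix x x' y assume *: "x \<in> carrier R" "x' \<in> carrier R" "y \<in> carrier S"
    have "frag_of (x \<oplus>\<^bsub>R\<^esub> x', y) - frag_of (x, y) - frag_of (x', y) \<in> Nu"
      using * by (intro rel) (auto simp: tensor_relators_def)
    then have "cls (frag_of (x \<oplus>\<^bsub>R\<^esub> x', y)) = cls (frag_of (x, y) + frag_of (x', y))"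
      using * by (intro eq cd) (auto simp: diff_diff_eq)
    then show "pure (x \<oplus>\<^bsub>R\<^esub> x') y = pure x y \<oplus>\<^bsub>T\<^esub> pure x' y"
      using * unfolding pure_tensor_def by (subst add_tensor_class) auto
  next
    fix x y y' assume *: "x \<in> carrier R" "y \<in> carrier S" "y' \<in> carrier S"
    have "frag_of (x, y \<oplus>\<^bsub>S\<^esub> y') - frag_of (x, y) - frag_of (x, y') \<in> Nu"
      using * by (intro rel) (auto simp: tensor_relators_def)
    then have "cls (frag_of (x, y \<oplus>\<^bsub>S\<^esub> y')) = cls (frag_of (x, y) + frag_of (x, y'))"
      using * by (intro eq cd) (auto simp: diff_diff_eq)
    then show "pure x (y \<oplus>\<^bsub>S\<^esub> y') = pure x y \<oplus>\<^bsub>T\<^esub> pure x y'"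
      using * unfolding pure_tensor_def by (subst add_tensor_class) auto
  next
    fix x a y assume *: "x \<in> carrier R" "a \<in> carrier A" "y \<in> carrier S"
    have "frag_of (x \<otimes>\<^bsub>R\<^esub> f a, y) - frag_of (x, g a \<otimes>\<^bsub>S\<^esub> y) \<in> Nu"
      using * by (intro rel) (auto simp: tensor_relators_def)
    then show "pure (x \<otimes>\<^bsub>R\<^esub> f a) y = pure x (g a \<otimes>\<^bsub>S\<^esub> y)"
      using * unfolding pure_tensor_def by (intro eq) (auto simp: act_R act_S)
  qed (rule pure_closed)
qed

text \<open>
  The uniqueness half of the universal property. It replaces computations with representatives in
  all later identities between Sweedler sums.
\<close>

lemma additive_determined_by_pure:
  assumes G: "abelian_group G" and F: "additive T G F" and F': "additive T G F'"
    and eq: "\<And>x y. \<lbrakk>x \<in> carrier R; y \<in> carrier S\<rbrakk> \<Longrightarrow> F (pure x y) = F' (pure x y)"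
    and z: "z \<in> carrier T"
  shows "F z = F' z"
proof -
  interpret T: abelian_group T by (rule abelian_group_tensor)
  interpret G: abelian_group G by fact
  note zero = additive_zero[OF abelian_group_tensor G]
    and sub = additive_minus[OF abelian_group_tensor G]
  have "F (cls c) = F' (cls c)" if "Poly_Mapping.keys c \<subseteq> carrier R \<times> carrier S" for c
  proof (rule free_Abelian_group_induct[OF that])
    show "F (cls 0) = F' (cls 0)"
      using zero[OF F] zero[OF F'] by (simp add: zero_tensor)
  next
    fix c d
    assume c: "Poly_Mapping.keys c \<subseteq> carrier R \<times> carrier S"
      and d: "Poly_Mapping.keys d \<subseteq> carrier R \<times> carrier S"
      and eqs: "F (cls c) = F' (cls c)" "F (cls d) = F' (cls d)"
    have cd: "c - d \<in> carrier Fr" using c d keys_diff[of c d] by auto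
    have cl: "cls (c - d) \<in> carrier T" "cls c \<in> carrier T" "cls d \<in> carrier T"
      using c d cd unfolding carrier_tensor by auto
    have "cls (c - d) \<oplus>\<^bsub>T\<^esub> cls d = cls c"
      using cd d by (subst add_tensor_class) auto
    then have "cls (c - d) = cls c \<ominus>\<^bsub>T\<^esub> cls d"
      unfolding a_minus_def using cl by (metis T.add.inv_solve_right)
    then show "F (cls (c - d)) = F' (cls (c - d))"
      using eqs sub[OF F] sub[OF F'] cl by simp
  next
    fix p assume "p \<in> carrier R \<times> carrier S"
    then show "F (cls (frag_of p)) = F' (cls (frag_of p))"
      using eq unfolding pure_tensor_def by (cases p) auto
  qed
  then show ?thesis using z by (auto simp: carrier_tensor)
qed

text \<open>
  Both sides are additive in \<open>z\<close> and agree on pure tensors. In Sweedler notation this is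
  \<open>F(\<phi>(z\<^sub>1, z\<^sub>2)) = (F \<circ> \<phi>)(z\<^sub>1, z\<^sub>2)\<close>, the rule for moving a map inside a sum.
\<close>

lemma additive_sweedler:
  assumes "abelian_group G" "abelian_group H" "bal G \<phi>" "additive G H F" "z \<in> carrier T"
  shows "F (sweedler G z \<phi>) = sweedler H z (\<lambda>x y. F (\<phi> x y))"
proof (rule additive_determined_by_pure[OF assms(2) _ _ _ assms(5)])
  have b: "bal H (\<lambda>x y. F (\<phi> x y))" by (rule additive_balanced_comp[OF assms(4,3)])
  show "additive T H (\<lambda>z. sweedler H z (\<lambda>x y. F (\<phi> x y)))"
    by (rule sweedler_additive[OF assms(2) b])
  show "additive T H (\<lambda>z. F (sweedler G z \<phi>))"
    using sweedler_additive[OF assms(1,3)] assms(4) unfolding additive_def by (auto simp: Pi_iff)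
  show "F (sweedler G (pure x y) \<phi>) = sweedler H (pure x y) (\<lambda>x y. F (\<phi> x y))"
    if "x \<in> carrier R" "y \<in> carrier S" for x y
    using that by (simp add: sweedler_pure assms b)
qed

lemma sweedler_pure_id: "z \<in> carrier T \<Longrightarrow> sweedler T z pure = z"
  using additive_determined_by_pure[OF abelian_group_tensor
      sweedler_additive[OF abelian_group_tensor pure_balanced], of "\<lambda>z. z" z]
  by (simp add: sweedler_pure[OF abelian_group_tensor pure_balanced] additive_def)

lemma balanced_cong:
  assumes "bal G \<phi>" "\<And>x y. \<lbrakk>x \<in> carrier R; y \<in> carrier S\<rbrakk> \<Longrightarrow> \<phi> x y = \<psi> x y"
  shows "bal G \<psi>"
proof -
  interpret R: abelian_group R by (rule ab_R)
  interpret S: abelian_group S by (rule ab_S)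
  show ?thesis
    using assms act_R act_S unfolding balanced_def by simp
qed

text \<open>
  Sweedler sums use only values at elements of the factors; equality of \<open>\<phi>\<close> and \<open>\<psi>\<close> as functions
  would be too much to ask, since both are unconstrained elsewhere.
\<close>

lemma sweedler_cong:
  assumes G: "abelian_group G" and b: "bal G \<phi>" and z: "z \<in> carrier T"
    and eq: "\<And>x y. \<lbrakk>x \<in> carrier R; y \<in> carrier S\<rbrakk> \<Longrightarrow> \<phi> x y = \<psi> x y"
  shows "sweedler G z \<phi> = sweedler G z \<psi>"
proof (rule additive_determined_by_pure[OF G _ _ _ z])
  have b': "bal G \<psi>" by (rule balanced_cong[OF b eq])
  show "additive T G (\<lambda>z. sweedler G z \<phi>)" "additive T G (\<lambda>z. sweedler G z \<psi>)"
    by (rule sweedler_additive[OF G b] sweedler_additive[OF G b'])+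
  show "sweedler G (pure x y) \<phi> = sweedler G (pure x y) \<psi>"
    if "x \<in> carrier R" "y \<in> carrier S" for x y
    using that eq by (simp add: sweedler_pure G b b')
qed

lemma sweedler_add_fun:
  assumes G: "abelian_group G" and b: "bal G \<phi>" "bal G \<psi>" and z: "z \<in> carrier T"
  shows "sweedler G z (\<lambda>x y. \<phi> x y \<oplus>\<^bsub>G\<^esub> \<psi> x y) = sweedler G z \<phi> \<oplus>\<^bsub>G\<^esub> sweedler G z \<psi>"
proof (rule additive_determined_by_pure[OF G _ _ _ z])
  interpret G: abelian_group G by fact
  have bb: "bal G (\<lambda>x y. \<phi> x y \<oplus>\<^bsub>G\<^esub> \<psi> x y)"
    using b unfolding balanced_def by (auto simp: G.a_ac)
  show "additive T G (\<lambda>z. sweedler G z (\<lambda>x y. \<phi> x y \<oplus>\<^bsub>G\<^esub> \<psi> x y))"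
    by (rule sweedler_additive[OF G bb])
  show "additive T G (\<lambda>z. sweedler G z \<phi> \<oplus>\<^bsub>G\<^esub> sweedler G z \<psi>)"
    using sweedler_additive[OF G b(1)] sweedler_additive[OF G b(2)]
    unfolding additive_def by (auto simp: Pi_iff G.a_ac)
  show "sweedler G (pure x y) (\<lambda>x y. \<phi> x y \<oplus>\<^bsub>G\<^esub> \<psi> x y) =
      sweedler G (pure x y) \<phi> \<oplus>\<^bsub>G\<^esub> sweedler G (pure x y) \<psi>"
    if "x \<in> carrier R" "y \<in> carrier S" for x y
    using that by (simp add: sweedler_pure G b bb)
qed

end

section \<open>Products of tensors\<close>

lemma (in abelian_group) frag_sum_cong:
  assumes "\<And>x y. (x, y) \<in> Poly_Mapping.keys c \<Longrightarrow> \<phi> x y = \<psi> x y"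
    and "\<And>x y. (x, y) \<in> Poly_Mapping.keys c \<Longrightarrow> \<psi> x y \<in> carrier G"
  shows "frag_sum G \<phi> c = frag_sum G \<psi> c"
  unfolding frag_sum_def using assms by (intro finsum_cong') auto

context tensor_factors
begin

text \<open>
  The product of tensors is built from \<open>frag_extend\<close> on representatives. Modulo the relations,
  \<open>frag_extend\<close> is a sum of the kind that defines Sweedler notation, and well-definedness of the
  product can be read off from the independence of such sums of representatives.
\<close>

lemma tensor_class_frag_extend:
  assumes h: "\<And>p. p \<in> carrier R \<times> carrier S \<Longrightarrow> h p \<in> carrier Fr" and c: "c \<in> carrier Fr"
  shows "frag_extend h c \<in> carrier Fr"
    and "cls (frag_extend h c) = frag_sum T (\<lambda>x y. cls (h (x, y))) c"
proof -
  interpret T: abelian_group T by (rule abelian_group_tensor)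
  have hT: "cls (h (x, y)) \<in> carrier T" if "x \<in> carrier R" "y \<in> carrier S" for x y
    using h[of "(x, y)"] that unfolding carrier_tensor by blast
  interpret F: group_hom Fr "add_monoid T" "frag_sum T (\<lambda>x y. cls (h (x, y)))"
    by (rule T.frag_sum_hom[OF hT])
  have eqdiff: "cls (a - b) = cls a \<ominus>\<^bsub>T\<^esub> cls b" if a: "a \<in> carrier Fr" and b: "b \<in> carrier Fr" for a b
  proof -
    have ab: "a - b \<in> carrier Fr" using a b keys_diff[of a b] by auto
    have cl: "cls (a - b) \<in> carrier T" "cls a \<in> carrier T" "cls b \<in> carrier T"
      using a b ab unfolding carrier_tensor by blast+
    have "cls (a - b) \<oplus>\<^bsub>T\<^esub> cls b = cls a"
      using ab b by (simp add: add_tensor_class)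
    then show ?thesis unfolding a_minus_def using cl by (metis T.add.inv_solve_right)
  qed
  have Fdiff: "frag_sum T (\<lambda>x y. cls (h (x, y))) (a - b) =
      frag_sum T (\<lambda>x y. cls (h (x, y))) a \<ominus>\<^bsub>T\<^esub> frag_sum T (\<lambda>x y. cls (h (x, y))) b"
    if "a \<in> carrier Fr" "b \<in> carrier Fr" for a b
    using F.hom_mult[of a "- b"] F.hom_inv[of b] that by (simp add: a_minus_def a_inv_def)
  have "frag_extend h c \<in> carrier Fr \<and> cls (frag_extend h c) = frag_sum T (\<lambda>x y. cls (h (x, y))) c"
  proof (rule free_Abelian_group_induct[of c "carrier R \<times> carrier S"])
    show "Poly_Mapping.keys c \<subseteq> carrier R \<times> carrier S" using c by simp
    show "frag_extend h 0 \<in> carrier Fr \<and> cls (frag_extend h 0) = frag_sum T (\<lambda>x y. cls (h (x, y))) 0"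
      using F.hom_one by (simp add: zero_tensor)
  next
    fix a b
    assume "Poly_Mapping.keys a \<subseteq> carrier R \<times> carrier S" "Poly_Mapping.keys b \<subseteq> carrier R \<times> carrier S"
      "frag_extend h a \<in> carrier Fr \<and> cls (frag_extend h a) = frag_sum T (\<lambda>x y. cls (h (x, y))) a"
      "frag_extend h b \<in> carrier Fr \<and> cls (frag_extend h b) = frag_sum T (\<lambda>x y. cls (h (x, y))) b"
    then show "frag_extend h (a - b) \<in> carrier Fr \<and>
        cls (frag_extend h (a - b)) = frag_sum T (\<lambda>x y. cls (h (x, y))) (a - b)"
      using keys_diff[of "frag_extend h a" "frag_extend h b"]
      by (simp add: frag_extend_diff eqdiff Fdiff) blast
  next
    fix p assume "p \<in> carrier R \<times> carrier S"
    then show "frag_extend h (frag_of p) \<in> carrier Fr \<and>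
        cls (frag_extend h (frag_of p)) = frag_sum T (\<lambda>x y. cls (h (x, y))) (frag_of p)"
      using h[of p] hT by (cases p) (simp add: T.frag_sum_frag_of)
  qed
  then show "frag_extend h c \<in> carrier Fr"
    and "cls (frag_extend h c) = frag_sum T (\<lambda>x y. cls (h (x, y))) c" by blast+
qed

end

locale tensor_algebras =
  fixes A :: "('a, 'c) ring_scheme" and R :: "('r, 'd) ring_scheme" and f :: "'a \<Rightarrow> 'r"
    and S :: "('s, 'e) ring_scheme" and g :: "'a \<Rightarrow> 's"
  assumes cring_R: "cring R" and cring_S: "cring S"
    and f_closed: "a \<in> carrier A \<Longrightarrow> f a \<in> carrier R"
    and g_closed: "a \<in> carrier A \<Longrightarrow> g a \<in> carrier S"

sublocale tensor_algebras \<subseteq> tensor_factors A R f S g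
proof -
  interpret R: cring R by (rule cring_R)
  interpret S: cring S by (rule cring_S)
  show "tensor_factors A R f S g"
    by unfold_locales (auto simp: f_closed g_closed)
qed

context tensor_algebras
begin

text \<open>
  Commutativity of the factors is what allows multiplication by a fixed pair to respect the
  relation \<open>x f(a) \<otimes> y = x \<otimes> g(a) y\<close>.
\<close>

lemma balanced_translate:
  assumes b: "bal G \<phi>" and xy: "x \<in> carrier R" "y \<in> carrier S"
  shows "bal G (\<lambda>x' y'. \<phi> (x \<otimes>\<^bsub>R\<^esub> x') (y \<otimes>\<^bsub>S\<^esub> y'))"
proof -
  interpret R: cring R by (rule cring_R)
  interpret S: cring S by (rule cring_S)
  have "\<phi> (x \<otimes>\<^bsub>R\<^esub> (x' \<otimes>\<^bsub>R\<^esub> f a)) (y \<otimes>\<^bsub>S\<^esub> y') = \<phi> (x \<otimes>\<^bsub>R\<^esub> x') (y \<otimes>\<^bsub>S\<^esub> (g a \<otimes>\<^bsub>S\<^esub> y'))"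
    if "x' \<in> carrier R" "a \<in> carrier A" "y' \<in> carrier S" for x' a y'
  proof -
    have "\<phi> ((x \<otimes>\<^bsub>R\<^esub> x') \<otimes>\<^bsub>R\<^esub> f a) (y \<otimes>\<^bsub>S\<^esub> y') = \<phi> (x \<otimes>\<^bsub>R\<^esub> x') (g a \<otimes>\<^bsub>S\<^esub> (y \<otimes>\<^bsub>S\<^esub> y'))"
      using b xy that unfolding balanced_def by blast
    then show ?thesis
      using xy that f_closed g_closed by (simp add: R.m_assoc S.m_lcomm)
  qed
  then show ?thesis
    using b xy unfolding balanced_def by (simp add: R.r_distr S.r_distr)
qed

lemma balanced_sweedler_translate:
  assumes G: "abelian_group G" and b: "bal G \<phi>" and w: "w \<in> carrier T"
  shows "bal G (\<lambda>x y. sweedler G w (\<lambda>x' y'. \<phi> (x \<otimes>\<^bsub>R\<^esub> x') (y \<otimes>\<^bsub>S\<^esub> y')))"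
proof (rule balancedI)
  interpret R: cring R by (rule cring_R)
  interpret S: cring S by (rule cring_S)
  note tr = balanced_translate[OF b]
  show "sweedler G w (\<lambda>x' y'. \<phi> (x \<otimes>\<^bsub>R\<^esub> x') (y \<otimes>\<^bsub>S\<^esub> y')) \<in> carrier G"
    if "x \<in> carrier R" "y \<in> carrier S" for x y
    by (rule sweedler_closed[OF G tr[OF that] w])
  show "sweedler G w (\<lambda>x' y'. \<phi> ((x \<oplus>\<^bsub>R\<^esub> z) \<otimes>\<^bsub>R\<^esub> x') (y \<otimes>\<^bsub>S\<^esub> y')) =
      sweedler G w (\<lambda>x' y'. \<phi> (x \<otimes>\<^bsub>R\<^esub> x') (y \<otimes>\<^bsub>S\<^esub> y')) \<oplus>\<^bsub>G\<^esub>
      sweedler G w (\<lambda>x' y'. \<phi> (z \<otimes>\<^bsub>R\<^esub> x') (y \<otimes>\<^bsub>S\<^esub> y'))"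
    if "x \<in> carrier R" "z \<in> carrier R" "y \<in> carrier S" for x z y
  proof (subst sweedler_add_fun[OF G tr tr w, symmetric])
    show "sweedler G w (\<lambda>x' y'. \<phi> ((x \<oplus>\<^bsub>R\<^esub> z) \<otimes>\<^bsub>R\<^esub> x') (y \<otimes>\<^bsub>S\<^esub> y')) =
      sweedler G w (\<lambda>x' y'. \<phi> (x \<otimes>\<^bsub>R\<^esub> x') (y \<otimes>\<^bsub>S\<^esub> y') \<oplus>\<^bsub>G\<^esub> \<phi> (z \<otimes>\<^bsub>R\<^esub> x') (y \<otimes>\<^bsub>S\<^esub> y'))"
      using that b by (intro sweedler_cong[OF G tr w]) (simp_all add: R.l_distr balanced_def)
  qed (use that in auto)
  show "sweedler G w (\<lambda>x' y'. \<phi> (x \<otimes>\<^bsub>R\<^esub> x') ((y \<oplus>\<^bsub>S\<^esub> z) \<otimes>\<^bsub>S\<^esub> y')) =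
      sweedler G w (\<lambda>x' y'. \<phi> (x \<otimes>\<^bsub>R\<^esub> x') (y \<otimes>\<^bsub>S\<^esub> y')) \<oplus>\<^bsub>G\<^esub>
      sweedler G w (\<lambda>x' y'. \<phi> (x \<otimes>\<^bsub>R\<^esub> x') (z \<otimes>\<^bsub>S\<^esub> y'))"
    if "x \<in> carrier R" "y \<in> carrier S" "z \<in> carrier S" for x z y
  proof (subst sweedler_add_fun[OF G tr tr w, symmetric])
    show "sweedler G w (\<lambda>x' y'. \<phi> (x \<otimes>\<^bsub>R\<^esub> x') ((y \<oplus>\<^bsub>S\<^esub> z) \<otimes>\<^bsub>S\<^esub> y')) =
      sweedler G w (\<lambda>x' y'. \<phi> (x \<otimes>\<^bsub>R\<^esub> x') (y \<otimes>\<^bsub>S\<^esub> y') \<oplus>\<^bsub>G\<^esub> \<phi> (x \<otimes>\<^bsub>R\<^esub> x') (z \<otimes>\<^bsub>S\<^esub> y'))"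
      using that b by (intro sweedler_cong[OF G tr w]) (simp_all add: S.l_distr balanced_def)
  qed (use that in auto)
  show "sweedler G w (\<lambda>x' y'. \<phi> ((x \<otimes>\<^bsub>R\<^esub> f a) \<otimes>\<^bsub>R\<^esub> x') (y \<otimes>\<^bsub>S\<^esub> y')) =
      sweedler G w (\<lambda>x' y'. \<phi> (x \<otimes>\<^bsub>R\<^esub> x') ((g a \<otimes>\<^bsub>S\<^esub> y) \<otimes>\<^bsub>S\<^esub> y'))"
    if *: "x \<in> carrier R" "a \<in> carrier A" "y \<in> carrier S" for x a y
  proof (rule sweedler_cong[OF G tr w])
    fix x' y' assume xy': "x' \<in> carrier R" "y' \<in> carrier S"
    have "\<phi> ((x \<otimes>\<^bsub>R\<^esub> x') \<otimes>\<^bsub>R\<^esub> f a) (y \<otimes>\<^bsub>S\<^esub> y') = \<phi> (x \<otimes>\<^bsub>R\<^esub> x') (g a \<otimes>\<^bsub>S\<^esub> (y \<otimes>\<^bsub>S\<^esub> y'))"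
      using b * xy' unfolding balanced_def by (meson R.m_closed S.m_closed)
    then show "\<phi> ((x \<otimes>\<^bsub>R\<^esub> f a) \<otimes>\<^bsub>R\<^esub> x') (y \<otimes>\<^bsub>S\<^esub> y') = \<phi> (x \<otimes>\<^bsub>R\<^esub> x') ((g a \<otimes>\<^bsub>S\<^esub> y) \<otimes>\<^bsub>S\<^esub> y')"
      using * xy' f_closed g_closed by (simp add: R.m_ac S.m_assoc)
  qed (use * f_closed in auto)
qed

text \<open>
  By the balancedness of the two inner maps, every choice of representatives yields the same class, so
  the union in the definition of the product is a union of equal sets.
\<close>

lemma tensor_mult_eq_sweedler:
  assumes z: "z \<in> carrier T" and w: "w \<in> carrier T"
  shows "z \<otimes>\<^bsub>T\<^esub> w = sweedler T z (\<lambda>x y. sweedler T w (\<lambda>x' y'. pure (x \<otimes>\<^bsub>R\<^esub> x') (y \<otimes>\<^bsub>S\<^esub> y')))"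
proof -
  interpret R: cring R by (rule cring_R)
  interpret S: cring S by (rule cring_S)
  interpret T: abelian_group T by (rule abelian_group_tensor)
  let ?m = "\<lambda>d p. frag_extend (\<lambda>(x', y'). frag_of (fst p \<otimes>\<^bsub>R\<^esub> x', snd p \<otimes>\<^bsub>S\<^esub> y')) d"
  let ?s = "sweedler T z (\<lambda>x y. sweedler T w (\<lambda>x' y'. pure (x \<otimes>\<^bsub>R\<^esub> x') (y \<otimes>\<^bsub>S\<^esub> y')))"
  note bal = balanced_translate[OF pure_balanced]
    and bal2 = balanced_sweedler_translate[OF abelian_group_tensor pure_balanced w]
  have rep: "\<exists>c\<in>carrier Fr. z' = cls c" if "z' \<in> carrier T" for z'
    using that unfolding carrier_tensor by blast
  obtain c where c: "c \<in> carrier Fr" "z = cls c" using rep[OF z] by blast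
  obtain d where d: "d \<in> carrier Fr" "w = cls d" using rep[OF w] by blast
  have mem: "e' \<in> carrier Fr" if "e \<in> carrier Fr" "e' \<in> cls e" for e e'
    using that subgroup.subset[OF tensor_null_subgroup]
      monoid.r_coset_subset_G[OF group.is_monoid[OF group_free_Abelian_group]] unfolding tensor_class_def by blast
  have eq: "cls (frag_extend (?m d') c') = ?s" if c': "c' \<in> z" and d': "d' \<in> w" for c' d'
  proof -
    have F: "c' \<in> carrier Fr" "d' \<in> carrier Fr" using mem c d c' d' by blast+
    have inF: "?m d' p \<in> carrier Fr" if "p \<in> carrier R \<times> carrier S" for p
      using that F by (intro tensor_class_frag_extend(1)) auto
    have inner: "cls (?m d' (x, y)) = sweedler T w (\<lambda>x' y'. pure (x \<otimes>\<^bsub>R\<^esub> x') (y \<otimes>\<^bsub>S\<^esub> y'))"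
      if xy: "x \<in> carrier R" "y \<in> carrier S" for x y
    proof -
      have "cls (?m d' (x, y)) = frag_sum T (\<lambda>x' y'. pure (x \<otimes>\<^bsub>R\<^esub> x') (y \<otimes>\<^bsub>S\<^esub> y')) d'"
        using xy F by (subst tensor_class_frag_extend(2)) (auto simp: pure_tensor_def)
      also have "\<dots> = sweedler T w (\<lambda>x' y'. pure (x \<otimes>\<^bsub>R\<^esub> x') (y \<otimes>\<^bsub>S\<^esub> y'))"
        using d d' frag_sum_tensor_class[OF abelian_group_tensor bal[OF xy] d(1), of d']
          sweedler_tensor_class[OF abelian_group_tensor bal[OF xy] d(1)] by simp
      finally show ?thesis .
    qed
    have "cls (frag_extend (?m d') c') = frag_sum T (\<lambda>x y. cls (?m d' (x, y))) c'"
      by (rule tensor_class_frag_extend(2)[OF inF F(1)])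
    also have "\<dots> = frag_sum T (\<lambda>x y. sweedler T w (\<lambda>x' y'. pure (x \<otimes>\<^bsub>R\<^esub> x') (y \<otimes>\<^bsub>S\<^esub> y'))) c'"
    proof (rule T.frag_sum_cong)
      fix x y assume "(x, y) \<in> Poly_Mapping.keys c'"
      then have xy: "x \<in> carrier R" "y \<in> carrier S" using F by auto
      show "cls (?m d' (x, y)) = sweedler T w (\<lambda>x' y'. pure (x \<otimes>\<^bsub>R\<^esub> x') (y \<otimes>\<^bsub>S\<^esub> y'))"
        by (rule inner[OF xy])
      show "sweedler T w (\<lambda>x' y'. pure (x \<otimes>\<^bsub>R\<^esub> x') (y \<otimes>\<^bsub>S\<^esub> y')) \<in> carrier T"
        by (rule sweedler_closed[OF abelian_group_tensor bal[OF xy] w])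
    qed
    also have "\<dots> = ?s"
      using c c' frag_sum_tensor_class[OF abelian_group_tensor bal2 c(1), of c']
        sweedler_tensor_class[OF abelian_group_tensor bal2 c(1)] by simp
    finally show ?thesis .
  qed
  have "z \<otimes>\<^bsub>T\<^esub> w = (\<Union>c'\<in>z. \<Union>d'\<in>w. cls (frag_extend (?m d') c'))"
    unfolding tensor_ring_def Let_def by (simp add: case_prod_unfold)
  also have "\<dots> = (\<Union>c'\<in>z. \<Union>d'\<in>w. ?s)"
    using eq by simp
  also have "\<dots> = ?s"
    using mem_tensor_class c d by blast
  finally show ?thesis .
qed

lemma tensor_mult_closed: "\<lbrakk>z \<in> carrier T; w \<in> carrier T\<rbrakk> \<Longrightarrow> z \<otimes>\<^bsub>T\<^esub> w \<in> carrier T"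
  unfolding tensor_mult_eq_sweedler
  by (rule sweedler_closed[OF abelian_group_tensor balanced_sweedler_translate])
    (auto simp: abelian_group_tensor pure_balanced)

text \<open>
  The rule \<open>\<phi>((zw)\<^sub>1, (zw)\<^sub>2) = \<phi>(z\<^sub>1 w\<^sub>1, z\<^sub>2 w\<^sub>2)\<close>.
\<close>

lemma sweedler_mult:
  assumes G: "abelian_group G" and b: "bal G \<phi>" and z: "z \<in> carrier T" and w: "w \<in> carrier T"
  shows "sweedler G (z \<otimes>\<^bsub>T\<^esub> w) \<phi> =
    sweedler G z (\<lambda>x y. sweedler G w (\<lambda>x' y'. \<phi> (x \<otimes>\<^bsub>R\<^esub> x') (y \<otimes>\<^bsub>S\<^esub> y')))"
proof -
  interpret R: cring R by (rule cring_R)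
  interpret S: cring S by (rule cring_S)
  note T = abelian_group_tensor
    and bal = balanced_translate[OF pure_balanced]
    and bal2 = balanced_sweedler_translate[OF abelian_group_tensor pure_balanced w]
    and add = sweedler_additive[OF G b]
  have "sweedler G (z \<otimes>\<^bsub>T\<^esub> w) \<phi> = sweedler G z
      (\<lambda>x y. sweedler G (sweedler T w (\<lambda>x' y'. pure (x \<otimes>\<^bsub>R\<^esub> x') (y \<otimes>\<^bsub>S\<^esub> y'))) \<phi>)"
    unfolding tensor_mult_eq_sweedler[OF z w] by (rule additive_sweedler[OF T G bal2 add z])
  also have "\<dots> = sweedler G z (\<lambda>x y. sweedler G w (\<lambda>x' y'. \<phi> (x \<otimes>\<^bsub>R\<^esub> x') (y \<otimes>\<^bsub>S\<^esub> y')))"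
  proof (rule sweedler_cong[OF G _ z])
    show "bal G (\<lambda>x y. sweedler G (sweedler T w (\<lambda>x' y'. pure (x \<otimes>\<^bsub>R\<^esub> x') (y \<otimes>\<^bsub>S\<^esub> y'))) \<phi>)"
      by (rule additive_balanced_comp[OF add bal2])
    fix x y assume xy: "x \<in> carrier R" "y \<in> carrier S"
    have "sweedler G (sweedler T w (\<lambda>x' y'. pure (x \<otimes>\<^bsub>R\<^esub> x') (y \<otimes>\<^bsub>S\<^esub> y'))) \<phi> =
        sweedler G w (\<lambda>x' y'. sweedler G (pure (x \<otimes>\<^bsub>R\<^esub> x') (y \<otimes>\<^bsub>S\<^esub> y')) \<phi>)"
      by (rule additive_sweedler[OF T G bal[OF xy] add w])
    also have "\<dots> = sweedler G w (\<lambda>x' y'. \<phi> (x \<otimes>\<^bsub>R\<^esub> x') (y \<otimes>\<^bsub>S\<^esub> y'))"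
      using xy by (intro sweedler_cong[OF G additive_balanced_comp[OF add bal[OF xy]] w])
        (auto simp: sweedler_pure[OF G b])
    finally show "sweedler G (sweedler T w (\<lambda>x' y'. pure (x \<otimes>\<^bsub>R\<^esub> x') (y \<otimes>\<^bsub>S\<^esub> y'))) \<phi> =
        sweedler G w (\<lambda>x' y'. \<phi> (x \<otimes>\<^bsub>R\<^esub> x') (y \<otimes>\<^bsub>S\<^esub> y'))" .
  qed
  finally show ?thesis .
qed

end

lemma (in tensor_algebras) pure_mult:
  assumes "x \<in> carrier R" "y \<in> carrier S" "x' \<in> carrier R" "y' \<in> carrier S"
  shows "pure x y \<otimes>\<^bsub>T\<^esub> pure x' y' = pure (x \<otimes>\<^bsub>R\<^esub> x') (y \<otimes>\<^bsub>S\<^esub> y')"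
  using assms
  by (simp add: tensor_mult_eq_sweedler pure_closed abelian_group_tensor pure_balanced
      sweedler_pure balanced_sweedler_translate balanced_translate)

section \<open>Modules of functions and commutator Lie algebras\<close>

text \<open>
  The dual, the comodule endomorphisms and the dual of the conormal module are all modules of
  extensional functions with pointwise operations. Only the closure properties differ, and
  additive inverses come for free from multiplication by \<open>-1\<close>.
\<close>

lemma pointwise_module:
  assumes N: "module R N" and V: "carrier V \<subseteq> X \<rightarrow>\<^sub>E carrier N"
    and zero: "\<zero>\<^bsub>V\<^esub> = (\<lambda>u\<in>X. \<zero>\<^bsub>N\<^esub>)"
    and add: "\<And>f g. f \<oplus>\<^bsub>V\<^esub> g = (\<lambda>u\<in>X. f u \<oplus>\<^bsub>N\<^esub> g u)"
    and smult: "\<And>a f. a \<odot>\<^bsub>V\<^esub> f = (\<lambda>u\<in>X. a \<odot>\<^bsub>N\<^esub> f u)"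
    and zero_closed: "\<zero>\<^bsub>V\<^esub> \<in> carrier V"
    and add_closed: "\<And>f g. \<lbrakk>f \<in> carrier V; g \<in> carrier V\<rbrakk> \<Longrightarrow> f \<oplus>\<^bsub>V\<^esub> g \<in> carrier V"
    and smult_closed: "\<And>a f. \<lbrakk>a \<in> carrier R; f \<in> carrier V\<rbrakk> \<Longrightarrow> a \<odot>\<^bsub>V\<^esub> f \<in> carrier V"
  shows "module R V"
proof -
  interpret N: module R N by fact
  have cl: "f u \<in> carrier N" if "f \<in> carrier V" "u \<in> X" for f u
    using that V by auto
  have ext: "f = g" if "f \<in> extensional X" "g \<in> extensional X" "\<And>u. u \<in> X \<Longrightarrow> f u = g u" for f g
    using that by (rule extensionalityI)
  have ex: "f \<in> extensional X" if "f \<in> carrier V" for f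
    using that V by (auto simp: PiE_def)
  note [simp] = zero add smult cl
  have inv: "\<exists>g\<in>carrier V. g \<oplus>\<^bsub>V\<^esub> f = \<zero>\<^bsub>V\<^esub>" if f: "f \<in> carrier V" for f
  proof (rule bexI[of _ "\<ominus>\<^bsub>R\<^esub> \<one>\<^bsub>R\<^esub> \<odot>\<^bsub>V\<^esub> f"])
    show "\<ominus>\<^bsub>R\<^esub> \<one>\<^bsub>R\<^esub> \<odot>\<^bsub>V\<^esub> f \<oplus>\<^bsub>V\<^esub> f = \<zero>\<^bsub>V\<^esub>"
      using f by (intro ext) (auto simp: N.smult_l_minus N.M.l_neg)
    show "\<ominus>\<^bsub>R\<^esub> \<one>\<^bsub>R\<^esub> \<odot>\<^bsub>V\<^esub> f \<in> carrier V" using f by (intro smult_closed) auto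
  qed
  show ?thesis
  proof (rule moduleI)
    show "abelian_group V"
    proof (rule abelian_groupI)
      show "\<exists>g\<in>carrier V. g \<oplus>\<^bsub>V\<^esub> f = \<zero>\<^bsub>V\<^esub>" if "f \<in> carrier V" for f by (rule inv[OF that])
      show "\<zero>\<^bsub>V\<^esub> \<in> carrier V" by (rule zero_closed)
      show "f \<oplus>\<^bsub>V\<^esub> g \<in> carrier V" if "f \<in> carrier V" "g \<in> carrier V" for f g
        by (rule add_closed[OF that])
    qed (auto intro!: ext simp: N.M.a_ac ex)
    show "cring R" by unfold_locales
    show "a \<odot>\<^bsub>V\<^esub> f \<in> carrier V" if "a \<in> carrier R" "f \<in> carrier V" for a f
      by (rule smult_closed[OF that])
  qed (auto intro!: ext simp: N.smult_l_distr N.smult_r_distr N.smult_assoc1 ex)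
qed

lemma pointwise_minus:
  assumes V: "abelian_group V" and N: "abelian_group N" and sub: "carrier V \<subseteq> X \<rightarrow>\<^sub>E carrier N"
    and add: "\<And>f g. f \<oplus>\<^bsub>V\<^esub> g = (\<lambda>u\<in>X. f u \<oplus>\<^bsub>N\<^esub> g u)"
    and fg: "f \<in> carrier V" "g \<in> carrier V" and u: "u \<in> X"
  shows "(f \<ominus>\<^bsub>V\<^esub> g) u = f u \<ominus>\<^bsub>N\<^esub> g u"
proof (rule additive_minus[OF V N _ fg])
  show "additive V N (\<lambda>f. f u)" using sub u by (auto simp: additive_def add)
qed

lemma (in module) submoduleI_smult:
  assumes "H \<subseteq> carrier M" "\<zero>\<^bsub>M\<^esub> \<in> H" "\<And>x y. \<lbrakk>x \<in> H; y \<in> H\<rbrakk> \<Longrightarrow> x \<oplus>\<^bsub>M\<^esub> y \<in> H"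
    and "\<And>a x. \<lbrakk>a \<in> carrier R; x \<in> H\<rbrakk> \<Longrightarrow> a \<odot>\<^bsub>M\<^esub> x \<in> H"
  shows "submodule H R M"
proof (rule submoduleI)
  fix x assume x: "x \<in> H"
  then have "\<ominus>\<^bsub>M\<^esub> x = (\<ominus> \<one>) \<odot>\<^bsub>M\<^esub> x"
    using assms(1) by (subst smult_l_minus) auto
  then show "\<ominus>\<^bsub>M\<^esub> x \<in> H" using assms(4)[of "\<ominus> \<one>" x] x by simp
qed (use assms in auto)

text \<open>
  The ring and the vector space are separate records with the same additive group, since a ring that
  is also an \<open>A\<close>-module becomes a vector space over \<open>K\<close> only after restriction of scalars.
\<close>

lemma commutator_lie_algebra:
  assumes "field K" and R: "ring R" and V: "module K V"
    and eqs: "carrier V = carrier R" "ring.add V = ring.add R" "\<zero>\<^bsub>V\<^esub> = \<zero>\<^bsub>R\<^esub>"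
    and sl: "\<And>k x y. \<lbrakk>k \<in> carrier K; x \<in> carrier R; y \<in> carrier R\<rbrakk> \<Longrightarrow>
      (k \<odot>\<^bsub>V\<^esub> x) \<otimes>\<^bsub>R\<^esub> y = k \<odot>\<^bsub>V\<^esub> (x \<otimes>\<^bsub>R\<^esub> y)"
    and sr: "\<And>k x y. \<lbrakk>k \<in> carrier K; x \<in> carrier R; y \<in> carrier R\<rbrakk> \<Longrightarrow>
      x \<otimes>\<^bsub>R\<^esub> (k \<odot>\<^bsub>V\<^esub> y) = k \<odot>\<^bsub>V\<^esub> (x \<otimes>\<^bsub>R\<^esub> y)"
  shows "lie_algebra K V (commutator R)"
proof -
  interpret R: ring R by fact
  interpret V: module K V by fact
  have smult_minus: "k \<odot>\<^bsub>V\<^esub> (x \<ominus>\<^bsub>R\<^esub> y) = k \<odot>\<^bsub>V\<^esub> x \<ominus>\<^bsub>R\<^esub> k \<odot>\<^bsub>V\<^esub> y"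
    if "k \<in> carrier K" "x \<in> carrier R" "y \<in> carrier R" for k x y
  proof (rule additive_minus[OF R.abelian_group_axioms R.abelian_group_axioms _ that(2,3)])
    show "additive R R (\<lambda>x. k \<odot>\<^bsub>V\<^esub> x)"
      using that V.smult_closed[of k] V.smult_r_distr[of k] eqs by (auto simp: additive_def)
  qed
  have sc: "k \<odot>\<^bsub>V\<^esub> x \<in> carrier R" if "k \<in> carrier K" "x \<in> carrier R" for k x
    using V.smult_closed[of k x] that eqs by simp
  have bilin: "commutator R (x \<oplus>\<^bsub>R\<^esub> y) z = commutator R x z \<oplus>\<^bsub>R\<^esub> commutator R y z \<and>
      commutator R z (x \<oplus>\<^bsub>R\<^esub> y) = commutator R z x \<oplus>\<^bsub>R\<^esub> commutator R z y"
    if "x \<in> carrier R" "y \<in> carrier R" "z \<in> carrier R" for x y z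
    using that
    by (simp add: commutator_def a_minus_def R.l_distr R.r_distr R.minus_add R.a_ac)
  have alt: "commutator R x x = \<zero>\<^bsub>R\<^esub>" if "x \<in> carrier R" for x
    using that unfolding commutator_def by (simp add: a_minus_def R.r_neg)
  have jac: "commutator R x (commutator R y z) \<oplus>\<^bsub>R\<^esub> commutator R y (commutator R z x) \<oplus>\<^bsub>R\<^esub>
      commutator R z (commutator R x y) = \<zero>\<^bsub>R\<^esub>"
    if "x \<in> carrier R" "y \<in> carrier R" "z \<in> carrier R" for x y z
  proof -
    have nested: "commutator R p (commutator R q r) =
        p \<otimes>\<^bsub>R\<^esub> (q \<otimes>\<^bsub>R\<^esub> r) \<oplus>\<^bsub>R\<^esub> \<ominus>\<^bsub>R\<^esub> (p \<otimes>\<^bsub>R\<^esub> (r \<otimes>\<^bsub>R\<^esub> q)) \<oplus>\<^bsub>R\<^esub>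
        (\<ominus>\<^bsub>R\<^esub> (q \<otimes>\<^bsub>R\<^esub> (r \<otimes>\<^bsub>R\<^esub> p)) \<oplus>\<^bsub>R\<^esub> r \<otimes>\<^bsub>R\<^esub> (q \<otimes>\<^bsub>R\<^esub> p))"
      if "p \<in> carrier R" "q \<in> carrier R" "r \<in> carrier R" for p q r
      using that
      by (simp add: commutator_def a_minus_def R.l_distr R.r_distr R.l_minus R.r_minus
          R.minus_add R.m_assoc)
    \<comment> \<open>the terms of the three nested commutators, matched up to their signs\<close>
    have cancel: "(a \<oplus>\<^bsub>R\<^esub> \<ominus>\<^bsub>R\<^esub> b \<oplus>\<^bsub>R\<^esub> (\<ominus>\<^bsub>R\<^esub> c \<oplus>\<^bsub>R\<^esub> d)) \<oplus>\<^bsub>R\<^esub> (c \<oplus>\<^bsub>R\<^esub> \<ominus>\<^bsub>R\<^esub> f \<oplus>\<^bsub>R\<^esub> (\<ominus>\<^bsub>R\<^esub> g \<oplus>\<^bsub>R\<^esub> b)) \<oplus>\<^bsub>R\<^esub>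
        (g \<oplus>\<^bsub>R\<^esub> \<ominus>\<^bsub>R\<^esub> d \<oplus>\<^bsub>R\<^esub> (\<ominus>\<^bsub>R\<^esub> a \<oplus>\<^bsub>R\<^esub> f)) = \<zero>\<^bsub>R\<^esub>" (is "?lhs = _")
      if in_R: "a \<in> carrier R" "b \<in> carrier R" "c \<in> carrier R" "d \<in> carrier R"
        "f \<in> carrier R" "g \<in> carrier R" for a b c d f g
    proof -
      have "?lhs = (a \<oplus>\<^bsub>R\<^esub> \<ominus>\<^bsub>R\<^esub> a) \<oplus>\<^bsub>R\<^esub> (b \<oplus>\<^bsub>R\<^esub> \<ominus>\<^bsub>R\<^esub> b) \<oplus>\<^bsub>R\<^esub> (c \<oplus>\<^bsub>R\<^esub> \<ominus>\<^bsub>R\<^esub> c) \<oplus>\<^bsub>R\<^esub>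
          (d \<oplus>\<^bsub>R\<^esub> \<ominus>\<^bsub>R\<^esub> d) \<oplus>\<^bsub>R\<^esub> (f \<oplus>\<^bsub>R\<^esub> \<ominus>\<^bsub>R\<^esub> f) \<oplus>\<^bsub>R\<^esub> (g \<oplus>\<^bsub>R\<^esub> \<ominus>\<^bsub>R\<^esub> g)"
        using in_R by (simp add: R.a_ac)
      then show ?thesis using in_R by (simp add: R.r_neg)
    qed
    show ?thesis
      using that by (subst nested nested nested; simp)+ (rule cancel; simp)
  qed
  show ?thesis
    unfolding lie_algebra_def eqs using assms(1) V
  proof (intro conjI ballI funcsetI)
    fix k x y assume *: "k \<in> carrier K" "x \<in> carrier R" "y \<in> carrier R"
    show "commutator R (k \<odot>\<^bsub>V\<^esub> x) y = k \<odot>\<^bsub>V\<^esub> commutator R x y"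
      and "commutator R x (k \<odot>\<^bsub>V\<^esub> y) = k \<odot>\<^bsub>V\<^esub> commutator R x y"
      using * by (simp_all add: commutator_def sl sr smult_minus)
  next
    show "commutator R x y \<in> carrier R" if "x \<in> carrier R" "y \<in> carrier R" for x y
      using that by (simp add: commutator_def)
  qed (simp_all add: bilin alt jac)
qed

text \<open>
  Every Lie axiom for \<open>br\<close> is an equation, which may be checked after applying the injection \<open>f\<close>. This
  serves both for subspaces closed under a bracket and for transport of structure.
\<close>

lemma lie_algebra_pullback:
  assumes W: "lie_algebra K W br'" and V: "module K V"
    and f: "f \<in> lin_maps K V W" and inj: "inj_on f (carrier V)"
    and br: "\<And>x y. \<lbrakk>x \<in> carrier V; y \<in> carrier V\<rbrakk> \<Longrightarrow> br x y \<in> carrier V"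
    and hom: "\<And>x y. \<lbrakk>x \<in> carrier V; y \<in> carrier V\<rbrakk> \<Longrightarrow> f (br x y) = br' (f x) (f y)"
  shows "lie_hom K V br W br' f"
proof -
  interpret V: module K V by fact
  interpret W: module K W using W by (simp add: lie_algebra_def)
  have fc: "f x \<in> carrier W" if "x \<in> carrier V" for x using f that by (auto simp: lin_maps_def)
  have fa: "f (x \<oplus>\<^bsub>V\<^esub> y) = f x \<oplus>\<^bsub>W\<^esub> f y" if "x \<in> carrier V" "y \<in> carrier V" for x y
    using f that by (auto simp: lin_maps_def)
  have fs: "f (k \<odot>\<^bsub>V\<^esub> x) = k \<odot>\<^bsub>W\<^esub> f x" if "k \<in> carrier K" "x \<in> carrier V" for k x
    using f that by (auto simp: lin_maps_def)
  have f0: "f \<zero>\<^bsub>V\<^esub> = \<zero>\<^bsub>W\<^esub>"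
    by (rule additive_zero[OF V.abelian_group_axioms W.abelian_group_axioms])
      (auto simp: additive_def fc fa)
  have eqI: "x = y" if "f x = f y" "x \<in> carrier V" "y \<in> carrier V" for x y
    using that inj by (auto dest: inj_onD)
  note [simp] = fc fa fs f0 br hom
  have "lie_algebra K V br"
    using W V unfolding lie_algebra_def
    by (intro conjI ballI funcsetI eqI) auto
  then show ?thesis using W f hom unfolding lie_hom_def by blast
qed

section \<open>Coassociativity for trilinear maps\<close>

context comm_hopf_algebroid
begin

abbreviation "A \<equiv> base \<H>"
abbreviation "U \<equiv> tot \<H>"
abbreviation "s \<equiv> src \<H>"
abbreviation "t \<equiv> tgt \<H>"
abbreviation "D \<equiv> comult \<H>"
abbreviation "e \<equiv> counit \<H>"

sublocale A: cring A
  using algebra_base by (rule algebra.axioms(2)) 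

sublocale U: cring U
  using algebra_tot by (rule algebra.axioms(2))

lemma src_ring_hom: "s \<in> ring_hom A U" and tgt_ring_hom: "t \<in> ring_hom A U"
  and counit_ring_hom: "e \<in> ring_hom U A"
  using src_hom tgt_hom counit_hom by (auto simp: alg_hom_def)

sublocale src: ring_hom_cring A U s
  by unfold_locales (rule src_ring_hom)

sublocale tgt: ring_hom_cring A U t
  by unfold_locales (rule tgt_ring_hom)

sublocale counit: ring_hom_cring U A e
  by unfold_locales (rule counit_ring_hom)

lemma counit_src [simp]: "a \<in> carrier A \<Longrightarrow> e (s a) = a"
  using counit_bilinear[of a "\<one>\<^bsub>A\<^esub>" "\<one>\<^bsub>U\<^esub>"] by simp

lemma counit_tgt [simp]: "a \<in> carrier A \<Longrightarrow> e (t a) = a"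
  using counit_bilinear[of "\<one>\<^bsub>A\<^esub>" a "\<one>\<^bsub>U\<^esub>"] by simp

sublocale T2: tensor_algebras A U t U s
  rewrites "tensor_ring A U t U s = tens2 \<H>" and "pure_tensor A U t U s = pure2 \<H>"
  by unfold_locales (auto simp: tens2_def pure2_def)

abbreviation "T2 \<equiv> tens2 \<H>"
abbreviation "T3 \<equiv> tens3 \<H>"
abbreviation "bal2 \<equiv> balanced A U t U s"

lemma comult_closed [simp]: "u \<in> carrier U \<Longrightarrow> D u \<in> carrier T2"
  using comult_ring_hom by (rule ring_hom_closed)

lemma comult_additive: "additive U T2 D"
  using comult_ring_hom by (auto simp: additive_def ring_hom_def)

lemma comult_one: "D \<one>\<^bsub>U\<^esub> = pure2 \<H> \<one>\<^bsub>U\<^esub> \<one>\<^bsub>U\<^esub>"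
  using ring_hom_one[OF comult_ring_hom] unfolding tens2_def pure2_def tensor_ring_def Let_def by simp

lemma comult_src_tgt:
  assumes "a \<in> carrier A" "b \<in> carrier A"
  shows "D (s a \<otimes>\<^bsub>U\<^esub> t b) = pure2 \<H> (s a) (t b)"
  using comult_bilinear[of a b "\<one>\<^bsub>U\<^esub>"] assms by (simp add: comult_one T2.pure_mult)

lemma comult_tgt: "b \<in> carrier A \<Longrightarrow> D (t b) = pure2 \<H> \<one>\<^bsub>U\<^esub> (t b)"
  using comult_src_tgt[of "\<one>\<^bsub>A\<^esub>" b] by simp

lemma comult_mult_tgt:
  "\<lbrakk>u \<in> carrier U; b \<in> carrier A\<rbrakk> \<Longrightarrow> D (u \<otimes>\<^bsub>U\<^esub> t b) = D u \<otimes>\<^bsub>T2\<^esub> pure2 \<H> \<one>\<^bsub>U\<^esub> (t b)"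
  using ring_hom_mult[OF comult_ring_hom, of u "t b"] by (simp add: comult_tgt)

text \<open>
  \<open>\<Delta>(s(a) u) = s(a) u\<^sub>1 \<otimes> u\<^sub>2\<close>.
\<close>

lemma sweedler_comult_src:
  assumes G: "abelian_group G" and b: "bal2 G \<phi>" and a: "a \<in> carrier A" and u: "u \<in> carrier U"
  shows "sweedler G (D (s a \<otimes>\<^bsub>U\<^esub> u)) \<phi> = sweedler G (D u) (\<lambda>x y. \<phi> (s a \<otimes>\<^bsub>U\<^esub> x) y)"
proof -
  have "D (s a \<otimes>\<^bsub>U\<^esub> u) = pure2 \<H> (s a) \<one>\<^bsub>U\<^esub> \<otimes>\<^bsub>T2\<^esub> D u"
    using comult_bilinear[of a "\<one>\<^bsub>A\<^esub>" u] a u by simp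
  then have "sweedler G (D (s a \<otimes>\<^bsub>U\<^esub> u)) \<phi> =
      sweedler G (D u) (\<lambda>x y. \<phi> (s a \<otimes>\<^bsub>U\<^esub> x) (\<one>\<^bsub>U\<^esub> \<otimes>\<^bsub>U\<^esub> y))"
    using a u by (simp add: T2.sweedler_mult[OF G b] T2.pure_closed
        T2.sweedler_pure[OF G T2.balanced_sweedler_translate[OF G b]])
  also have "\<dots> = sweedler G (D u) (\<lambda>x y. \<phi> (s a \<otimes>\<^bsub>U\<^esub> x) y)"
    using a u by (intro T2.sweedler_cong[OF G T2.balanced_translate[OF b]]) auto
  finally show ?thesis .
qed

lemma sweedler_mult_tgt:
  assumes G: "abelian_group G" and b: "bal2 G \<phi>" and a: "a \<in> carrier A" and z: "z \<in> carrier T2"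
  shows "sweedler G (z \<otimes>\<^bsub>T2\<^esub> pure2 \<H> \<one>\<^bsub>U\<^esub> (t a)) \<phi> = sweedler G z (\<lambda>x y. \<phi> x (y \<otimes>\<^bsub>U\<^esub> t a))"
proof -
  have p: "pure2 \<H> \<one>\<^bsub>U\<^esub> (t a) \<in> carrier T2" using a by (simp add: T2.pure_closed)
  have "sweedler G (z \<otimes>\<^bsub>T2\<^esub> pure2 \<H> \<one>\<^bsub>U\<^esub> (t a)) \<phi> =
      sweedler G z (\<lambda>x y. sweedler G (pure2 \<H> \<one>\<^bsub>U\<^esub> (t a)) (\<lambda>x' y'. \<phi> (x \<otimes>\<^bsub>U\<^esub> x') (y \<otimes>\<^bsub>U\<^esub> y')))"
    by (rule T2.sweedler_mult[OF G b z p])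
  also have "\<dots> = sweedler G z (\<lambda>x y. \<phi> x (y \<otimes>\<^bsub>U\<^esub> t a))"
    using a z by (intro T2.sweedler_cong[OF G T2.balanced_sweedler_translate[OF G b p]])
      (simp_all add: T2.sweedler_pure[OF G T2.balanced_translate[OF b]])
  finally show ?thesis .
qed

text \<open>
  \<open>\<Delta>(u t(a)) = u\<^sub>1 \<otimes> u\<^sub>2 t(a)\<close>.
\<close>

lemma sweedler_comult_tgt:
  assumes "abelian_group G" "bal2 G \<phi>" "a \<in> carrier A" "u \<in> carrier U"
  shows "sweedler G (D (u \<otimes>\<^bsub>U\<^esub> t a)) \<phi> = sweedler G (D u) (\<lambda>x y. \<phi> x (y \<otimes>\<^bsub>U\<^esub> t a))"
  using assms by (simp add: comult_mult_tgt sweedler_mult_tgt)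

sublocale T3: tensor_factors A T2 "\<lambda>a. pure2 \<H> \<one>\<^bsub>U\<^esub> (t a)" U s
  rewrites "tensor_ring A T2 (\<lambda>a. pure2 \<H> \<one>\<^bsub>U\<^esub> (t a)) U s = T3"
    and "pure_tensor A T2 (\<lambda>a. pure2 \<H> \<one>\<^bsub>U\<^esub> (t a)) U s = pure3 \<H>"
proof -
  show "tensor_factors A T2 (\<lambda>a. pure2 \<H> \<one>\<^bsub>U\<^esub> (t a)) U s"
    using T2.abelian_group_tensor T2.tensor_mult_closed T2.pure_closed U.abelian_group_axioms
    by (intro tensor_factors.intro) auto
qed (simp_all add: tens3_def pure3_def)

text \<open>
  Trilinear maps compatible with both tensor signs of \<open>\<H> \<otimes>\<^sub>A \<H> \<otimes>\<^sub>A \<H>\<close>. Fixing the last and fixing the first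
  variable covers the conditions at the two signs.
\<close>

definition tribalanced :: "('g, 'z) ring_scheme \<Rightarrow> ('h \<Rightarrow> 'h \<Rightarrow> 'h \<Rightarrow> 'g) \<Rightarrow> bool" where
  "tribalanced G \<psi> \<longleftrightarrow>
     (\<forall>z\<in>carrier U. bal2 G (\<lambda>x y. \<psi> x y z)) \<and> (\<forall>x\<in>carrier U. bal2 G (\<psi> x))"

text \<open>
  Needed to make sense of \<open>\<psi>(u\<^sub>1, u\<^sub>2, u\<^sub>3)\<close> when the second tensor factor is expanded: the balance
  condition \<open>\<psi>(x t(a), \<sqdot>, \<sqdot>) = \<psi>(x, s(a) \<sqdot>, \<sqdot>)\<close> matches left \<open>A\<close>-linearity of \<open>\<Delta>\<close>.
\<close>

lemma balanced_comult_right: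
  assumes G: "abelian_group G" and b: "tribalanced G \<psi>"
  shows "bal2 G (\<lambda>x z. sweedler G (D z) (\<lambda>z' z''. \<psi> x z' z''))"
proof (rule balancedI)
  have bz: "bal2 G (\<lambda>x y. \<psi> x y z)" if "z \<in> carrier U" for z
    using b that by (auto simp: tribalanced_def)
  have bx: "bal2 G (\<psi> x)" if "x \<in> carrier U" for x
    using b that by (auto simp: tribalanced_def)
  show "sweedler G (D z) (\<psi> x) \<in> carrier G"
    if "x \<in> carrier U" "z \<in> carrier U" for x z
    using that by (intro T2.sweedler_closed[OF G bx]) auto
  show "sweedler G (D z) (\<psi> (x \<oplus>\<^bsub>U\<^esub> y)) = sweedler G (D z) (\<psi> x) \<oplus>\<^bsub>G\<^esub> sweedler G (D z) (\<psi> y)"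
    if *: "x \<in> carrier U" "y \<in> carrier U" "z \<in> carrier U" for x y z
  proof -
    have "sweedler G (D z) (\<psi> (x \<oplus>\<^bsub>U\<^esub> y)) =
        sweedler G (D z) (\<lambda>z' z''. \<psi> x z' z'' \<oplus>\<^bsub>G\<^esub> \<psi> y z' z'')"
      using * bz by (intro T2.sweedler_cong[OF G bx]) (auto simp: balanced_def)
    then show ?thesis using * T2.sweedler_add_fun[OF G bx bx] by simp
  qed
  show "sweedler G (D (y \<oplus>\<^bsub>U\<^esub> z)) (\<psi> x) = sweedler G (D y) (\<psi> x) \<oplus>\<^bsub>G\<^esub> sweedler G (D z) (\<psi> x)"
    if "x \<in> carrier U" "y \<in> carrier U" "z \<in> carrier U" for x y z
    using that comult_additive T2.sweedler_add[OF G bx] by (simp add: additive_def)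
  show "sweedler G (D z) (\<psi> (x \<otimes>\<^bsub>U\<^esub> t a)) = sweedler G (D (s a \<otimes>\<^bsub>U\<^esub> z)) (\<psi> x)"
    if *: "x \<in> carrier U" "a \<in> carrier A" "z \<in> carrier U" for x a z
  proof -
    have "sweedler G (D z) (\<psi> (x \<otimes>\<^bsub>U\<^esub> t a)) = sweedler G (D z) (\<lambda>z' z''. \<psi> x (s a \<otimes>\<^bsub>U\<^esub> z') z'')"
      using * bz by (intro T2.sweedler_cong[OF G bx]) (auto simp: balanced_def)
    then show ?thesis using * sweedler_comult_src[OF G bx] by simp
  qed
qed

text \<open>
  The coassociativity axiom is an equation in the threefold tensor product. A tribalanced map
  induces a homomorphism on that tensor product, and applying it to both sides of the axiom
  gives the equation for \<open>\<psi>\<close>.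
\<close>

lemma sweedler_coassoc:
  assumes G: "abelian_group G" and b: "tribalanced G \<psi>" and u: "u \<in> carrier U"
  shows "sweedler G (D u) (\<lambda>x z. sweedler G (D x) (\<lambda>x' x''. \<psi> x' x'' z)) =
    sweedler G (D u) (\<lambda>x z. sweedler G (D z) (\<lambda>z' z''. \<psi> x z' z''))"
proof -
  have bz: "bal2 G (\<lambda>x y. \<psi> x y z)" if "z \<in> carrier U" for z
    using b that by (auto simp: tribalanced_def)
  have bx: "bal2 G (\<psi> x)" if "x \<in> carrier U" for x
    using b that by (auto simp: tribalanced_def)
  note T3 = T3.abelian_group_tensor and p3 = T3.pure_balanced and p2 = T2.pure_balanced
  \<comment> \<open>the map induced by \<open>\<psi>\<close> on the first two factors, and then on all three\<close>
  let ?\<Psi> = "\<lambda>w z. sweedler G w (\<lambda>x y. \<psi> x y z)"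
  have Psi: "balanced A T2 (\<lambda>a. pure2 \<H> \<one>\<^bsub>U\<^esub> (t a)) U s G ?\<Psi>"
  proof (rule balancedI)
    show "?\<Psi> w z \<in> carrier G" if "w \<in> carrier T2" "z \<in> carrier U" for w z
      using that by (intro T2.sweedler_closed[OF G bz])
    show "?\<Psi> (w \<oplus>\<^bsub>T2\<^esub> v) z = ?\<Psi> w z \<oplus>\<^bsub>G\<^esub> ?\<Psi> v z"
      if "w \<in> carrier T2" "v \<in> carrier T2" "z \<in> carrier U" for w v z
      using that by (intro T2.sweedler_add[OF G bz])
    show "?\<Psi> w (y \<oplus>\<^bsub>U\<^esub> z) = ?\<Psi> w y \<oplus>\<^bsub>G\<^esub> ?\<Psi> w z"
      if *: "w \<in> carrier T2" "y \<in> carrier U" "z \<in> carrier U" for w y z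
    proof -
      have "?\<Psi> w (y \<oplus>\<^bsub>U\<^esub> z) = sweedler G w (\<lambda>x' x''. \<psi> x' x'' y \<oplus>\<^bsub>G\<^esub> \<psi> x' x'' z)"
        using * bx by (intro T2.sweedler_cong[OF G bz]) (auto simp: balanced_def)
      then show ?thesis using * T2.sweedler_add_fun[OF G bz bz] by simp
    qed
    show "?\<Psi> (w \<otimes>\<^bsub>T2\<^esub> pure2 \<H> \<one>\<^bsub>U\<^esub> (t a)) z = ?\<Psi> w (s a \<otimes>\<^bsub>U\<^esub> z)"
      if *: "w \<in> carrier T2" "a \<in> carrier A" "z \<in> carrier U" for w a z
    proof -
      have "?\<Psi> w (s a \<otimes>\<^bsub>U\<^esub> z) = sweedler G w (\<lambda>x' x''. \<psi> x' (x'' \<otimes>\<^bsub>U\<^esub> t a) z)"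
        using * bx by (intro T2.sweedler_cong[OF G bz]) (auto simp: balanced_def)
      then show ?thesis using * sweedler_mult_tgt[OF G bz] by simp
    qed
  qed
  let ?F = "\<lambda>v. sweedler G v ?\<Psi>"
  have F: "additive T3 G ?F" by (rule T3.sweedler_additive[OF G Psi])
  have Fp: "?F (pure3 \<H> w z) = ?\<Psi> w z" if "w \<in> carrier T2" "z \<in> carrier U" for w z
    using that by (rule T3.sweedler_pure[OF G Psi])
  have left: "bal2 T3 (\<lambda>x z. pure3 \<H> (D x) z)"
    using p3 comult_additive unfolding balanced_def additive_def
    by (auto simp: comult_mult_tgt Pi_iff)
  have right: "tribalanced T3 (\<lambda>x y z. pure3 \<H> (pure2 \<H> x y) z)"
    unfolding tribalanced_def
  proof (intro conjI ballI)
    fix z assume "z \<in> carrier U"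
    then have "additive T2 T3 (\<lambda>w. pure3 \<H> w z)"
      using p3 by (auto simp: balanced_def additive_def)
    then show "bal2 T3 (\<lambda>x y. pure3 \<H> (pure2 \<H> x y) z)"
      by (rule additive_balanced_comp[OF _ p2])
  next
    fix x assume x: "x \<in> carrier U"
    have "pure3 \<H> (pure2 \<H> x (y \<otimes>\<^bsub>U\<^esub> t a)) z = pure3 \<H> (pure2 \<H> x y) (s a \<otimes>\<^bsub>U\<^esub> z)"
      if "y \<in> carrier U" "a \<in> carrier A" "z \<in> carrier U" for y a z
    proof -
      have "pure2 \<H> x (y \<otimes>\<^bsub>U\<^esub> t a) = pure2 \<H> x y \<otimes>\<^bsub>T2\<^esub> pure2 \<H> \<one>\<^bsub>U\<^esub> (t a)"
        using x that by (simp add: T2.pure_mult)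
      then show ?thesis
        using p3 x that T2.pure_closed unfolding balanced_def by simp
    qed
    then show "bal2 T3 (\<lambda>y z. pure3 \<H> (pure2 \<H> x y) z)"
      using p3 p2 x by (auto simp: balanced_def)
  qed
  have "?F (sweedler T3 (D u) (\<lambda>x y. pure3 \<H> (D x) y)) =
      sweedler G (D u) (\<lambda>x z. ?F (pure3 \<H> (D x) z))"
    using u by (intro T2.additive_sweedler[OF T3 G left F]) simp
  also have "\<dots> = sweedler G (D u) (\<lambda>x z. sweedler G (D x) (\<lambda>x' x''. \<psi> x' x'' z))"
    using u by (intro T2.sweedler_cong[OF G additive_balanced_comp[OF F left]]) (simp_all add: Fp)
  finally have 1: "?F (sweedler T3 (D u) (\<lambda>x y. pure3 \<H> (D x) y)) =
    sweedler G (D u) (\<lambda>x z. sweedler G (D x) (\<lambda>x' x''. \<psi> x' x'' z))" .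
  have rx: "bal2 T3 (\<lambda>y z. pure3 \<H> (pure2 \<H> x y) z)" if "x \<in> carrier U" for x
    using right that by (auto simp: tribalanced_def)
  note right' = balanced_comult_right[OF T3 right]
  have "?F (sweedler T3 (D u) (\<lambda>x y. sweedler T3 (D y) (\<lambda>y' y''. pure3 \<H> (pure2 \<H> x y') y''))) =
      sweedler G (D u) (\<lambda>x z. ?F (sweedler T3 (D z) (\<lambda>y' y''. pure3 \<H> (pure2 \<H> x y') y'')))"
    using u by (intro T2.additive_sweedler[OF T3 G right' F]) simp
  also have "\<dots> = sweedler G (D u) (\<lambda>x z. sweedler G (D z) (\<lambda>z' z''. \<psi> x z' z''))"
  proof (rule T2.sweedler_cong[OF G additive_balanced_comp[OF F right']])
    show "D u \<in> carrier T2" using u by simp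
    fix x z assume xz: "x \<in> carrier U" "z \<in> carrier U"
    have "?F (sweedler T3 (D z) (\<lambda>y' y''. pure3 \<H> (pure2 \<H> x y') y'')) =
        sweedler G (D z) (\<lambda>y' y''. ?F (pure3 \<H> (pure2 \<H> x y') y''))"
      using xz by (intro T2.additive_sweedler[OF T3 G rx F]) auto
    also have "\<dots> = sweedler G (D z) (\<psi> x)"
      using xz by (intro T2.sweedler_cong[OF G additive_balanced_comp[OF F rx]])
        (simp_all add: Fp T2.pure_closed T2.sweedler_pure[OF G bz])
    finally show "?F (sweedler T3 (D z) (\<lambda>y' y''. pure3 \<H> (pure2 \<H> x y') y'')) =
      sweedler G (D z) (\<psi> x)" .
  qed
  finally have 2: "?F (sweedler T3 (D u) (\<lambda>x y. sweedler T3 (D y) (\<lambda>y' y''. pure3 \<H> (pure2 \<H> x y') y''))) =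
      sweedler G (D u) (\<lambda>x z. sweedler G (D z) (\<lambda>z' z''. \<psi> x z' z''))" .
  show ?thesis using 1 2 coassoc[OF u] by simp
qed

end

section \<open>The bijection between the dual and the comodule endomorphisms\<close>

context comm_hopf_algebroid
begin

abbreviation "L \<equiv> ldual \<H>"
abbreviation "E \<equiv> comod_end \<H>"
abbreviation "\<theta> \<equiv> theta \<H>"

lemma mem_ldual:
  "\<alpha> \<in> carrier L \<longleftrightarrow> \<alpha> \<in> extensional (carrier U) \<and> additive U A \<alpha> \<and>
     (\<forall>a\<in>carrier A. \<forall>u\<in>carrier U. \<alpha> (s a \<otimes>\<^bsub>U\<^esub> u) = a \<otimes>\<^bsub>A\<^esub> \<alpha> u)"
  by (auto simp: ldual_def lin_maps_def src_mod_def base_mod_def additive_def)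

lemma mem_comod_end:
  "\<delta> \<in> carrier E \<longleftrightarrow> \<delta> \<in> extensional (carrier U) \<and> additive U U \<delta> \<and>
     (\<forall>a\<in>carrier A. \<forall>u\<in>carrier U. \<delta> (s a \<otimes>\<^bsub>U\<^esub> u) = s a \<otimes>\<^bsub>U\<^esub> \<delta> u) \<and> comodule_map \<H> \<delta>"
  by (auto simp: comod_end_def lin_maps_def src_mod_def additive_def)

lemma ldual_closed [simp]: "\<lbrakk>\<alpha> \<in> carrier L; u \<in> carrier U\<rbrakk> \<Longrightarrow> \<alpha> u \<in> carrier A"
  by (auto simp: mem_ldual additive_def)

lemma ldual_add: "\<lbrakk>\<alpha> \<in> carrier L; u \<in> carrier U; v \<in> carrier U\<rbrakk> \<Longrightarrow> \<alpha> (u \<oplus>\<^bsub>U\<^esub> v) = \<alpha> u \<oplus>\<^bsub>A\<^esub> \<alpha> v"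
  by (auto simp: mem_ldual additive_def)

lemma ldual_src: "\<lbrakk>\<alpha> \<in> carrier L; a \<in> carrier A; u \<in> carrier U\<rbrakk> \<Longrightarrow> \<alpha> (s a \<otimes>\<^bsub>U\<^esub> u) = a \<otimes>\<^bsub>A\<^esub> \<alpha> u"
  by (auto simp: mem_ldual)

lemma comod_end_closed [simp]: "\<lbrakk>\<delta> \<in> carrier E; u \<in> carrier U\<rbrakk> \<Longrightarrow> \<delta> u \<in> carrier U"
  by (auto simp: mem_comod_end additive_def)

lemma comod_end_add:
  "\<lbrakk>\<delta> \<in> carrier E; u \<in> carrier U; v \<in> carrier U\<rbrakk> \<Longrightarrow> \<delta> (u \<oplus>\<^bsub>U\<^esub> v) = \<delta> u \<oplus>\<^bsub>U\<^esub> \<delta> v"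
  by (auto simp: mem_comod_end additive_def)

lemma comod_end_src:
  "\<lbrakk>\<delta> \<in> carrier E; a \<in> carrier A; u \<in> carrier U\<rbrakk> \<Longrightarrow> \<delta> (s a \<otimes>\<^bsub>U\<^esub> u) = s a \<otimes>\<^bsub>U\<^esub> \<delta> u"
  by (auto simp: mem_comod_end)

lemma comod_end_comodule_map: "\<delta> \<in> carrier E \<Longrightarrow> comodule_map \<H> \<delta>"
  by (auto simp: mem_comod_end)

lemma balanced_theta:
  assumes "\<alpha> \<in> carrier L"
  shows "bal2 U (\<lambda>x y. x \<otimes>\<^bsub>U\<^esub> t (\<alpha> y))"
  using assms
  by (intro balancedI)
    (simp_all add: ldual_add ldual_src U.l_distr U.r_distr U.m_assoc)

lemma theta_eq: "u \<in> carrier U \<Longrightarrow> \<theta> \<alpha> u = sweedler U (D u) (\<lambda>x y. x \<otimes>\<^bsub>U\<^esub> t (\<alpha> y))"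
  by (simp add: theta_def)

lemma theta_closed [simp]: "\<lbrakk>\<alpha> \<in> carrier L; u \<in> carrier U\<rbrakk> \<Longrightarrow> \<theta> \<alpha> u \<in> carrier U"
  unfolding theta_eq by (intro T2.sweedler_closed[OF U.abelian_group_axioms balanced_theta]) auto

lemma theta_additive: "\<alpha> \<in> carrier L \<Longrightarrow> additive U U (\<theta> \<alpha>)"
  using comult_additive T2.sweedler_add[OF U.abelian_group_axioms balanced_theta]
  unfolding additive_def by (auto simp: theta_eq[symmetric]) (simp add: theta_eq)

lemma theta_src:
  assumes "\<alpha> \<in> carrier L" "a \<in> carrier A" "u \<in> carrier U"
  shows "\<theta> \<alpha> (s a \<otimes>\<^bsub>U\<^esub> u) = s a \<otimes>\<^bsub>U\<^esub> \<theta> \<alpha> u"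
proof -
  note UA = U.abelian_group_axioms and b = balanced_theta[OF assms(1)]
  have "\<theta> \<alpha> (s a \<otimes>\<^bsub>U\<^esub> u) = sweedler U (D u) (\<lambda>x y. s a \<otimes>\<^bsub>U\<^esub> x \<otimes>\<^bsub>U\<^esub> t (\<alpha> y))"
    using assms sweedler_comult_src[OF UA b] by (simp add: theta_eq)
  also have "\<dots> = sweedler U (D u) (\<lambda>x y. s a \<otimes>\<^bsub>U\<^esub> (x \<otimes>\<^bsub>U\<^esub> t (\<alpha> y)))"
    using assms
    by (intro T2.sweedler_cong[OF UA
          T2.balanced_cong[OF T2.balanced_translate[OF b, of "s a" "\<one>\<^bsub>U\<^esub>"]]])
      (auto simp: U.m_assoc)
  also have "\<dots> = s a \<otimes>\<^bsub>U\<^esub> \<theta> \<alpha> u"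
    unfolding theta_eq[OF assms(3)]
    using assms by (intro T2.additive_sweedler[OF UA UA b, symmetric]) (auto simp: additive_def U.r_distr)
  finally show ?thesis .
qed

text \<open>
  This is coassociativity for \<open>\<psi>(x, y, z) = x \<otimes> y t(\<alpha>(z))\<close>: its left side is \<open>\<Delta>(\<theta>(\<alpha>)(u))\<close> because
  \<open>\<Delta>(x t(b)) = x\<^sub>1 \<otimes> x\<^sub>2 t(b)\<close>, and its right side is \<open>u\<^sub>1 \<otimes> \<theta>(\<alpha>)(u\<^sub>2)\<close>.
\<close>

lemma theta_comodule_map:
  assumes al: "\<alpha> \<in> carrier L"
  shows "comodule_map \<H> (\<theta> \<alpha>)"
  unfolding comodule_map_def
proof
  fix u assume u: "u \<in> carrier U"
  note UA = U.abelian_group_axioms and TA = T2.abelian_group_tensor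
  note b = balanced_theta[OF al] and p2 = T2.pure_balanced
  let ?\<psi> = "\<lambda>x y z. pure2 \<H> x (y \<otimes>\<^bsub>U\<^esub> t (\<alpha> z))"
  have tri: "tribalanced T2 ?\<psi>"
    unfolding tribalanced_def
  proof (intro conjI ballI)
    show "bal2 T2 (\<lambda>x y. ?\<psi> x y z)" if "z \<in> carrier U" for z
      using al that
      by (intro T2.balanced_cong[OF T2.balanced_translate[OF p2, of "\<one>\<^bsub>U\<^esub>" "t (\<alpha> z)"]])
        (auto simp: U.m_comm)
    show "bal2 T2 (?\<psi> x)" if "x \<in> carrier U" for x
      using that p2 by (intro additive_balanced_comp[OF _ b]) (auto simp: additive_def balanced_def)
  qed
  have "D (\<theta> \<alpha> u) = sweedler T2 (D u) (\<lambda>x y. D (x \<otimes>\<^bsub>U\<^esub> t (\<alpha> y)))"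
    unfolding theta_eq[OF u] using u
    by (intro T2.additive_sweedler[OF UA TA b comult_additive]) simp
  also have "\<dots> = sweedler T2 (D u) (\<lambda>x z. sweedler T2 (D x) (\<lambda>x' x''. ?\<psi> x' x'' z))"
  proof (rule T2.sweedler_cong[OF TA additive_balanced_comp[OF comult_additive b]])
    show "D u \<in> carrier T2" using u by simp
    fix x z assume xz: "x \<in> carrier U" "z \<in> carrier U"
    have "D (x \<otimes>\<^bsub>U\<^esub> t (\<alpha> z)) = sweedler T2 (D (x \<otimes>\<^bsub>U\<^esub> t (\<alpha> z))) (pure2 \<H>)"
      using xz al by (simp add: T2.sweedler_pure_id)
    also have "\<dots> = sweedler T2 (D x) (\<lambda>x' x''. ?\<psi> x' x'' z)"
      using xz al by (intro sweedler_comult_tgt[OF TA p2]) auto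
    finally show "D (x \<otimes>\<^bsub>U\<^esub> t (\<alpha> z)) = sweedler T2 (D x) (\<lambda>x' x''. ?\<psi> x' x'' z)" .
  qed
  also have "\<dots> = sweedler T2 (D u) (\<lambda>x z. sweedler T2 (D z) (?\<psi> x))"
    by (rule sweedler_coassoc[OF TA tri u])
  also have "\<dots> = sweedler T2 (D u) (\<lambda>x z. pure2 \<H> x (\<theta> \<alpha> z))"
  proof (rule T2.sweedler_cong[OF TA balanced_comult_right[OF TA tri]])
    show "D u \<in> carrier T2" using u by simp
    fix x z assume xz: "x \<in> carrier U" "z \<in> carrier U"
    have "additive U T2 (pure2 \<H> x)"
      using p2 xz by (auto simp: balanced_def additive_def)
    then show "sweedler T2 (D z) (?\<psi> x) = pure2 \<H> x (\<theta> \<alpha> z)"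
      unfolding theta_eq[OF xz(2)] using xz
      by (intro T2.additive_sweedler[OF UA TA b, symmetric]) auto
  qed
  finally show "D (\<theta> \<alpha> u) = sweedler T2 (D u) (\<lambda>x y. pure2 \<H> x (\<theta> \<alpha> y))" .
qed

lemma theta_in_comod_end [simp]: "\<alpha> \<in> carrier L \<Longrightarrow> \<theta> \<alpha> \<in> carrier E"
  by (auto simp: mem_comod_end theta_additive theta_src theta_comodule_map) (simp add: theta_def)

text \<open>
  Multiplicativity of \<open>\<epsilon>\<close> and left linearity of \<open>\<alpha>\<close> give
  \<open>\<epsilon>(u\<^sub>1 t(\<alpha>(u\<^sub>2))) = \<epsilon>(u\<^sub>1) \<alpha>(u\<^sub>2) = \<alpha>(s(\<epsilon>(u\<^sub>1)) u\<^sub>2)\<close>, and the left counit law applies.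
\<close>

lemma counit_theta:
  assumes al: "\<alpha> \<in> carrier L" and u: "u \<in> carrier U"
  shows "e (\<theta> \<alpha> u) = \<alpha> u"
proof -
  note UA = U.abelian_group_axioms and AA = A.abelian_group_axioms
  have ea: "additive U A e" by (auto simp: additive_def)
  have bl: "bal2 U (\<lambda>x y. s (e x) \<otimes>\<^bsub>U\<^esub> y)"
    by (intro balancedI) (simp_all add: U.l_distr U.r_distr U.m_assoc)
  have aa: "additive U A \<alpha>" using al by (simp add: mem_ldual)
  have "e (\<theta> \<alpha> u) = sweedler A (D u) (\<lambda>x y. e (x \<otimes>\<^bsub>U\<^esub> t (\<alpha> y)))"
    unfolding theta_eq[OF u] using u
    by (intro T2.additive_sweedler[OF UA AA balanced_theta[OF al] ea]) simp
  also have "\<dots> = sweedler A (D u) (\<lambda>x y. \<alpha> (s (e x) \<otimes>\<^bsub>U\<^esub> y))"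
    using u al by (intro T2.sweedler_cong[OF AA additive_balanced_comp[OF ea balanced_theta[OF al]]])
      (simp_all add: ldual_src)
  also have "\<dots> = \<alpha> (sweedler U (D u) (\<lambda>x y. s (e x) \<otimes>\<^bsub>U\<^esub> y))"
    using u by (intro T2.additive_sweedler[OF UA AA bl aa, symmetric]) simp
  finally show ?thesis using counit_left[OF u] by simp
qed

text \<open>
  The defining property of a comodule map, evaluated against an arbitrary balanced map.
\<close>

lemma sweedler_comult_comodule_map:
  assumes G: "abelian_group G" and b: "bal2 G \<phi>" and de: "\<delta> \<in> carrier E" and u: "u \<in> carrier U"
  shows "bal2 G (\<lambda>x y. \<phi> x (\<delta> y))"
    and "sweedler G (D (\<delta> u)) \<phi> = sweedler G (D u) (\<lambda>x y. \<phi> x (\<delta> y))"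
proof -
  show b': "bal2 G (\<lambda>x y. \<phi> x (\<delta> y))"
    using b de by (auto simp: balanced_def comod_end_add comod_end_src)
  have pb: "bal2 T2 (\<lambda>x y. pure2 \<H> x (\<delta> y))"
    using T2.pure_balanced de by (auto simp: balanced_def comod_end_add comod_end_src)
  have "sweedler G (D (\<delta> u)) \<phi> = sweedler G (sweedler T2 (D u) (\<lambda>x y. pure2 \<H> x (\<delta> y))) \<phi>"
    using comod_end_comodule_map[OF de] u by (simp add: comodule_map_def)
  also have "\<dots> = sweedler G (D u) (\<lambda>x y. sweedler G (pure2 \<H> x (\<delta> y)) \<phi>)"
    using u by (intro T2.additive_sweedler[OF T2.abelian_group_tensor G pb T2.sweedler_additive[OF G b]]) simp
  also have "\<dots> = sweedler G (D u) (\<lambda>x y. \<phi> x (\<delta> y))"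
    using u de by (intro T2.sweedler_cong[OF G
          additive_balanced_comp[OF T2.sweedler_additive[OF G b] pb]])
      (simp_all add: T2.sweedler_pure[OF G b])
  finally show "sweedler G (D (\<delta> u)) \<phi> = sweedler G (D u) (\<lambda>x y. \<phi> x (\<delta> y))" .
qed

lemma counit_comp_comod_end:
  "\<delta> \<in> carrier E \<Longrightarrow> compose (carrier U) e \<delta> \<in> carrier L"
  by (auto simp: mem_ldual additive_def compose_def comod_end_add comod_end_src)

text \<open>
  The right counit law for \<open>\<delta>(u)\<close>, with \<open>\<Delta>(\<delta>(u))\<close> replaced by \<open>u\<^sub>1 \<otimes> \<delta>(u\<^sub>2)\<close>.
\<close>

lemma theta_counit_comp:
  assumes "\<delta> \<in> carrier E"
  shows "\<theta> (compose (carrier U) e \<delta>) = \<delta>"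
proof (rule extensionalityI)
  show "\<theta> (compose (carrier U) e \<delta>) \<in> extensional (carrier U)" by (simp add: theta_def)
  show "\<delta> \<in> extensional (carrier U)" using assms by (simp add: mem_comod_end)
  fix u assume u: "u \<in> carrier U"
  have b: "bal2 U (\<lambda>x y. x \<otimes>\<^bsub>U\<^esub> t (e y))"
    by (intro balancedI) (simp_all add: U.l_distr U.r_distr U.m_assoc)
  have "\<theta> (compose (carrier U) e \<delta>) u = sweedler U (D u) (\<lambda>x y. x \<otimes>\<^bsub>U\<^esub> t (e (\<delta> y)))"
    unfolding theta_eq[OF u]
    using u by (intro T2.sweedler_cong[OF U.abelian_group_axioms
          balanced_theta[OF counit_comp_comod_end[OF assms]]]) (simp_all add: compose_def)
  also have "\<dots> = sweedler U (D (\<delta> u)) (\<lambda>x y. x \<otimes>\<^bsub>U\<^esub> t (e y))"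
    using sweedler_comult_comodule_map(2)[OF U.abelian_group_axioms b assms u] by simp
  also have "\<dots> = \<delta> u" using counit_right[of "\<delta> u"] u assms by simp
  finally show "\<theta> (compose (carrier U) e \<delta>) u = \<delta> u" .
qed

lemma counit_comp_theta:
  assumes "\<alpha> \<in> carrier L"
  shows "compose (carrier U) e (\<theta> \<alpha>) = \<alpha>"
  by (rule extensionalityI[of _ "carrier U"])
    (use assms in \<open>auto simp: compose_def counit_theta mem_ldual\<close>)

lemma theta_bij: "bij_betw \<theta> (carrier L) (carrier E)"
  by (rule bij_betw_byWitness[where f' = "compose (carrier U) e"])
    (auto simp: counit_comp_theta theta_counit_comp counit_comp_comod_end)

lemma comod_end_compose:
  assumes "\<delta> \<in> carrier E" "\<delta>' \<in> carrier E"
  shows "compose (carrier U) \<delta> \<delta>' \<in> carrier E"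
  unfolding mem_comod_end
proof (intro conjI)
  show "comodule_map \<H> (compose (carrier U) \<delta> \<delta>')"
    unfolding comodule_map_def
  proof
    fix u assume u: "u \<in> carrier U"
    note TA = T2.abelian_group_tensor
    have pb: "bal2 T2 (\<lambda>x y. pure2 \<H> x (\<delta> y))"
      using T2.pure_balanced assms by (auto simp: balanced_def comod_end_add comod_end_src)
    have "D (\<delta> (\<delta>' u)) = sweedler T2 (D (\<delta>' u)) (\<lambda>x y. pure2 \<H> x (\<delta> y))"
      using comod_end_comodule_map[OF assms(1)] assms u by (simp add: comodule_map_def)
    also have "\<dots> = sweedler T2 (D u) (\<lambda>x y. pure2 \<H> x (\<delta> (\<delta>' y)))"
      by (rule sweedler_comult_comodule_map(2)[OF TA pb assms(2) u])
    also have "\<dots> = sweedler T2 (D u) (\<lambda>x y. pure2 \<H> x (compose (carrier U) \<delta> \<delta>' y))"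
      using u by (intro T2.sweedler_cong[OF TA sweedler_comult_comodule_map(1)[OF TA pb assms(2) u]])
        (simp_all add: compose_def)
    finally show "D (compose (carrier U) \<delta> \<delta>' u) = \<dots>" using u by (simp add: compose_def)
  qed
qed (use assms in \<open>auto simp: additive_def compose_def comod_end_add comod_end_src\<close>)

lemma ldual_mult_eq: "\<alpha> \<otimes>\<^bsub>L\<^esub> \<beta> = (\<lambda>u\<in>carrier U. \<alpha> (\<theta> \<beta> u))"
  by (auto simp: ldual_def theta_def)

text \<open>
  The composite \<open>\<theta>(\<alpha>) \<circ> \<theta>(\<beta>)\<close> is a comodule endomorphism, hence equal to \<open>\<theta>\<close> of its composite with
  \<open>\<epsilon>\<close>; and that composite is \<open>\<alpha> * \<beta>\<close>.
\<close>

lemma theta_mult: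
  assumes "\<alpha> \<in> carrier L" "\<beta> \<in> carrier L"
  shows "\<alpha> \<otimes>\<^bsub>L\<^esub> \<beta> \<in> carrier L" and "\<theta> (\<alpha> \<otimes>\<^bsub>L\<^esub> \<beta>) = compose (carrier U) (\<theta> \<alpha>) (\<theta> \<beta>)"
proof -
  let ?c = "compose (carrier U) (\<theta> \<alpha>) (\<theta> \<beta>)"
  have c: "?c \<in> carrier E" using assms by (simp add: comod_end_compose)
  have "compose (carrier U) e ?c = \<alpha> \<otimes>\<^bsub>L\<^esub> \<beta>"
    using assms by (auto simp: ldual_mult_eq compose_def counit_theta)
  then show "\<alpha> \<otimes>\<^bsub>L\<^esub> \<beta> \<in> carrier L" and "\<theta> (\<alpha> \<otimes>\<^bsub>L\<^esub> \<beta>) = ?c"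
    using counit_comp_comod_end[OF c] theta_counit_comp[OF c] by simp_all
qed

lemma theta_add:
  assumes "\<alpha> \<in> carrier L" "\<beta> \<in> carrier L"
  shows "\<theta> (\<alpha> \<oplus>\<^bsub>L\<^esub> \<beta>) = \<theta> \<alpha> \<oplus>\<^bsub>E\<^esub> \<theta> \<beta>"
proof -
  have "\<theta> (\<lambda>u\<in>carrier U. \<alpha> u \<oplus>\<^bsub>A\<^esub> \<beta> u) u = \<theta> \<alpha> u \<oplus>\<^bsub>U\<^esub> \<theta> \<beta> u" if u: "u \<in> carrier U" for u
  proof -
    note UA = U.abelian_group_axioms and b = assms[THEN balanced_theta]
    have "\<theta> \<alpha> u \<oplus>\<^bsub>U\<^esub> \<theta> \<beta> u =
        sweedler U (D u) (\<lambda>x y. x \<otimes>\<^bsub>U\<^esub> t (\<alpha> y) \<oplus>\<^bsub>U\<^esub> x \<otimes>\<^bsub>U\<^esub> t (\<beta> y))"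
      using u T2.sweedler_add_fun[OF UA b] by (simp add: theta_eq)
    also have "\<dots> = \<theta> (\<lambda>u\<in>carrier U. \<alpha> u \<oplus>\<^bsub>A\<^esub> \<beta> u) u"
      unfolding theta_eq[OF u] using u assms b
      by (intro T2.sweedler_cong[OF UA]) (auto simp: balanced_def U.r_distr U.a_ac)
    finally show ?thesis by simp
  qed
  then show ?thesis
    by (intro extensionalityI[of _ "carrier U"]) (auto simp: ldual_def comod_end_def theta_def)
qed

lemma theta_smult:
  assumes "\<alpha> \<in> carrier L" "a \<in> carrier A"
  shows "\<theta> (a \<odot>\<^bsub>L\<^esub> \<alpha>) = a \<odot>\<^bsub>E\<^esub> \<theta> \<alpha>"
proof -
  have "\<theta> (\<lambda>u\<in>carrier U. a \<otimes>\<^bsub>A\<^esub> \<alpha> u) u = \<theta> \<alpha> u \<otimes>\<^bsub>U\<^esub> t a" if u: "u \<in> carrier U" for u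
  proof -
    note UA = U.abelian_group_axioms and b = balanced_theta[OF assms(1)]
    have add: "additive U U (\<lambda>v. v \<otimes>\<^bsub>U\<^esub> t a)" using assms by (auto simp: additive_def U.l_distr)
    have "\<theta> \<alpha> u \<otimes>\<^bsub>U\<^esub> t a = sweedler U (D u) (\<lambda>x y. x \<otimes>\<^bsub>U\<^esub> t (\<alpha> y) \<otimes>\<^bsub>U\<^esub> t a)"
      unfolding theta_eq[OF u] using u by (intro T2.additive_sweedler[OF UA UA b add]) simp
    also have "\<dots> = \<theta> (\<lambda>u\<in>carrier U. a \<otimes>\<^bsub>A\<^esub> \<alpha> u) u"
      unfolding theta_eq[OF u] using u assms
      by (intro T2.sweedler_cong[OF UA additive_balanced_comp[OF add b]]) (auto simp: U.m_ac)
    finally show ?thesis by simp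
  qed
  then show ?thesis
    by (intro extensionalityI[of _ "carrier U"]) (auto simp: ldual_def comod_end_def theta_def)
qed

end

section \<open>Module, ring and Lie structures\<close>

context comm_hopf_algebroid
begin

abbreviation "tgt_mod \<equiv> (src_mod \<H>)\<lparr>smult := \<lambda>a u. u \<otimes>\<^bsub>U\<^esub> t a\<rparr>"

lemma base_module: "module A (base_mod \<H>)"
  by (rule moduleI; (rule abelian_groupI)?)
    (auto simp: base_mod_def A.a_ac A.m_ac A.l_distr A.r_distr A.is_cring intro: A.add.l_inv_ex)

lemma tgt_module: "module A tgt_mod"
  by (rule moduleI; (rule abelian_groupI)?)
    (auto simp: src_mod_def U.a_ac U.m_ac U.l_distr U.r_distr A.is_cring intro: U.add.l_inv_ex)

lemma ldual_subset: "carrier L \<subseteq> carrier U \<rightarrow>\<^sub>E carrier (base_mod \<H>)"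
  by (auto simp: mem_ldual base_mod_def additive_def PiE_def)

lemma comod_end_subset: "carrier E \<subseteq> carrier U \<rightarrow>\<^sub>E carrier tgt_mod"
  by (auto simp: mem_comod_end src_mod_def additive_def PiE_def)

lemma ldual_module: "module A L"
proof (rule pointwise_module[OF base_module ldual_subset])
  show "\<zero>\<^bsub>L\<^esub> \<in> carrier L"
    by (simp add: mem_ldual additive_def) (simp add: ldual_def)
  show "\<alpha> \<oplus>\<^bsub>L\<^esub> \<beta> \<in> carrier L" if "\<alpha> \<in> carrier L" "\<beta> \<in> carrier L" for \<alpha> \<beta>
  proof -
    have "(\<lambda>u\<in>carrier U. \<alpha> u \<oplus>\<^bsub>A\<^esub> \<beta> u) \<in> carrier L"
      using that by (auto simp: mem_ldual[of "restrict _ _"] additive_def ldual_add ldual_src A.r_distr A.a_ac)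
    then show ?thesis by (simp add: ldual_def)
  qed
  show "a \<odot>\<^bsub>L\<^esub> \<alpha> \<in> carrier L" if "a \<in> carrier A" "\<alpha> \<in> carrier L" for a \<alpha>
  proof -
    have "(\<lambda>u\<in>carrier U. a \<otimes>\<^bsub>A\<^esub> \<alpha> u) \<in> carrier L"
      using that by (auto simp: mem_ldual[of "restrict _ _"] additive_def ldual_add ldual_src A.r_distr A.m_ac)
    then show ?thesis by (simp add: ldual_def)
  qed
qed (simp_all add: ldual_def base_mod_def)

sublocale L: module A L by (rule ldual_module)

text \<open>
  Closure under the operations is inherited from the dual: every comodule endomorphism is some
  \<open>\<theta>(\<alpha>)\<close>, and \<open>\<theta>\<close> respects addition and scalar multiplication.
\<close>

lemma comod_end_module: "module A E"
proof (rule pointwise_module[OF tgt_module comod_end_subset])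
  have rep: "\<exists>\<alpha>\<in>carrier L. \<delta> = \<theta> \<alpha>" if "\<delta> \<in> carrier E" for \<delta>
    using that theta_counit_comp counit_comp_comod_end by metis
  have z: "\<theta> \<zero>\<^bsub>L\<^esub> = \<zero>\<^bsub>E\<^esub>"
  proof -
    have "\<theta> \<zero>\<^bsub>L\<^esub> = \<zero>\<^bsub>A\<^esub> \<odot>\<^bsub>E\<^esub> \<theta> \<zero>\<^bsub>L\<^esub>"
      using theta_smult[of "\<zero>\<^bsub>L\<^esub>" "\<zero>\<^bsub>A\<^esub>"] by simp
    also have "\<dots> = (\<lambda>u\<in>carrier U. \<theta> \<zero>\<^bsub>L\<^esub> u \<otimes>\<^bsub>U\<^esub> t \<zero>\<^bsub>A\<^esub>)"
      by (simp add: comod_end_def)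
    also have "\<dots> = (\<lambda>u\<in>carrier U. \<zero>\<^bsub>U\<^esub>)"
      by (rule restrict_ext) simp
    finally show ?thesis by (simp add: comod_end_def)
  qed
  show "\<zero>\<^bsub>E\<^esub> \<in> carrier E" unfolding z[symmetric] by simp
  show "\<delta> \<oplus>\<^bsub>E\<^esub> \<delta>' \<in> carrier E" if "\<delta> \<in> carrier E" "\<delta>' \<in> carrier E" for \<delta> \<delta>'
    using that[THEN rep] by (auto simp: theta_add[symmetric])
  show "a \<odot>\<^bsub>E\<^esub> \<delta> \<in> carrier E" if "a \<in> carrier A" "\<delta> \<in> carrier E" for a \<delta>
    using that(1) rep[OF that(2)] by (auto simp: theta_smult[symmetric])
qed (simp_all add: comod_end_def src_mod_def)

sublocale E: module A E by (rule comod_end_module)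

lemma ldual_minus:
  "\<lbrakk>\<alpha> \<in> carrier L; \<beta> \<in> carrier L; u \<in> carrier U\<rbrakk> \<Longrightarrow> (\<alpha> \<ominus>\<^bsub>L\<^esub> \<beta>) u = \<alpha> u \<ominus>\<^bsub>A\<^esub> \<beta> u"
proof (rule pointwise_minus[OF L.M.abelian_group_axioms A.abelian_group_axioms, of "carrier U"])
  show "carrier L \<subseteq> carrier U \<rightarrow>\<^sub>E carrier A" by (auto simp: mem_ldual additive_def PiE_def)
qed (simp_all add: ldual_def)

lemma comod_end_minus:
  "\<lbrakk>\<delta> \<in> carrier E; \<delta>' \<in> carrier E; u \<in> carrier U\<rbrakk> \<Longrightarrow> (\<delta> \<ominus>\<^bsub>E\<^esub> \<delta>') u = \<delta> u \<ominus>\<^bsub>U\<^esub> \<delta>' u"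
proof (rule pointwise_minus[OF E.M.abelian_group_axioms U.abelian_group_axioms, of "carrier U"])
  show "carrier E \<subseteq> carrier U \<rightarrow>\<^sub>E carrier U" by (auto simp: mem_comod_end additive_def PiE_def)
qed (simp_all add: comod_end_def)

end

context comm_hopf_algebroid
begin

lemma ldual_one: "\<one>\<^bsub>L\<^esub> \<in> carrier L" and theta_one: "\<theta> \<one>\<^bsub>L\<^esub> = \<one>\<^bsub>E\<^esub>"
proof -
  have "(\<lambda>u\<in>carrier U. e u) \<in> carrier L"
    by (auto simp: mem_ldual[of "restrict _ _"] additive_def)
  then show "\<one>\<^bsub>L\<^esub> \<in> carrier L" by (simp add: ldual_def)
  then have b: "bal2 U (\<lambda>x y. x \<otimes>\<^bsub>U\<^esub> t (\<one>\<^bsub>L\<^esub> y))" by (rule balanced_theta)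
  have "\<theta> \<one>\<^bsub>L\<^esub> u = u" if u: "u \<in> carrier U" for u
  proof -
    have "\<theta> \<one>\<^bsub>L\<^esub> u = sweedler U (D u) (\<lambda>x y. x \<otimes>\<^bsub>U\<^esub> t (e y))"
      unfolding theta_eq[OF u] using u
      by (intro T2.sweedler_cong[OF U.abelian_group_axioms b]) (auto simp: ldual_def)
    then show ?thesis using counit_right[OF u] by simp
  qed
  then show "\<theta> \<one>\<^bsub>L\<^esub> = \<one>\<^bsub>E\<^esub>"
    by (intro extensionalityI[of _ "carrier U"]) (auto simp: comod_end_def theta_def)
qed

lemma ldual_ext: "\<lbrakk>\<alpha> \<in> carrier L; \<beta> \<in> carrier L; \<And>u. u \<in> carrier U \<Longrightarrow> \<alpha> u = \<beta> u\<rbrakk> \<Longrightarrow> \<alpha> = \<beta>"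
  by (rule extensionalityI[of _ "carrier U"]) (auto simp: mem_ldual)

lemma ldual_mult_apply: "u \<in> carrier U \<Longrightarrow> (\<alpha> \<otimes>\<^bsub>L\<^esub> \<beta>) u = \<alpha> (\<theta> \<beta> u)"
  by (simp add: ldual_mult_eq)

lemma ldual_add_apply: "u \<in> carrier U \<Longrightarrow> (\<alpha> \<oplus>\<^bsub>L\<^esub> \<beta>) u = \<alpha> u \<oplus>\<^bsub>A\<^esub> \<beta> u"
  by (simp add: ldual_def)

lemma ldual_smult_apply: "u \<in> carrier U \<Longrightarrow> (a \<odot>\<^bsub>L\<^esub> \<alpha>) u = a \<otimes>\<^bsub>A\<^esub> \<alpha> u"
  by (simp add: ldual_def)

lemma comod_end_add_apply: "u \<in> carrier U \<Longrightarrow> (\<delta> \<oplus>\<^bsub>E\<^esub> \<delta>') u = \<delta> u \<oplus>\<^bsub>U\<^esub> \<delta>' u"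
  by (simp add: comod_end_def)

lemma comod_end_smult_apply: "u \<in> carrier U \<Longrightarrow> (a \<odot>\<^bsub>E\<^esub> \<delta>) u = \<delta> u \<otimes>\<^bsub>U\<^esub> t a"
  by (simp add: comod_end_def)

lemma theta_comp_apply:
  "\<lbrakk>\<alpha> \<in> carrier L; \<beta> \<in> carrier L; u \<in> carrier U\<rbrakk> \<Longrightarrow> \<theta> (\<alpha> \<otimes>\<^bsub>L\<^esub> \<beta>) u = \<theta> \<alpha> (\<theta> \<beta> u)"
  by (simp add: theta_mult compose_def)

text \<open>
  Since \<open>(\<alpha> * \<beta>)(u) = \<alpha>(\<theta>(\<beta>)(u))\<close> and \<open>\<theta>(\<beta> * \<gamma>) = \<theta>(\<beta>) \<circ> \<theta>(\<gamma>)\<close>, the axioms reduce to those for composition.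
\<close>

lemma ldual_ring: "ring L"
proof (rule ringI)
  show "abelian_group L" by (rule L.M.abelian_group_axioms)
  show "Group.monoid L"
  proof (rule monoidI)
    show "\<alpha> \<otimes>\<^bsub>L\<^esub> \<beta> \<otimes>\<^bsub>L\<^esub> \<gamma> = \<alpha> \<otimes>\<^bsub>L\<^esub> (\<beta> \<otimes>\<^bsub>L\<^esub> \<gamma>)"
      if "\<alpha> \<in> carrier L" "\<beta> \<in> carrier L" "\<gamma> \<in> carrier L" for \<alpha> \<beta> \<gamma>
      using that by (intro ldual_ext) (simp_all add: theta_mult(1) ldual_mult_apply theta_comp_apply)
    show "\<one>\<^bsub>L\<^esub> \<otimes>\<^bsub>L\<^esub> \<alpha> = \<alpha>" if "\<alpha> \<in> carrier L" for \<alpha>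
    proof (rule ldual_ext)
      show "(\<one>\<^bsub>L\<^esub> \<otimes>\<^bsub>L\<^esub> \<alpha>) u = \<alpha> u" if u: "u \<in> carrier U" for u
      proof -
        have "\<one>\<^bsub>L\<^esub> (\<theta> \<alpha> u) = e (\<theta> \<alpha> u)"
          using u \<open>\<alpha> \<in> carrier L\<close> theta_closed[OF \<open>\<alpha> \<in> carrier L\<close> u] by (simp add: ldual_def)
        then show ?thesis using u \<open>\<alpha> \<in> carrier L\<close> by (simp add: ldual_mult_apply counit_theta)
      qed
    qed (use that ldual_one in \<open>simp_all add: theta_mult\<close>)
    show "\<alpha> \<otimes>\<^bsub>L\<^esub> \<one>\<^bsub>L\<^esub> = \<alpha>" if "\<alpha> \<in> carrier L" for \<alpha>
      using that ldual_one
      by (intro ldual_ext) (simp_all add: theta_mult(1) ldual_mult_apply theta_one, simp add: comod_end_def)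
  qed (simp_all add: ldual_one theta_mult)
  show "(\<alpha> \<oplus>\<^bsub>L\<^esub> \<beta>) \<otimes>\<^bsub>L\<^esub> \<gamma> = \<alpha> \<otimes>\<^bsub>L\<^esub> \<gamma> \<oplus>\<^bsub>L\<^esub> \<beta> \<otimes>\<^bsub>L\<^esub> \<gamma>"
    if "\<alpha> \<in> carrier L" "\<beta> \<in> carrier L" "\<gamma> \<in> carrier L" for \<alpha> \<beta> \<gamma>
    using that by (intro ldual_ext) (simp_all add: theta_mult(1) ldual_mult_apply ldual_add_apply)
  show "\<gamma> \<otimes>\<^bsub>L\<^esub> (\<alpha> \<oplus>\<^bsub>L\<^esub> \<beta>) = \<gamma> \<otimes>\<^bsub>L\<^esub> \<alpha> \<oplus>\<^bsub>L\<^esub> \<gamma> \<otimes>\<^bsub>L\<^esub> \<beta>"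
    if "\<alpha> \<in> carrier L" "\<beta> \<in> carrier L" "\<gamma> \<in> carrier L" for \<alpha> \<beta> \<gamma>
    using that by (intro ldual_ext)
      (simp_all add: theta_mult(1) ldual_mult_apply ldual_add_apply theta_add comod_end_add_apply ldual_add)
qed

lemma comod_end_ext: "\<lbrakk>\<delta> \<in> carrier E; \<delta>' \<in> carrier E; \<And>u. u \<in> carrier U \<Longrightarrow> \<delta> u = \<delta>' u\<rbrakk> \<Longrightarrow> \<delta> = \<delta>'"
  by (rule extensionalityI[of _ "carrier U"]) (auto simp: mem_comod_end)

lemma comod_end_mult_closed: "\<lbrakk>\<delta> \<in> carrier E; \<delta>' \<in> carrier E\<rbrakk> \<Longrightarrow> \<delta> \<otimes>\<^bsub>E\<^esub> \<delta>' \<in> carrier E"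
  using comod_end_compose[of \<delta> \<delta>'] by (simp add: comod_end_def)

lemma comod_end_mult_apply: "u \<in> carrier U \<Longrightarrow> (\<delta> \<otimes>\<^bsub>E\<^esub> \<delta>') u = \<delta> (\<delta>' u)"
  by (simp add: comod_end_def compose_def)

lemma comod_end_one: "\<one>\<^bsub>E\<^esub> \<in> carrier E"
  using theta_in_comod_end[OF ldual_one] by (simp add: theta_one)

lemma comod_end_one_apply: "u \<in> carrier U \<Longrightarrow> \<one>\<^bsub>E\<^esub> u = u"
  by (simp add: comod_end_def)

lemma comod_end_ring: "ring E"
proof (rule ringI)
  show "abelian_group E" by (rule E.M.abelian_group_axioms)
  show "Group.monoid E"
    by (rule monoidI)
      (auto intro!: comod_end_ext comod_end_mult_closed comod_end_one
        simp: comod_end_mult_apply comod_end_one_apply)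
qed (auto intro!: comod_end_ext comod_end_mult_closed E.M.a_closed
    simp: comod_end_mult_apply comod_end_add_apply comod_end_add)

lemma theta_ring_iso: "\<theta> \<in> ring_iso L E"
proof (rule ring_iso_memI)
  show "\<theta> (\<alpha> \<otimes>\<^bsub>L\<^esub> \<beta>) = \<theta> \<alpha> \<otimes>\<^bsub>E\<^esub> \<theta> \<beta>" if "\<alpha> \<in> carrier L" "\<beta> \<in> carrier L" for \<alpha> \<beta>
    using theta_mult(2)[OF that] by (simp add: comod_end_def)
qed (simp_all add: theta_add theta_one theta_bij)

lemma ldual_unit_closed: "a \<in> carrier A \<Longrightarrow> ldual_unit \<H> a \<in> carrier L"
  by (auto simp: ldual_unit_def mem_ldual[of "restrict _ _"] additive_def A.l_distr A.m_assoc)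

lemma theta_ldual_unit:
  assumes a: "a \<in> carrier A"
  shows "\<theta> (ldual_unit \<H> a) = comod_end_unit \<H> a"
proof -
  have "ldual_unit \<H> a = a \<odot>\<^bsub>L\<^esub> \<one>\<^bsub>L\<^esub>"
    using a ldual_one ldual_unit_closed[OF a]
    by (intro ldual_ext) (auto simp: ldual_smult_apply, auto simp: ldual_def ldual_unit_def A.m_comm)
  then show ?thesis
    using a ldual_one by (simp add: theta_smult theta_one) (auto simp: comod_end_def comod_end_unit_def intro: restrict_ext)
qed

lemma ldual_unit_hom: "ldual_unit \<H> \<in> ring_hom A L"
proof (rule ring_hom_memI)
  fix a b assume ab: "a \<in> carrier A" "b \<in> carrier A"
  show "ldual_unit \<H> (a \<otimes>\<^bsub>A\<^esub> b) = ldual_unit \<H> a \<otimes>\<^bsub>L\<^esub> ldual_unit \<H> b"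
    using ab by (intro ldual_ext)
      (simp_all add: ldual_unit_closed theta_mult ldual_mult_apply theta_ldual_unit,
       simp add: ldual_unit_def comod_end_unit_def A.m_ac)
  show "ldual_unit \<H> (a \<oplus>\<^bsub>A\<^esub> b) = ldual_unit \<H> a \<oplus>\<^bsub>L\<^esub> ldual_unit \<H> b"
    using ab by (intro ldual_ext)
      (simp_all add: ldual_unit_closed ldual_add_apply, simp add: ldual_unit_def A.r_distr)
next
  show "ldual_unit \<H> \<one>\<^bsub>A\<^esub> = \<one>\<^bsub>L\<^esub>"
    by (intro ldual_ext) (simp_all add: ldual_unit_closed ldual_one, simp add: ldual_unit_def ldual_def)
qed (rule ldual_unit_closed)

text \<open>
  The structure map of the comodule endomorphisms is \<open>\<theta>\<close> composed with that of the dual, so it is a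
  homomorphism because both factors are.
\<close>

lemma A_ring_iso_theta: "A_ring_iso A L (ldual_unit \<H>) E (comod_end_unit \<H>) \<theta>"
proof -
  have "comod_end_unit \<H> \<in> ring_hom A E"
  proof (rule ring_hom_memI)
    note hom = ldual_unit_hom[THEN ring_hom_mult] ldual_unit_hom[THEN ring_hom_add]
      ldual_unit_hom[THEN ring_hom_one]
    note th = theta_ring_iso[THEN ring_iso_memE(2)] theta_ring_iso[THEN ring_iso_memE(3)]
      theta_ring_iso[THEN ring_iso_memE(4)]
    note r = theta_ldual_unit[symmetric]
    show "comod_end_unit \<H> a \<in> carrier E" if "a \<in> carrier A" for a
      using that by (simp add: r ldual_unit_closed)
    show "comod_end_unit \<H> (a \<otimes>\<^bsub>A\<^esub> b) = comod_end_unit \<H> a \<otimes>\<^bsub>E\<^esub> comod_end_unit \<H> b"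
      "comod_end_unit \<H> (a \<oplus>\<^bsub>A\<^esub> b) = comod_end_unit \<H> a \<oplus>\<^bsub>E\<^esub> comod_end_unit \<H> b"
      if "a \<in> carrier A" "b \<in> carrier A" for a b
      using that by (simp_all add: r ldual_unit_closed hom th)
    show "comod_end_unit \<H> \<one>\<^bsub>A\<^esub> = \<one>\<^bsub>E\<^esub>" by (simp add: r hom th)
  qed
  then show ?thesis
    by (simp add: A_ring_iso_def A_ring_def ldual_ring comod_end_ring ldual_unit_hom
        theta_ring_iso theta_ldual_unit)
qed

abbreviation scalar :: "'k \<Rightarrow> 'a" where "scalar k \<equiv> k \<odot>\<^bsub>A\<^esub> \<one>\<^bsub>A\<^esub>"

lemma scalar_closed [simp]: "k \<in> carrier K \<Longrightarrow> scalar k \<in> carrier A"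
  using algebra_base module.smult_closed[of K A k "\<one>\<^bsub>A\<^esub>"] by (simp add: algebra_def)

lemma scalar_hom: "scalar \<in> ring_hom K A"
proof -
  interpret KA: algebra K A by (rule algebra_base)
  show ?thesis
    by (rule ring_hom_memI)
      (simp_all add: KA.smult_l_distr KA.smult_assoc1 KA.smult_assoc2)
qed

lemma base_smult: "\<lbrakk>k \<in> carrier K; a \<in> carrier A\<rbrakk> \<Longrightarrow> k \<odot>\<^bsub>A\<^esub> a = scalar k \<otimes>\<^bsub>A\<^esub> a"
  using algebra.smult_assoc2[OF algebra_base, of k "\<one>\<^bsub>A\<^esub>" a] by simp

text \<open>
  The second equation, \<open>t = s\<close> on scalars, is what makes the convolution product linear over \<open>K\<close>
  in its second argument.
\<close>

lemma tot_smult: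
  assumes "k \<in> carrier K" "u \<in> carrier U"
  shows "k \<odot>\<^bsub>U\<^esub> u = s (scalar k) \<otimes>\<^bsub>U\<^esub> u" and "t (scalar k) = s (scalar k)"
  using algebra.smult_assoc2[OF algebra_tot, of k "\<one>\<^bsub>U\<^esub>" u] src_hom tgt_hom assms
  by (auto simp: alg_hom_def)

lemma k_space_simps [simp]:
  "carrier (k_space \<H> M) = carrier M" "ring.add (k_space \<H> M) = ring.add M"
  "ring.zero (k_space \<H> M) = ring.zero M" "k \<odot>\<^bsub>k_space \<H> M\<^esub> m = scalar k \<odot>\<^bsub>M\<^esub> m"
  by (simp_all add: k_space_def)

lemma k_space_module:
  assumes "module A M"
  shows "module K (k_space \<H> M)"
proof -
  interpret M: module A M by fact
  interpret K: field K by (rule field_K)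
  interpret h: ring_hom_cring K A scalar by unfold_locales (rule scalar_hom)
  show ?thesis
    by (rule moduleI; (rule abelian_groupI)?)
      (auto simp: M.M.a_ac M.smult_l_distr M.smult_r_distr M.smult_assoc1 K.is_cring
        intro: M.M.add.l_inv_ex)
qed

lemma ldual_lie: "lie_algebra K (k_space \<H> L) (commutator L)"
proof (rule commutator_lie_algebra[OF field_K ldual_ring k_space_module[OF ldual_module]])
  fix k \<alpha> \<beta> assume *: "k \<in> carrier K" "\<alpha> \<in> carrier L" "\<beta> \<in> carrier L"
  then show "(k \<odot>\<^bsub>k_space \<H> L\<^esub> \<alpha>) \<otimes>\<^bsub>L\<^esub> \<beta> = k \<odot>\<^bsub>k_space \<H> L\<^esub> (\<alpha> \<otimes>\<^bsub>L\<^esub> \<beta>)"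
    by (intro ldual_ext) (simp_all add: theta_mult ldual_mult_apply ldual_smult_apply)
  show "\<alpha> \<otimes>\<^bsub>L\<^esub> (k \<odot>\<^bsub>k_space \<H> L\<^esub> \<beta>) = k \<odot>\<^bsub>k_space \<H> L\<^esub> (\<alpha> \<otimes>\<^bsub>L\<^esub> \<beta>)"
    using * by (intro ldual_ext)
      (simp_all add: theta_mult ldual_mult_apply ldual_smult_apply theta_smult
        comod_end_smult_apply tot_smult U.m_comm[of _ "s _"] ldual_src)
qed simp_all

lemma comod_end_lie: "lie_algebra K (k_space \<H> E) (commutator E)"
proof (rule commutator_lie_algebra[OF field_K comod_end_ring k_space_module[OF comod_end_module]])
  fix k \<delta> \<delta>' assume *: "k \<in> carrier K" "\<delta> \<in> carrier E" "\<delta>' \<in> carrier E"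
  then show "(k \<odot>\<^bsub>k_space \<H> E\<^esub> \<delta>) \<otimes>\<^bsub>E\<^esub> \<delta>' = k \<odot>\<^bsub>k_space \<H> E\<^esub> (\<delta> \<otimes>\<^bsub>E\<^esub> \<delta>')"
    by (intro comod_end_ext)
      (simp_all add: comod_end_mult_closed comod_end_mult_apply comod_end_smult_apply)
  show "\<delta> \<otimes>\<^bsub>E\<^esub> (k \<odot>\<^bsub>k_space \<H> E\<^esub> \<delta>') = k \<odot>\<^bsub>k_space \<H> E\<^esub> (\<delta> \<otimes>\<^bsub>E\<^esub> \<delta>')"
    using * by (intro comod_end_ext)
      (simp_all add: comod_end_mult_closed comod_end_mult_apply comod_end_smult_apply
        tot_smult U.m_comm[of _ "s _"] comod_end_src)
qed simp_all

end

section \<open>Derivations\<close>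

context comm_hopf_algebroid
begin

abbreviation "DL \<equiv> der_counit K \<H>"
abbreviation "DE \<equiv> der_comod K \<H>"

lemma der_counit_simps [simp]:
  "ring.add DL = ring.add L" "ring.zero DL = ring.zero L" "smult DL = smult L"
  by (simp_all add: der_counit_def)

lemma der_comod_simps [simp]:
  "ring.add DE = ring.add E" "ring.zero DE = ring.zero E" "smult DE = smult E"
  by (simp_all add: der_comod_def)

text \<open>
  By the Leibniz rule, linearity over \<open>K\<close> together with vanishing on \<open>s(A)\<close> amounts to linearity
  over \<open>A\<close>: vanishing on \<open>s(A)\<close> turns \<open>\<delta>(s(a) u)\<close> into \<open>a \<delta>(u)\<close>, and conversely \<open>\<delta>(1) = 0\<close> forces
  \<open>\<delta>(s(a)) = a \<delta>(1) = 0\<close>.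
\<close>

lemma mem_der_counit:
  "\<delta> \<in> carrier DL \<longleftrightarrow> \<delta> \<in> carrier L \<and>
     (\<forall>u\<in>carrier U. \<forall>v\<in>carrier U. \<delta> (u \<otimes>\<^bsub>U\<^esub> v) = e u \<otimes>\<^bsub>A\<^esub> \<delta> v \<oplus>\<^bsub>A\<^esub> \<delta> u \<otimes>\<^bsub>A\<^esub> e v)"
  (is "_ \<longleftrightarrow> _ \<and> ?leibniz")
proof
  assume d: "\<delta> \<in> carrier DL"
  then have l: ?leibniz and z: "\<forall>a\<in>carrier A. \<delta> (s a) = \<zero>\<^bsub>A\<^esub>"
    and ext: "\<delta> \<in> extensional (carrier U)" and ad: "additive U A \<delta>"
    by (auto simp: der_counit_def der_counit_carrier_def lin_maps_def additive_def)
  have "\<delta> (s a \<otimes>\<^bsub>U\<^esub> u) = a \<otimes>\<^bsub>A\<^esub> \<delta> u" if "a \<in> carrier A" "u \<in> carrier U" for a u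
    using that l z ad by (auto simp: additive_def Pi_iff)
  then show "\<delta> \<in> carrier L \<and> ?leibniz" using l ext ad by (auto simp: mem_ldual)
next
  assume "\<delta> \<in> carrier L \<and> ?leibniz"
  then have d: "\<delta> \<in> carrier L" and l: ?leibniz by blast+
  have one: "\<delta> \<one>\<^bsub>U\<^esub> = \<zero>\<^bsub>A\<^esub>"
  proof -
    have "\<delta> \<one>\<^bsub>U\<^esub> = \<delta> \<one>\<^bsub>U\<^esub> \<oplus>\<^bsub>A\<^esub> \<delta> \<one>\<^bsub>U\<^esub>"
      using l[rule_format, of "\<one>\<^bsub>U\<^esub>" "\<one>\<^bsub>U\<^esub>"] d by simp
    then show ?thesis using d by (metis A.add.r_cancel_one' U.one_closed ldual_closed)
  qed
  have "\<delta> (s a) = \<zero>\<^bsub>A\<^esub>" if "a \<in> carrier A" for a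
    using ldual_src[OF d that U.one_closed] that one by simp
  moreover have "\<delta> (k \<odot>\<^bsub>U\<^esub> u) = k \<odot>\<^bsub>A\<^esub> \<delta> u" if "k \<in> carrier K" "u \<in> carrier U" for k u
    using d that by (simp add: tot_smult ldual_src base_smult[of k "\<delta> u"])
  ultimately show "\<delta> \<in> carrier DL"
    using d l unfolding der_counit_def der_counit_carrier_def lin_maps_def mem_ldual additive_def by simp
qed

lemma mem_der_comod:
  "\<delta> \<in> carrier DE \<longleftrightarrow> \<delta> \<in> carrier E \<and>
     (\<forall>u\<in>carrier U. \<forall>v\<in>carrier U. \<delta> (u \<otimes>\<^bsub>U\<^esub> v) = \<delta> u \<otimes>\<^bsub>U\<^esub> v \<oplus>\<^bsub>U\<^esub> u \<otimes>\<^bsub>U\<^esub> \<delta> v)"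
  (is "_ \<longleftrightarrow> _ \<and> ?leibniz")
proof
  assume d: "\<delta> \<in> carrier DE"
  then have l: ?leibniz and z: "\<forall>a\<in>carrier A. \<delta> (s a) = \<zero>\<^bsub>U\<^esub>"
    and ext: "\<delta> \<in> extensional (carrier U)" and ad: "additive U U \<delta>" and cm: "comodule_map \<H> \<delta>"
    by (auto simp: der_comod_def der_comod_carrier_def lin_maps_def additive_def)
  have "\<delta> (s a \<otimes>\<^bsub>U\<^esub> u) = s a \<otimes>\<^bsub>U\<^esub> \<delta> u" if "a \<in> carrier A" "u \<in> carrier U" for a u
    using that l z ad by (auto simp: additive_def Pi_iff)
  then show "\<delta> \<in> carrier E \<and> ?leibniz" using l ext ad cm by (auto simp: mem_comod_end)
next
  assume "\<delta> \<in> carrier E \<and> ?leibniz"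
  then have d: "\<delta> \<in> carrier E" and l: ?leibniz by blast+
  have one: "\<delta> \<one>\<^bsub>U\<^esub> = \<zero>\<^bsub>U\<^esub>"
  proof -
    have "\<delta> \<one>\<^bsub>U\<^esub> = \<delta> \<one>\<^bsub>U\<^esub> \<oplus>\<^bsub>U\<^esub> \<delta> \<one>\<^bsub>U\<^esub>"
      using l[rule_format, of "\<one>\<^bsub>U\<^esub>" "\<one>\<^bsub>U\<^esub>"] d by simp
    then show ?thesis using d by (metis U.add.r_cancel_one' U.one_closed comod_end_closed)
  qed
  have "\<delta> (s a) = \<zero>\<^bsub>U\<^esub>" if "a \<in> carrier A" for a
    using comod_end_src[OF d that U.one_closed] that one by simp
  moreover have "\<delta> (k \<odot>\<^bsub>U\<^esub> u) = k \<odot>\<^bsub>U\<^esub> \<delta> u" if "k \<in> carrier K" "u \<in> carrier U" for k u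
    using d that by (simp add: tot_smult comod_end_src)
  ultimately show "\<delta> \<in> carrier DE"
    using d l unfolding der_comod_def der_comod_carrier_def lin_maps_def mem_comod_end additive_def by simp
qed

lemma der_counit_sub: "carrier DL \<subseteq> carrier L"
  by (auto simp: mem_der_counit)

lemma der_comod_sub: "carrier DE \<subseteq> carrier E"
  by (auto simp: mem_der_comod)

text \<open>
  As \<open>\<Delta>\<close> is multiplicative, \<open>\<theta>(\<delta>)(uv) = u\<^sub>1 v\<^sub>1 t(\<delta>(u\<^sub>2 v\<^sub>2))\<close>; the Leibniz rule splits the sum into two parts,
  and the right counit law collapses one pair of indices in each.
\<close>

lemma theta_der:
  assumes d: "\<delta> \<in> carrier DL"
  shows "\<theta> \<delta> \<in> carrier DE"
  unfolding mem_der_comod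
proof (intro conjI ballI)
  have dL: "\<delta> \<in> carrier L" using d by (simp add: mem_der_counit)
  show "\<theta> \<delta> \<in> carrier E" using dL by simp
  fix u v assume u: "u \<in> carrier U" and v: "v \<in> carrier U"
  note UA = U.abelian_group_axioms and b = balanced_theta[OF dL]
  have b1: "bal2 U (\<lambda>x y. x \<otimes>\<^bsub>U\<^esub> t (e y))"
    by (intro balancedI) (simp_all add: U.l_distr U.r_distr U.m_assoc)
  have scale: "additive U U (\<lambda>h. p \<otimes>\<^bsub>U\<^esub> h)" "additive U U (\<lambda>h. h \<otimes>\<^bsub>U\<^esub> p)" if "p \<in> carrier U" for p
    using that by (auto simp: additive_def U.l_distr U.r_distr)
  have inner: "sweedler U (D v) (\<lambda>x' y'. x \<otimes>\<^bsub>U\<^esub> x' \<otimes>\<^bsub>U\<^esub> t (\<delta> (y \<otimes>\<^bsub>U\<^esub> y'))) =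
      (x \<otimes>\<^bsub>U\<^esub> t (e y)) \<otimes>\<^bsub>U\<^esub> \<theta> \<delta> v \<oplus>\<^bsub>U\<^esub> (x \<otimes>\<^bsub>U\<^esub> t (\<delta> y)) \<otimes>\<^bsub>U\<^esub> v"
    if x: "x \<in> carrier U" and y: "y \<in> carrier U" for x y
  proof -
    let ?p = "x \<otimes>\<^bsub>U\<^esub> t (e y)" and ?q = "x \<otimes>\<^bsub>U\<^esub> t (\<delta> y)"
    have pq: "?p \<in> carrier U" "?q \<in> carrier U" using x y dL by auto
    have bp: "bal2 U (\<lambda>x' y'. ?p \<otimes>\<^bsub>U\<^esub> (x' \<otimes>\<^bsub>U\<^esub> t (\<delta> y')))"
      by (rule additive_balanced_comp[OF scale(1)[OF pq(1)] b])
    have bq: "bal2 U (\<lambda>x' y'. ?q \<otimes>\<^bsub>U\<^esub> (x' \<otimes>\<^bsub>U\<^esub> t (e y')))"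
      by (rule additive_balanced_comp[OF scale(1)[OF pq(2)] b1])
    have "sweedler U (D v) (\<lambda>x' y'. x \<otimes>\<^bsub>U\<^esub> x' \<otimes>\<^bsub>U\<^esub> t (\<delta> (y \<otimes>\<^bsub>U\<^esub> y'))) =
        sweedler U (D v) (\<lambda>x' y'. ?p \<otimes>\<^bsub>U\<^esub> (x' \<otimes>\<^bsub>U\<^esub> t (\<delta> y')) \<oplus>\<^bsub>U\<^esub> ?q \<otimes>\<^bsub>U\<^esub> (x' \<otimes>\<^bsub>U\<^esub> t (e y')))"
    proof (rule T2.sweedler_cong[OF UA T2.balanced_translate[OF b x y]])
      show "D v \<in> carrier T2" using v by simp
      fix x' y' assume xy': "x' \<in> carrier U" "y' \<in> carrier U"
      have "\<delta> (y \<otimes>\<^bsub>U\<^esub> y') = e y \<otimes>\<^bsub>A\<^esub> \<delta> y' \<oplus>\<^bsub>A\<^esub> \<delta> y \<otimes>\<^bsub>A\<^esub> e y'"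
        using d y xy' by (simp add: mem_der_counit)
      then show "x \<otimes>\<^bsub>U\<^esub> x' \<otimes>\<^bsub>U\<^esub> t (\<delta> (y \<otimes>\<^bsub>U\<^esub> y')) =
          ?p \<otimes>\<^bsub>U\<^esub> (x' \<otimes>\<^bsub>U\<^esub> t (\<delta> y')) \<oplus>\<^bsub>U\<^esub> ?q \<otimes>\<^bsub>U\<^esub> (x' \<otimes>\<^bsub>U\<^esub> t (e y'))"
        using x y xy' dL by (simp add: U.r_distr U.m_ac)
    qed
    also have "\<dots> = sweedler U (D v) (\<lambda>x' y'. ?p \<otimes>\<^bsub>U\<^esub> (x' \<otimes>\<^bsub>U\<^esub> t (\<delta> y'))) \<oplus>\<^bsub>U\<^esub>
        sweedler U (D v) (\<lambda>x' y'. ?q \<otimes>\<^bsub>U\<^esub> (x' \<otimes>\<^bsub>U\<^esub> t (e y')))"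
      using v by (intro T2.sweedler_add_fun[OF UA bp bq]) simp
    also have "sweedler U (D v) (\<lambda>x' y'. ?p \<otimes>\<^bsub>U\<^esub> (x' \<otimes>\<^bsub>U\<^esub> t (\<delta> y'))) = ?p \<otimes>\<^bsub>U\<^esub> \<theta> \<delta> v"
      unfolding theta_eq[OF v] using v
      by (intro T2.additive_sweedler[OF UA UA b scale(1)[OF pq(1)], symmetric]) simp
    also have "sweedler U (D v) (\<lambda>x' y'. ?q \<otimes>\<^bsub>U\<^esub> (x' \<otimes>\<^bsub>U\<^esub> t (e y'))) = ?q \<otimes>\<^bsub>U\<^esub> v"
      using T2.additive_sweedler[OF UA UA b1 scale(1)[OF pq(2)], of "D v"] v by (simp add: counit_right)
    finally show ?thesis .
  qed
  have "\<theta> \<delta> (u \<otimes>\<^bsub>U\<^esub> v) = sweedler U (D u \<otimes>\<^bsub>T2\<^esub> D v) (\<lambda>x y. x \<otimes>\<^bsub>U\<^esub> t (\<delta> y))"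
    using u v ring_hom_mult[OF comult_ring_hom, of u v] by (simp add: theta_eq)
  also have "\<dots> = sweedler U (D u)
      (\<lambda>x y. sweedler U (D v) (\<lambda>x' y'. x \<otimes>\<^bsub>U\<^esub> x' \<otimes>\<^bsub>U\<^esub> t (\<delta> (y \<otimes>\<^bsub>U\<^esub> y'))))"
    using u v by (intro T2.sweedler_mult[OF UA b]) simp_all
  also have "\<dots> = sweedler U (D u)
      (\<lambda>x y. (x \<otimes>\<^bsub>U\<^esub> t (e y)) \<otimes>\<^bsub>U\<^esub> \<theta> \<delta> v \<oplus>\<^bsub>U\<^esub> (x \<otimes>\<^bsub>U\<^esub> t (\<delta> y)) \<otimes>\<^bsub>U\<^esub> v)"
    using u v by (intro T2.sweedler_cong[OF UA T2.balanced_sweedler_translate[OF UA b]] inner) simp_all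
  also have "\<dots> = sweedler U (D u) (\<lambda>x y. (x \<otimes>\<^bsub>U\<^esub> t (e y)) \<otimes>\<^bsub>U\<^esub> \<theta> \<delta> v) \<oplus>\<^bsub>U\<^esub>
      sweedler U (D u) (\<lambda>x y. (x \<otimes>\<^bsub>U\<^esub> t (\<delta> y)) \<otimes>\<^bsub>U\<^esub> v)"
    using u v dL
    by (intro T2.sweedler_add_fun[OF UA] additive_balanced_comp[OF scale(2) b1]
        additive_balanced_comp[OF scale(2) b]) simp_all
  also have "sweedler U (D u) (\<lambda>x y. (x \<otimes>\<^bsub>U\<^esub> t (e y)) \<otimes>\<^bsub>U\<^esub> \<theta> \<delta> v) = u \<otimes>\<^bsub>U\<^esub> \<theta> \<delta> v"
    using T2.additive_sweedler[OF UA UA b1 scale(2), of "\<theta> \<delta> v" "D u"] u v dL by (simp add: counit_right)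
  also have "sweedler U (D u) (\<lambda>x y. (x \<otimes>\<^bsub>U\<^esub> t (\<delta> y)) \<otimes>\<^bsub>U\<^esub> v) = \<theta> \<delta> u \<otimes>\<^bsub>U\<^esub> v"
    unfolding theta_eq[OF u] using u v
    by (intro T2.additive_sweedler[OF UA UA b scale(2), symmetric]) simp_all
  finally show "\<theta> \<delta> (u \<otimes>\<^bsub>U\<^esub> v) = \<theta> \<delta> u \<otimes>\<^bsub>U\<^esub> v \<oplus>\<^bsub>U\<^esub> u \<otimes>\<^bsub>U\<^esub> \<theta> \<delta> v"
    using u v dL by (simp add: U.a_comm)
qed

lemma counit_comp_der:
  assumes "\<delta> \<in> carrier DE"
  shows "compose (carrier U) e \<delta> \<in> carrier DL"
proof -
  have E: "\<delta> \<in> carrier E" using assms by (simp add: mem_der_comod)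
  show ?thesis
    unfolding mem_der_counit
  proof (intro conjI ballI)
    show "compose (carrier U) e \<delta> \<in> carrier L" by (rule counit_comp_comod_end[OF E])
    fix u v assume "u \<in> carrier U" "v \<in> carrier U"
    then show "compose (carrier U) e \<delta> (u \<otimes>\<^bsub>U\<^esub> v) =
        e u \<otimes>\<^bsub>A\<^esub> compose (carrier U) e \<delta> v \<oplus>\<^bsub>A\<^esub> compose (carrier U) e \<delta> u \<otimes>\<^bsub>A\<^esub> e v"
      using assms E by (simp add: mem_der_comod compose_def A.a_comm)
  qed
qed

lemma theta_der_bij: "bij_betw \<theta> (carrier DL) (carrier DE)"
  using der_counit_sub der_comod_sub
  by (intro bij_betw_byWitness[where f' = "compose (carrier U) e"])
    (auto simp: counit_comp_theta theta_counit_comp counit_comp_der theta_der)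

lemma der_counit_submodule: "submodule (carrier DL) A L"
proof (rule L.submoduleI_smult)
  show "carrier DL \<subseteq> carrier L" by (rule der_counit_sub)
  show "\<zero>\<^bsub>L\<^esub> \<in> carrier DL"
    using L.M.zero_closed by (auto simp: mem_der_counit) (auto simp: ldual_def)
  show "\<delta> \<oplus>\<^bsub>L\<^esub> \<delta>' \<in> carrier DL" if "\<delta> \<in> carrier DL" "\<delta>' \<in> carrier DL" for \<delta> \<delta>'
    using that by (auto simp: mem_der_counit ldual_add_apply A.l_distr A.r_distr A.a_ac)
  show "a \<odot>\<^bsub>L\<^esub> \<delta> \<in> carrier DL" if "a \<in> carrier A" "\<delta> \<in> carrier DL" for a \<delta>
    using that by (auto simp: mem_der_counit ldual_smult_apply A.r_distr A.m_ac)
qed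

lemma der_comod_submodule: "submodule (carrier DE) A E"
proof (rule E.submoduleI_smult)
  show "carrier DE \<subseteq> carrier E" by (rule der_comod_sub)
  show "\<zero>\<^bsub>E\<^esub> \<in> carrier DE"
    using E.M.zero_closed by (auto simp: mem_der_comod) (auto simp: comod_end_def)
  show "\<delta> \<oplus>\<^bsub>E\<^esub> \<delta>' \<in> carrier DE" if "\<delta> \<in> carrier DE" "\<delta>' \<in> carrier DE" for \<delta> \<delta>'
    using that by (auto simp: mem_der_comod comod_end_add_apply U.l_distr U.r_distr U.a_ac)
  show "a \<odot>\<^bsub>E\<^esub> \<delta> \<in> carrier DE" if "a \<in> carrier A" "\<delta> \<in> carrier DE" for a \<delta>
    using that by (auto simp: mem_der_comod comod_end_smult_apply U.l_distr U.r_distr U.m_ac)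
qed

lemma der_counit_module: "module A DL"
  using submodule.submodule_is_module[OF der_counit_submodule ldual_module]
  by (simp add: der_counit_def)

lemma der_comod_module: "module A DE"
  using submodule.submodule_is_module[OF der_comod_submodule comod_end_module]
  by (simp add: der_comod_def)

lemma commutator_comod_end_apply:
  assumes "\<delta> \<in> carrier E" "\<delta>' \<in> carrier E" "u \<in> carrier U"
  shows "commutator E \<delta> \<delta>' u = \<delta> (\<delta>' u) \<ominus>\<^bsub>U\<^esub> \<delta>' (\<delta> u)"
  using assms by (simp add: commutator_def comod_end_minus comod_end_mult_closed comod_end_mult_apply)

lemma commutator_der_comod:
  assumes d: "\<delta> \<in> carrier DE" and d': "\<delta>' \<in> carrier DE"
  shows "commutator E \<delta> \<delta>' \<in> carrier DE"
  unfolding mem_der_comod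
proof (intro conjI ballI)
  have E: "\<delta> \<in> carrier E" "\<delta>' \<in> carrier E" using d d' by (auto simp: mem_der_comod)
  show "commutator E \<delta> \<delta>' \<in> carrier E"
    using E by (simp add: commutator_def comod_end_mult_closed)
  fix u v assume uv: "u \<in> carrier U" "v \<in> carrier U"
  have l: "\<delta> (x \<otimes>\<^bsub>U\<^esub> y) = \<delta> x \<otimes>\<^bsub>U\<^esub> y \<oplus>\<^bsub>U\<^esub> x \<otimes>\<^bsub>U\<^esub> \<delta> y"
    and l': "\<delta>' (x \<otimes>\<^bsub>U\<^esub> y) = \<delta>' x \<otimes>\<^bsub>U\<^esub> y \<oplus>\<^bsub>U\<^esub> x \<otimes>\<^bsub>U\<^esub> \<delta>' y"
    if "x \<in> carrier U" "y \<in> carrier U" for x y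
    using d d' that by (auto simp: mem_der_comod)
  \<comment> \<open>the mixed terms \<open>\<delta>'(u) \<delta>(v)\<close> and \<open>\<delta>(u) \<delta>'(v)\<close> occur in both second-order expressions\<close>
  have cancel: "(p \<oplus>\<^bsub>U\<^esub> q \<oplus>\<^bsub>U\<^esub> (r \<oplus>\<^bsub>U\<^esub> w)) \<ominus>\<^bsub>U\<^esub> (p' \<oplus>\<^bsub>U\<^esub> r \<oplus>\<^bsub>U\<^esub> (q \<oplus>\<^bsub>U\<^esub> w')) =
      (p \<ominus>\<^bsub>U\<^esub> p') \<oplus>\<^bsub>U\<^esub> (w \<ominus>\<^bsub>U\<^esub> w')"
    if in_U: "p \<in> carrier U" "q \<in> carrier U" "r \<in> carrier U" "w \<in> carrier U" "p' \<in> carrier U" "w' \<in> carrier U"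
    for p q r w p' w'
  proof -
    have "(p \<oplus>\<^bsub>U\<^esub> q \<oplus>\<^bsub>U\<^esub> (r \<oplus>\<^bsub>U\<^esub> w)) \<ominus>\<^bsub>U\<^esub> (p' \<oplus>\<^bsub>U\<^esub> r \<oplus>\<^bsub>U\<^esub> (q \<oplus>\<^bsub>U\<^esub> w')) =
        ((p \<ominus>\<^bsub>U\<^esub> p') \<oplus>\<^bsub>U\<^esub> (w \<ominus>\<^bsub>U\<^esub> w')) \<oplus>\<^bsub>U\<^esub> ((q \<oplus>\<^bsub>U\<^esub> \<ominus>\<^bsub>U\<^esub> q) \<oplus>\<^bsub>U\<^esub> (r \<oplus>\<^bsub>U\<^esub> \<ominus>\<^bsub>U\<^esub> r))"
      using in_U by (simp add: a_minus_def U.minus_add U.a_ac)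
    then show ?thesis using in_U by (simp add: U.r_neg)
  qed
  have "commutator E \<delta> \<delta>' (u \<otimes>\<^bsub>U\<^esub> v) = \<delta> (\<delta>' (u \<otimes>\<^bsub>U\<^esub> v)) \<ominus>\<^bsub>U\<^esub> \<delta>' (\<delta> (u \<otimes>\<^bsub>U\<^esub> v))"
    using E uv by (simp add: commutator_comod_end_apply)
  also have "\<dots> = (\<delta> (\<delta>' u) \<otimes>\<^bsub>U\<^esub> v \<oplus>\<^bsub>U\<^esub> \<delta>' u \<otimes>\<^bsub>U\<^esub> \<delta> v \<oplus>\<^bsub>U\<^esub> (\<delta> u \<otimes>\<^bsub>U\<^esub> \<delta>' v \<oplus>\<^bsub>U\<^esub> u \<otimes>\<^bsub>U\<^esub> \<delta> (\<delta>' v))) \<ominus>\<^bsub>U\<^esub>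
      (\<delta>' (\<delta> u) \<otimes>\<^bsub>U\<^esub> v \<oplus>\<^bsub>U\<^esub> \<delta> u \<otimes>\<^bsub>U\<^esub> \<delta>' v \<oplus>\<^bsub>U\<^esub> (\<delta>' u \<otimes>\<^bsub>U\<^esub> \<delta> v \<oplus>\<^bsub>U\<^esub> u \<otimes>\<^bsub>U\<^esub> \<delta>' (\<delta> v)))"
    using E uv by (simp add: l l' comod_end_add)
  also have "\<dots> = (\<delta> (\<delta>' u) \<otimes>\<^bsub>U\<^esub> v \<ominus>\<^bsub>U\<^esub> \<delta>' (\<delta> u) \<otimes>\<^bsub>U\<^esub> v) \<oplus>\<^bsub>U\<^esub>
      (u \<otimes>\<^bsub>U\<^esub> \<delta> (\<delta>' v) \<ominus>\<^bsub>U\<^esub> u \<otimes>\<^bsub>U\<^esub> \<delta>' (\<delta> v))"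
    using E uv by (intro cancel) simp_all
  also have "\<dots> = commutator E \<delta> \<delta>' u \<otimes>\<^bsub>U\<^esub> v \<oplus>\<^bsub>U\<^esub> u \<otimes>\<^bsub>U\<^esub> commutator E \<delta> \<delta>' v"
    using E uv
    by (simp add: commutator_comod_end_apply a_minus_def U.l_distr U.r_distr U.l_minus U.r_minus)
  finally show "commutator E \<delta> \<delta>' (u \<otimes>\<^bsub>U\<^esub> v) =
    commutator E \<delta> \<delta>' u \<otimes>\<^bsub>U\<^esub> v \<oplus>\<^bsub>U\<^esub> u \<otimes>\<^bsub>U\<^esub> commutator E \<delta> \<delta>' v" .
qed

lemma commutator_ldual_closed: "\<lbrakk>\<alpha> \<in> carrier L; \<beta> \<in> carrier L\<rbrakk> \<Longrightarrow> commutator L \<alpha> \<beta> \<in> carrier L"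
  by (simp add: commutator_def theta_mult)

lemma theta_commutator:
  assumes "\<alpha> \<in> carrier L" "\<beta> \<in> carrier L"
  shows "\<theta> (commutator L \<alpha> \<beta>) = commutator E (\<theta> \<alpha>) (\<theta> \<beta>)"
proof -
  have ad: "additive L E \<theta>" by (auto simp: additive_def theta_add)
  have "\<theta> (commutator L \<alpha> \<beta>) = \<theta> (\<alpha> \<otimes>\<^bsub>L\<^esub> \<beta>) \<ominus>\<^bsub>E\<^esub> \<theta> (\<beta> \<otimes>\<^bsub>L\<^esub> \<alpha>)"
    unfolding commutator_def using assms theta_mult(1)
    by (intro additive_minus[OF L.M.abelian_group_axioms E.M.abelian_group_axioms ad]) auto
  then show ?thesis
    using assms ring_iso_memE(2)[OF theta_ring_iso] by (simp add: commutator_def)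
qed

text \<open>
  Closure is transported from the derivations of \<open>\<H>\<close>: \<open>\<theta>\<close> sends the bracket to a commutator of
  derivations, and \<open>\<epsilon> \<circ> \<theta>(\<alpha>) = \<alpha>\<close> brings it back.
\<close>

lemma commutator_der_counit:
  assumes "\<delta> \<in> carrier DL" "\<delta>' \<in> carrier DL"
  shows "commutator L \<delta> \<delta>' \<in> carrier DL"
proof -
  have L: "\<delta> \<in> carrier L" "\<delta>' \<in> carrier L" using assms der_counit_sub by auto
  have "commutator E (\<theta> \<delta>) (\<theta> \<delta>') \<in> carrier DE"
    using assms by (intro commutator_der_comod theta_der)
  from counit_comp_der[OF this] show ?thesis
    using L by (simp add: theta_commutator[symmetric] counit_comp_theta commutator_ldual_closed)
qed

lemma commutator_ldual_apply:
  assumes "\<alpha> \<in> carrier L" "\<beta> \<in> carrier L" "u \<in> carrier U"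
  shows "commutator L \<alpha> \<beta> u = \<alpha> (\<theta> \<beta> u) \<ominus>\<^bsub>A\<^esub> \<beta> (\<theta> \<alpha> u)"
  using assms by (simp add: commutator_def ldual_minus theta_mult ldual_mult_apply)

lemma der_counit_lie_hom:
  "lie_hom K (k_space \<H> DL) (commutator L) (k_space \<H> L) (commutator L) (\<lambda>\<delta>. \<delta>)"
  using der_counit_sub
  by (intro lie_algebra_pullback[OF ldual_lie k_space_module[OF der_counit_module]])
    (auto simp: lin_maps_def commutator_der_counit)

lemma der_comod_lie_hom:
  "lie_hom K (k_space \<H> DE) (commutator E) (k_space \<H> E) (commutator E) (\<lambda>\<delta>. \<delta>)"
  using der_comod_sub
  by (intro lie_algebra_pullback[OF comod_end_lie k_space_module[OF der_comod_module]])
    (auto simp: lin_maps_def commutator_der_comod)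

lemma theta_der_module_iso: "module_iso A DL DE \<theta>"
  by (auto simp: module_iso_def der_counit_module der_comod_module theta_der_bij lin_maps_def
      theta_der theta_add theta_smult subsetD[OF der_counit_sub])

lemma theta_der_lie_hom:
  "lie_hom K (k_space \<H> DL) (commutator L) (k_space \<H> DE) (commutator E) \<theta>"
proof (rule lie_algebra_pullback)
  show "lie_algebra K (k_space \<H> DE) (commutator E)" using der_comod_lie_hom by (simp add: lie_hom_def)
  show "module K (k_space \<H> DL)" by (rule k_space_module[OF der_counit_module])
  show "\<theta> \<in> lin_maps K (k_space \<H> DL) (k_space \<H> DE)"
    by (auto simp: lin_maps_def theta_der theta_add theta_smult subsetD[OF der_counit_sub])
  show "inj_on \<theta> (carrier (k_space \<H> DL))" using theta_der_bij by (simp add: bij_betw_def)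
qed (auto simp: commutator_der_counit theta_commutator subsetD[OF der_counit_sub])

end

section \<open>The conormal module\<close>

context comm_hopf_algebroid
begin

abbreviation "I \<equiv> aug_ideal \<H>"
abbreviation "I2 \<equiv> aug_ideal_sq \<H>"
abbreviation "C \<equiv> conormal \<H>"
abbreviation "CD \<equiv> conormal_dual \<H>"
abbreviation cot :: "'h \<Rightarrow> 'h set" where "cot u \<equiv> I2 +>\<^bsub>U\<^esub> u"

lemma mem_aug_ideal: "u \<in> I \<longleftrightarrow> u \<in> carrier U \<and> e u = \<zero>\<^bsub>A\<^esub>"
  unfolding aug_ideal_def a_kernel_def kernel_def monoid.simps partial_object.simps by blast

lemma aug_ideal_sub: "I \<subseteq> carrier U"
  by (auto simp: mem_aug_ideal)

lemma aug_ideal: "ideal I U"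
  unfolding aug_ideal_def by (rule counit.ring.kernel_is_ideal)

lemma aug_ideal_sq: "ideal I2 U"
  unfolding aug_ideal_sq_def by (rule U.ideal_prod_is_ideal[OF aug_ideal aug_ideal])

sublocale I2: ideal I2 U by (rule aug_ideal_sq)

lemma cot_eq_iff:
  assumes "u \<in> carrier U" "v \<in> carrier U"
  shows "cot u = cot v \<longleftrightarrow> u \<ominus>\<^bsub>U\<^esub> v \<in> I2"
  using U.quotient_eq_iff_same_a_r_cos[OF aug_ideal_sq assms] by blast

lemma carrier_conormal: "carrier C = cot ` I"
  by (simp add: conormal_def Let_def)

lemma conormal_add: "\<lbrakk>u \<in> carrier U; v \<in> carrier U\<rbrakk> \<Longrightarrow> cot u \<oplus>\<^bsub>C\<^esub> cot v = cot (u \<oplus>\<^bsub>U\<^esub> v)"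
  by (simp add: conormal_def Let_def FactRing_def I2.a_rcos_sum)

lemma conormal_smult: "\<lbrakk>a \<in> carrier A; u \<in> carrier U\<rbrakk> \<Longrightarrow> a \<odot>\<^bsub>C\<^esub> cot u = cot (s a \<otimes>\<^bsub>U\<^esub> u)"
  by (simp add: conormal_def Let_def FactRing_def I2.rcoset_mult_add)

lemma conormal_zero: "\<zero>\<^bsub>C\<^esub> = cot \<zero>\<^bsub>U\<^esub>"
  using I2.a_subset by (simp add: conormal_def Let_def FactRing_def U.a_coset_add_zero)

lemma conormal_module: "module A C"
proof (rule moduleI)
  show "abelian_group C"
  proof (rule abelian_groupI)
    show "\<exists>y\<in>carrier C. y \<oplus>\<^bsub>C\<^esub> x = \<zero>\<^bsub>C\<^esub>" if "x \<in> carrier C" for x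
    proof -
      obtain u where u: "u \<in> I" "x = cot u" using \<open>x \<in> carrier C\<close> by (auto simp: carrier_conormal)
      then have "\<ominus>\<^bsub>U\<^esub> u \<in> I" by (simp add: mem_aug_ideal)
      then show ?thesis
        using u by (intro bexI[of _ "cot (\<ominus>\<^bsub>U\<^esub> u)"])
          (auto simp: mem_aug_ideal conormal_add conormal_zero U.l_neg carrier_conormal)
    qed
  qed (auto simp: carrier_conormal mem_aug_ideal conormal_add conormal_zero U.a_ac)
qed (auto simp: carrier_conormal mem_aug_ideal conormal_add conormal_smult U.l_distr U.r_distr
    U.m_assoc A.is_cring)

sublocale C: module A C by (rule conormal_module)

lemma mem_conormal_dual:
  "f \<in> carrier CD \<longleftrightarrow> f \<in> extensional (carrier C) \<and> additive C A f \<and>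
     (\<forall>a\<in>carrier A. \<forall>z\<in>carrier C. f (a \<odot>\<^bsub>C\<^esub> z) = a \<otimes>\<^bsub>A\<^esub> f z)"
  by (auto simp: conormal_dual_def lin_maps_def base_mod_def additive_def)

lemma conormal_dual_module: "module A CD"
proof (rule pointwise_module[OF base_module])
  show "carrier CD \<subseteq> carrier C \<rightarrow>\<^sub>E carrier (base_mod \<H>)"
    by (auto simp: mem_conormal_dual base_mod_def additive_def PiE_def)
  show "\<zero>\<^bsub>CD\<^esub> \<in> carrier CD"
    by (simp add: mem_conormal_dual additive_def) (simp add: conormal_dual_def)
  show "f \<oplus>\<^bsub>CD\<^esub> g \<in> carrier CD" if fg: "f \<in> carrier CD" "g \<in> carrier CD" for f g
  proof -
    have "(\<lambda>z\<in>carrier C. f z \<oplus>\<^bsub>A\<^esub> g z) \<in> carrier CD"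
      using fg by (auto simp: mem_conormal_dual additive_def Pi_iff A.r_distr A.a_ac)
    then show ?thesis by (simp add: conormal_dual_def)
  qed
  show "a \<odot>\<^bsub>CD\<^esub> f \<in> carrier CD" if af: "a \<in> carrier A" "f \<in> carrier CD" for a f
  proof -
    have "(\<lambda>z\<in>carrier C. a \<otimes>\<^bsub>A\<^esub> f z) \<in> carrier CD"
      using af by (auto simp: mem_conormal_dual additive_def Pi_iff A.r_distr A.m_ac)
    then show ?thesis by (simp add: conormal_dual_def)
  qed
qed (simp_all add: conormal_dual_def base_mod_def)

abbreviation red :: "'h \<Rightarrow> 'h" where "red u \<equiv> u \<ominus>\<^bsub>U\<^esub> s (e u)"

lemma red_mem: "u \<in> carrier U \<Longrightarrow> red u \<in> I"
  by (simp add: mem_aug_ideal a_minus_def A.r_neg)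

lemma pi_s_eq: "pi_s \<H> u = cot (red u)"
  by (simp add: pi_s_def)

lemma pi_s_closed [simp]: "u \<in> carrier U \<Longrightarrow> pi_s \<H> u \<in> carrier C"
  by (simp add: pi_s_eq carrier_conormal red_mem)

lemma pi_s_add: "\<lbrakk>u \<in> carrier U; v \<in> carrier U\<rbrakk> \<Longrightarrow> pi_s \<H> (u \<oplus>\<^bsub>U\<^esub> v) = pi_s \<H> u \<oplus>\<^bsub>C\<^esub> pi_s \<H> v"
  by (simp add: pi_s_eq conormal_add) (simp add: a_minus_def U.minus_add U.a_ac)

lemma pi_s_src:
  "\<lbrakk>a \<in> carrier A; u \<in> carrier U\<rbrakk> \<Longrightarrow> pi_s \<H> (s a \<otimes>\<^bsub>U\<^esub> u) = a \<odot>\<^bsub>C\<^esub> pi_s \<H> u"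
  by (simp add: pi_s_eq conormal_smult) (simp add: a_minus_def U.r_distr U.r_minus)

text \<open>
  The two sides differ by the class of \<open>(u - s(\<epsilon>(u))) (v - s(\<epsilon>(v)))\<close>, a product of two elements of
  the augmentation ideal.
\<close>

lemma pi_s_mult:
  assumes u: "u \<in> carrier U" and v: "v \<in> carrier U"
  shows "pi_s \<H> (u \<otimes>\<^bsub>U\<^esub> v) = e u \<odot>\<^bsub>C\<^esub> pi_s \<H> v \<oplus>\<^bsub>C\<^esub> e v \<odot>\<^bsub>C\<^esub> pi_s \<H> u"
proof -
  let ?x = "s (e u)" and ?y = "s (e v)"
  have "red (u \<otimes>\<^bsub>U\<^esub> v) \<ominus>\<^bsub>U\<^esub> (?x \<otimes>\<^bsub>U\<^esub> red v \<oplus>\<^bsub>U\<^esub> ?y \<otimes>\<^bsub>U\<^esub> red u) = red u \<otimes>\<^bsub>U\<^esub> red v"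
  proof -
    have xy: "?x \<in> carrier U" "?y \<in> carrier U" using u v by auto
    have "(u \<otimes>\<^bsub>U\<^esub> v \<ominus>\<^bsub>U\<^esub> ?x \<otimes>\<^bsub>U\<^esub> ?y) \<ominus>\<^bsub>U\<^esub> (?x \<otimes>\<^bsub>U\<^esub> red v \<oplus>\<^bsub>U\<^esub> ?y \<otimes>\<^bsub>U\<^esub> red u) =
        red u \<otimes>\<^bsub>U\<^esub> red v \<oplus>\<^bsub>U\<^esub> (?x \<otimes>\<^bsub>U\<^esub> ?y \<oplus>\<^bsub>U\<^esub> \<ominus>\<^bsub>U\<^esub> (?x \<otimes>\<^bsub>U\<^esub> ?y))"
      using u v xy
      by (simp add: a_minus_def U.l_distr U.r_distr U.l_minus U.r_minus U.minus_add U.a_ac U.m_ac)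
    then show ?thesis using u v xy by (simp add: U.r_neg)
  qed
  moreover have "red u \<otimes>\<^bsub>U\<^esub> red v \<in> I2"
    unfolding aug_ideal_sq_def using u v by (intro ideal_prod.prod red_mem)
  ultimately show ?thesis
    using u v by (simp add: pi_s_eq conormal_smult conormal_add cot_eq_iff)
qed

lemma pi_s_dual_apply: "u \<in> carrier U \<Longrightarrow> pi_s_dual \<H> f u = f (pi_s \<H> u)"
  by (simp add: pi_s_dual_def compose_def)

lemma pi_s_dual_der:
  assumes f: "f \<in> carrier CD"
  shows "pi_s_dual \<H> f \<in> carrier DL"
proof -
  have fc: "f z \<in> carrier A" if "z \<in> carrier C" for z
    using f that by (auto simp: mem_conormal_dual additive_def)
  have fa: "f (z \<oplus>\<^bsub>C\<^esub> w) = f z \<oplus>\<^bsub>A\<^esub> f w" if "z \<in> carrier C" "w \<in> carrier C" for z w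
    using f that by (auto simp: mem_conormal_dual additive_def)
  have fs: "f (a \<odot>\<^bsub>C\<^esub> z) = a \<otimes>\<^bsub>A\<^esub> f z" if "a \<in> carrier A" "z \<in> carrier C" for a z
    using f that by (auto simp: mem_conormal_dual)
  have "pi_s_dual \<H> f \<in> carrier L"
    by (auto simp: mem_ldual additive_def pi_s_dual_apply pi_s_add pi_s_src fc fa fs)
      (simp add: pi_s_dual_def)
  then show ?thesis
    by (auto simp: mem_der_counit pi_s_dual_apply pi_s_mult fc fa fs A.m_comm)
qed

lemma pi_s_of_aug_ideal: "u \<in> I \<Longrightarrow> pi_s \<H> u = cot u"
  by (simp add: pi_s_eq mem_aug_ideal a_minus_def)

lemma pi_s_surj: "z \<in> carrier C \<Longrightarrow> \<exists>u\<in>carrier U. z = pi_s \<H> u"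
  unfolding carrier_conormal using pi_s_of_aug_ideal aug_ideal_sub by blast

lemma pi_s_dual_inj: "inj_on (pi_s_dual \<H>) (carrier CD)"
proof (rule inj_onI)
  fix f g assume fg: "f \<in> carrier CD" "g \<in> carrier CD" and eq: "pi_s_dual \<H> f = pi_s_dual \<H> g"
  show "f = g"
  proof (rule extensionalityI[of _ "carrier C"])
    fix z assume "z \<in> carrier C"
    then obtain u where "u \<in> carrier U" "z = pi_s \<H> u" using pi_s_surj by blast
    then show "f z = g z" using fun_cong[OF eq, of u] by (simp add: pi_s_dual_apply)
  qed (use fg in \<open>auto simp: mem_conormal_dual\<close>)
qed

lemma der_vanishes_on_square:
  assumes d: "\<delta> \<in> carrier DL" and u: "u \<in> I2"
  shows "\<delta> u = \<zero>\<^bsub>A\<^esub>"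
proof -
  have L: "\<delta> \<in> carrier L" using d by (simp add: mem_der_counit)
  have "u \<in> carrier U \<and> \<delta> u = \<zero>\<^bsub>A\<^esub>"
    using u unfolding aug_ideal_sq_def
  proof (induction u rule: ideal_prod.induct)
    case (prod i j)
    then show ?case using d L by (simp add: mem_der_counit mem_aug_ideal)
  next
    case (sum v w)
    then show ?case using L by (simp add: ldual_add)
  qed
  then show ?thesis by simp
qed

text \<open>
  A derivation is constant on the classes modulo the square of the augmentation ideal, hence descends;
  the descended map recovers \<open>\<delta>\<close> because \<open>\<delta>(u - s(\<epsilon>(u))) = \<delta>(u)\<close>.
\<close>

lemma pi_s_dual_surj:
  assumes d: "\<delta> \<in> carrier DL"
  shows "\<exists>f\<in>carrier CD. pi_s_dual \<H> f = \<delta>"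
proof -
  have L: "\<delta> \<in> carrier L" using d by (simp add: mem_der_counit)
  have ad: "additive U A \<delta>" using L by (simp add: mem_ldual)
  note minus = additive_minus[OF U.abelian_group_axioms A.abelian_group_axioms ad]
  \<comment> \<open>the value at a class is read off from an arbitrary representative\<close>
  define f where "f = (\<lambda>z\<in>carrier C. \<delta> (SOME u. u \<in> I \<and> z = cot u))"
  have f: "f (cot u) = \<delta> u" if u: "u \<in> I" for u
  proof -
    define v where "v = (SOME v. v \<in> I \<and> cot u = cot v)"
    have v: "v \<in> I \<and> cot u = cot v"
      unfolding v_def by (rule someI[of _ u]) (use u in simp)
    have uU: "u \<in> carrier U" and vU: "v \<in> carrier U" using u v by (auto simp: mem_aug_ideal)
    have "\<delta> u \<ominus>\<^bsub>A\<^esub> \<delta> v = \<zero>\<^bsub>A\<^esub>"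
      using der_vanishes_on_square[OF d, of "u \<ominus>\<^bsub>U\<^esub> v"] v minus[OF uU vU]
      by (simp add: cot_eq_iff uU vU)
    moreover have "\<delta> u = (\<delta> u \<ominus>\<^bsub>A\<^esub> \<delta> v) \<oplus>\<^bsub>A\<^esub> \<delta> v"
      using L uU vU by (simp add: a_minus_def A.a_assoc A.l_neg)
    ultimately have "\<delta> u = \<delta> v" using L vU by simp
    then show ?thesis using u by (simp add: f_def v_def carrier_conormal)
  qed
  have one: "\<delta> (s a) = \<zero>\<^bsub>A\<^esub>" if "a \<in> carrier A" for a
    using d that by (auto simp: der_counit_def der_counit_carrier_def)
  have "f \<in> carrier CD"
    unfolding mem_conormal_dual
  proof (intro conjI)
    show "f \<in> extensional (carrier C)" by (simp add: f_def)
    have sum: "u \<oplus>\<^bsub>U\<^esub> v \<in> I" if "u \<in> I" "v \<in> I" for u v using that by (simp add: mem_aug_ideal)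
    show "additive C A f"
      using L by (auto simp: additive_def carrier_conormal f conormal_add sum mem_aug_ideal ldual_add)
    have sm: "s a \<otimes>\<^bsub>U\<^esub> u \<in> I" if "a \<in> carrier A" "u \<in> I" for a u
      using that by (simp add: mem_aug_ideal)
    show "\<forall>a\<in>carrier A. \<forall>z\<in>carrier C. f (a \<odot>\<^bsub>C\<^esub> z) = a \<otimes>\<^bsub>A\<^esub> f z"
      using L by (auto simp: carrier_conormal conormal_smult f sm mem_aug_ideal ldual_src)
  qed
  moreover have "pi_s_dual \<H> f = \<delta>"
  proof (rule extensionalityI[of _ "carrier U"])
    fix u assume u: "u \<in> carrier U"
    have "pi_s_dual \<H> f u = \<delta> (red u)"
      using u by (simp add: pi_s_dual_apply pi_s_eq f red_mem)
    also have "\<dots> = \<delta> u \<ominus>\<^bsub>A\<^esub> \<delta> (s (e u))"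
      using u by (intro minus) simp_all
    also have "\<dots> = \<delta> u"
      using u L by (simp add: one a_minus_def)
    finally show "pi_s_dual \<H> f u = \<delta> u" .
  qed (use L in \<open>auto simp: pi_s_dual_def mem_ldual\<close>)
  ultimately show ?thesis by blast
qed

lemma pi_s_dual_add:
  "pi_s_dual \<H> (f \<oplus>\<^bsub>CD\<^esub> g) = pi_s_dual \<H> f \<oplus>\<^bsub>L\<^esub> pi_s_dual \<H> g"
  by (rule extensionalityI[of _ "carrier U"])
    (auto simp: conormal_dual_def ldual_def pi_s_dual_def compose_def)

lemma pi_s_dual_smult: "pi_s_dual \<H> (a \<odot>\<^bsub>CD\<^esub> f) = a \<odot>\<^bsub>L\<^esub> pi_s_dual \<H> f"
  by (rule extensionalityI[of _ "carrier U"])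
    (auto simp: conormal_dual_def ldual_def pi_s_dual_def compose_def)

lemma pi_s_dual_module_iso: "module_iso A CD DL (pi_s_dual \<H>)"
proof -
  have "bij_betw (pi_s_dual \<H>) (carrier CD) (carrier DL)"
    unfolding bij_betw_def using pi_s_dual_inj pi_s_dual_der pi_s_dual_surj by (auto simp: image_iff)
  then show ?thesis
    by (simp add: module_iso_def conormal_dual_module der_counit_module lin_maps_def
        pi_s_dual_der pi_s_dual_add pi_s_dual_smult)
qed

text \<open>
  The image of the injection is the module of derivations, which is closed under commutators; the
  bracket can therefore be pulled back, and compatibility with the injection leaves no choice.
\<close>

lemma conormal_dual_unique_bracket:
  "\<exists>!br. br \<in> carrier CD \<rightarrow>\<^sub>E carrier CD \<rightarrow>\<^sub>E carrier CD \<and> inj_on (pi_s_dual \<H>) (carrier CD) \<and>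
     lie_hom K (k_space \<H> CD) br (k_space \<H> L) (commutator L) (pi_s_dual \<H>)"
proof (rule ex_ex1I)
  let ?\<pi> = "pi_s_dual \<H>"
  let ?inv = "inv_into (carrier CD) ?\<pi>"
  have im: "?\<pi> ` carrier CD = carrier DL"
    using pi_s_dual_module_iso by (simp add: module_iso_def bij_betw_def)
  have comm: "commutator L (?\<pi> f) (?\<pi> g) \<in> ?\<pi> ` carrier CD" if "f \<in> carrier CD" "g \<in> carrier CD" for f g
    unfolding im using that by (intro commutator_der_counit pi_s_dual_der)
  let ?br = "\<lambda>f\<in>carrier CD. \<lambda>g\<in>carrier CD. ?inv (commutator L (?\<pi> f) (?\<pi> g))"
  have closed: "?br f g \<in> carrier CD" if "f \<in> carrier CD" "g \<in> carrier CD" for f g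
    using that inv_into_into[OF comm[OF that]] by simp
  have "lie_hom K (k_space \<H> CD) ?br (k_space \<H> L) (commutator L) ?\<pi>"
  proof (rule lie_algebra_pullback[OF ldual_lie k_space_module[OF conormal_dual_module]])
    show "?\<pi> \<in> lin_maps K (k_space \<H> CD) (k_space \<H> L)"
      using pi_s_dual_der der_counit_sub by (auto simp: lin_maps_def pi_s_dual_add pi_s_dual_smult)
    show "inj_on ?\<pi> (carrier (k_space \<H> CD))" by (simp add: pi_s_dual_inj)
    show "?br f g \<in> carrier (k_space \<H> CD)"
      if "f \<in> carrier (k_space \<H> CD)" "g \<in> carrier (k_space \<H> CD)" for f g
      using closed that by simp
    show "?\<pi> (?br f g) = commutator L (?\<pi> f) (?\<pi> g)"
      if "f \<in> carrier (k_space \<H> CD)" "g \<in> carrier (k_space \<H> CD)" for f g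
      using that f_inv_into_f[OF comm, of f g] by simp
  qed
  moreover have "?br \<in> carrier CD \<rightarrow>\<^sub>E carrier CD \<rightarrow>\<^sub>E carrier CD"
    using closed by auto
  ultimately show "\<exists>br. br \<in> carrier CD \<rightarrow>\<^sub>E carrier CD \<rightarrow>\<^sub>E carrier CD \<and> inj_on ?\<pi> (carrier CD) \<and>
     lie_hom K (k_space \<H> CD) br (k_space \<H> L) (commutator L) ?\<pi>"
    using pi_s_dual_inj by blast
next
  fix br br'
  assume br: "br \<in> carrier CD \<rightarrow>\<^sub>E carrier CD \<rightarrow>\<^sub>E carrier CD \<and> inj_on (pi_s_dual \<H>) (carrier CD) \<and>
      lie_hom K (k_space \<H> CD) br (k_space \<H> L) (commutator L) (pi_s_dual \<H>)"
    and br': "br' \<in> carrier CD \<rightarrow>\<^sub>E carrier CD \<rightarrow>\<^sub>E carrier CD \<and> inj_on (pi_s_dual \<H>) (carrier CD) \<and>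
      lie_hom K (k_space \<H> CD) br' (k_space \<H> L) (commutator L) (pi_s_dual \<H>)"
  have mem: "br f \<in> carrier CD \<rightarrow>\<^sub>E carrier CD" "br' f \<in> carrier CD \<rightarrow>\<^sub>E carrier CD" if "f \<in> carrier CD" for f
    using br br' that by auto
  have "br f g = br' f g" if fg: "f \<in> carrier CD" "g \<in> carrier CD" for f g
  proof (rule inj_onD[OF pi_s_dual_inj])
    show "pi_s_dual \<H> (br f g) = pi_s_dual \<H> (br' f g)"
      using br br' fg by (simp add: lie_hom_def)
  qed (use mem fg in auto)
  then have "br f = br' f" if "f \<in> carrier CD" for f
    using mem[OF that] that by (auto intro: PiE_ext)
  then show "br = br'" using br br' by (auto intro: PiE_ext)
qed

end

theorem lemma5p12:
  fixes K :: "'k ring" and \<H> :: "('k, 'a, 'h) hopf_algebroid"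
  assumes "comm_hopf_algebroid K \<H>"
  shows
    "A_ring_iso (base \<H>) (ldual \<H>) (ldual_unit \<H>) (comod_end \<H>) (comod_end_unit \<H>) (theta \<H>) \<and>
     (\<forall>\<delta>\<in>carrier (comod_end \<H>).
        compose (carrier (tot \<H>)) (counit \<H>) \<delta> \<in> carrier (ldual \<H>) \<and>
        theta \<H> (compose (carrier (tot \<H>)) (counit \<H>) \<delta>) = \<delta>) \<and>
     module (base \<H>) (ldual \<H>) \<and> submodule (carrier (der_counit K \<H>)) (base \<H>) (ldual \<H>) \<and>
     module (base \<H>) (comod_end \<H>) \<and> submodule (carrier (der_comod K \<H>)) (base \<H>) (comod_end \<H>) \<and>
     lie_algebra K (k_space \<H> (ldual \<H>)) (commutator (ldual \<H>)) \<and>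
     lie_algebra K (k_space \<H> (der_counit K \<H>)) (commutator (ldual \<H>)) \<and>
     lie_algebra K (k_space \<H> (der_comod K \<H>)) (commutator (comod_end \<H>)) \<and>
     (\<forall>\<delta>\<in>carrier (der_counit K \<H>). \<forall>\<delta>'\<in>carrier (der_counit K \<H>). \<forall>u\<in>carrier (tot \<H>).
        commutator (ldual \<H>) \<delta> \<delta>' u =
          \<delta> (sweedler (tot \<H>) (comult \<H> u) (\<lambda>x y. x \<otimes>\<^bsub>tot \<H>\<^esub> tgt \<H> (\<delta>' y))) \<ominus>\<^bsub>base \<H>\<^esub>
          \<delta>' (sweedler (tot \<H>) (comult \<H> u) (\<lambda>x y. x \<otimes>\<^bsub>tot \<H>\<^esub> tgt \<H> (\<delta> y)))) \<and>
     (\<exists>\<theta>'. (\<forall>\<delta>\<in>carrier (der_counit K \<H>). theta \<H> \<delta> = \<theta>' \<delta>) \<and>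
        module_iso (base \<H>) (der_counit K \<H>) (der_comod K \<H>) \<theta>' \<and>
        lie_hom K (k_space \<H> (der_counit K \<H>)) (commutator (ldual \<H>))
          (k_space \<H> (der_comod K \<H>)) (commutator (comod_end \<H>)) \<theta>') \<and>
     (\<exists>\<phi>. module_iso (base \<H>) (conormal_dual \<H>) (der_counit K \<H>) \<phi> \<and>
        (\<forall>f\<in>carrier (conormal_dual \<H>). pi_s_dual \<H> f = \<phi> f)) \<and>
     module (base \<H>) (conormal \<H>) \<and>
     (\<exists>!br. br \<in> carrier (conormal_dual \<H>) \<rightarrow>\<^sub>E carrier (conormal_dual \<H>) \<rightarrow>\<^sub>E carrier (conormal_dual \<H>) \<and>
        inj_on (pi_s_dual \<H>) (carrier (conormal_dual \<H>)) \<and>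
        lie_hom K (k_space \<H> (conormal_dual \<H>)) br
          (k_space \<H> (ldual \<H>)) (commutator (ldual \<H>)) (pi_s_dual \<H>))"
proof -
  interpret comm_hopf_algebroid K \<H> by fact
  show ?thesis
    using der_counit_lie_hom der_comod_lie_hom theta_der_module_iso
      theta_der_lie_hom pi_s_dual_module_iso
    by (intro conjI conormal_dual_unique_bracket exI[of _ "\<theta>"] exI[of _ "pi_s_dual \<H>"]
        A_ring_iso_theta ldual_module comod_end_module der_counit_submodule der_comod_submodule
        ldual_lie conormal_module)
      (auto simp: lie_hom_def counit_comp_comod_end theta_counit_comp
        commutator_ldual_apply theta_eq[symmetric] subsetD[OF der_counit_sub])
qed

end
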